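(* Let $p$ be a prime and $n\ge1$. The simplex ${\rm IRS}_\tau(\mathcal{A}_{n,p})$ of shift-invariant Borel probability measures on ${\rm Sub}(\mathcal{A}_{n,p})$ is a Poulsen simplex. Therefore ${\rm IRS}_0(\mathcal{L}_{n,p})={\rm IRS}_\ast(\mathcal{L}_{n,p})$ is also a Poulsen simplex.
   Context: $\mathcal{A}_{n,p}=\bigoplus_{\mathbb{Z}}(\mathbb{Z}/p\mathbb{Z})^n$ and $\mathcal{L}_{n,p}=\mathcal{A}_{n,p}\rtimes\mathbb{Z}$, $\mathbb{Z}$ acting by the shift $\tau$, $(\tau\omega)_i=\omega_{i+1}$. ${\rm Sub}(G)$ is the compact space of subgroups of $G$ with the topology induced from $\{0,1\}^G$. ${\rm IRS}_\tau(\mathcal{A}_{n,p})$ is the set of Borel probability measures on ${\rm Sub}(\mathcal{A}_{n,p})$ invariant under the map $H\mapsto\tau H$, with the weak$^*$ topology. For a subgroup $V\le\mathcal{L}_{n,p}$ let $\pi_1(V)\in\{0,1,2,\dots\}$ be such that the projection of $V$ to $\mathbb{Z}$ is $\pi_1(V)\mathbb{Z}$. ${\rm IRS}_0(\mathcal{L}_{n,p})$ is the set of conjugation-invariant Borel probability measures $\mu$ on ${\rm Sub}(\mathcal{L}_{n,p})$ with $\mu(\pi_1^{-1}(0))=1$; ${\rm IRS}_\ast(\mathcal{L}_{n,p})$ is the set of conjugation-invariant Borel probability measures supported on the perfect kernel of ${\rm Sub}(\mathcal{L}_{n,p})$ (the unique perfect subset with countable complement). A Poulsen simplex is a simplex whose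 extreme points are dense. *)

theory Defs
  imports "HOL-Probability.Probability" "HOL-Algebra.Group"
begin

definition borel_of :: "'a topology \<Rightarrow> 'a measure" where
  "borel_of T = sigma (topspace T) {U. openin T U}"

definition prob_measures :: "'a topology \<Rightarrow> 'a measure set" where
  "prob_measures T = {\<mu>. prob_space \<mu> \<and> sets \<mu> = sets (borel_of T) \<and> space \<mu> = topspace T}"

definition weak_star :: "'a topology \<Rightarrow> 'a measure set \<Rightarrow> 'a measure topology" where
  "weak_star T K = subtopology
     (topology_generated_by
        {{\<mu>. (\<integral>x. f x \<partial>\<mu>) \<in> U} | f U. continuous_map T euclideanreal f \<and> open U}) K"

definition mix :: "real \<Rightarrow> 'a measure \<Rightarrow> 'a measure \<Rightarrow> 'a measure" where
  "mix t \<mu> \<nu> = measure_of (space \<mu>) (sets \<mu>)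
      (\<lambda>A. ennreal t * emeasure \<mu> A + ennreal (1 - t) * emeasure \<nu> A)"

definition convex_measures :: "'a measure set \<Rightarrow> bool" where
  "convex_measures K \<longleftrightarrow> (\<forall>\<mu>\<in>K. \<forall>\<nu>\<in>K. \<forall>t. 0 \<le> t \<and> t \<le> 1 \<longrightarrow> mix t \<mu> \<nu> \<in> K)"

definition extreme_measures :: "'a measure set \<Rightarrow> 'a measure set" where
  "extreme_measures K = {\<mu>\<in>K. \<forall>\<nu>1\<in>K. \<forall>\<nu>2\<in>K. \<forall>t. 0 < t \<and> t < 1 \<and> \<mu> = mix t \<nu>1 \<nu>2
        \<longrightarrow> \<nu>1 = \<mu> \<and> \<nu>2 = \<mu>}"

text \<open>(Metrizable) Choquet simplex: a weak*-compact convex set of Borel probability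
  measures in which every point is the barycenter of a unique probability measure
  concentrated on the extreme points.\<close>
definition choquet_simplex :: "'a topology \<Rightarrow> 'a measure set \<Rightarrow> bool" where
  "choquet_simplex T K \<longleftrightarrow>
     K \<subseteq> prob_measures T \<and> K \<noteq> {} \<and> convex_measures K \<and>
     compactin (weak_star T (prob_measures T)) K \<and>
     (\<forall>\<mu>\<in>K. \<exists>!m. prob_space m \<and> space m = K \<and>
                 sets m = sets (borel_of (weak_star T K)) \<and>
                 extreme_measures K \<in> sets m \<and> emeasure m (extreme_measures K) = 1 \<and>
                 (\<forall>A\<in>sets (borel_of T). emeasure \<mu> A = (\<integral>\<^sup>+\<nu>. emeasure \<nu> A \<partial>m)))"

definition poulsen_simplex :: "'a topology \<Rightarrow> 'a measure set \<Rightarrow> bool" where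
  "poulsen_simplex T K \<longleftrightarrow>
     choquet_simplex T K \<and> (weak_star T K) closure_of (extreme_measures K) = K"

definition Sub :: "('g, 'b) monoid_scheme \<Rightarrow> 'g set set" where
  "Sub G = {H. subgroup H G}"

text \<open>Topology on Sub(G) induced from {0,1}^G (product topology).\<close>
definition Sub_top :: "('g, 'b) monoid_scheme \<Rightarrow> 'g set topology" where
  "Sub_top G = subtopology
     (topology_generated_by ({{H. x \<in> H} | x. x \<in> carrier G} \<union> {{H. x \<notin> H} | x. x \<in> carrier G}))
     (Sub G)"

text \<open>Elements of A_{n,p}: omega i j is the j-th coordinate (j < n) at position i in Z,
  valued in {0..<p}, finitely supported in i.\<close>
definition A_carrier :: "nat \<Rightarrow> nat \<Rightarrow> (int \<Rightarrow> nat \<Rightarrow> nat) set" where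
  "A_carrier n p = {\<omega>. (\<forall>i j. \<omega> i j < p) \<and> (\<forall>i j. n \<le> j \<longrightarrow> \<omega> i j = 0)
                       \<and> finite {i. \<omega> i \<noteq> (\<lambda>_. 0)}}"

definition A_add :: "nat \<Rightarrow> (int \<Rightarrow> nat \<Rightarrow> nat) \<Rightarrow> (int \<Rightarrow> nat \<Rightarrow> nat) \<Rightarrow> (int \<Rightarrow> nat \<Rightarrow> nat)" where
  "A_add p \<omega> \<omega>' = (\<lambda>i j. (\<omega> i j + \<omega>' i j) mod p)"

definition A_grp :: "nat \<Rightarrow> nat \<Rightarrow> (int \<Rightarrow> nat \<Rightarrow> nat) monoid" where
  "A_grp n p = \<lparr>carrier = A_carrier n p, mult = A_add p, one = (\<lambda>_ _. 0)\<rparr>"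

definition shift :: "int \<Rightarrow> (int \<Rightarrow> nat \<Rightarrow> nat) \<Rightarrow> (int \<Rightarrow> nat \<Rightarrow> nat)" where
  "shift k \<omega> = (\<lambda>i. \<omega> (i + k))"

definition L_grp :: "nat \<Rightarrow> nat \<Rightarrow> ((int \<Rightarrow> nat \<Rightarrow> nat) \<times> int) monoid" where
  "L_grp n p = \<lparr>carrier = A_carrier n p \<times> UNIV,
               mult = (\<lambda>(a, k) (b, l). (A_add p a (shift k b), k + l)),
               one = ((\<lambda>_ _. 0), 0)\<rparr>"

definition IRS_tau :: "nat \<Rightarrow> nat \<Rightarrow> (int \<Rightarrow> nat \<Rightarrow> nat) set measure set" where
  "IRS_tau n p = {\<mu>\<in>prob_measures (Sub_top (A_grp n p)).
      \<forall>B\<in>sets \<mu>. emeasure \<mu> {H\<in>Sub (A_grp n p). shift 1 ` H \<in> B} = emeasure \<mu> B}"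

definition IRS_L :: "nat \<Rightarrow> nat \<Rightarrow> ((int \<Rightarrow> nat \<Rightarrow> nat) \<times> int) set measure set" where
  "IRS_L n p = {\<mu>\<in>prob_measures (Sub_top (L_grp n p)).
      \<forall>g\<in>carrier (L_grp n p). \<forall>B\<in>sets \<mu>.
        emeasure \<mu> {V\<in>Sub (L_grp n p).
            (\<lambda>h. g \<otimes>\<^bsub>L_grp n p\<^esub> h \<otimes>\<^bsub>L_grp n p\<^esub> inv\<^bsub>L_grp n p\<^esub> g) ` V \<in> B}
        = emeasure \<mu> B}"

definition pi1 :: "('a \<times> int) set \<Rightarrow> nat" where
  "pi1 V = (THE m. snd ` V = {int m * k | k. True})"

definition IRS_0 :: "nat \<Rightarrow> nat \<Rightarrow> ((int \<Rightarrow> nat \<Rightarrow> nat) \<times> int) set measure set" where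
  "IRS_0 n p = {\<mu>\<in>IRS_L n p. emeasure \<mu> {V\<in>Sub (L_grp n p). pi1 V = 0} = 1}"

definition perfect_kernel :: "'a topology \<Rightarrow> 'a set" where
  "perfect_kernel T = (THE P. closedin T P \<and> T derived_set_of P = P \<and> countable (topspace T - P))"

definition IRS_star :: "nat \<Rightarrow> nat \<Rightarrow> ((int \<Rightarrow> nat \<Rightarrow> nat) \<times> int) set measure set" where
  "IRS_star n p = {\<mu>\<in>IRS_L n p. emeasure \<mu> (perfect_kernel (Sub_top (L_grp n p))) = 1}"

end

theory Submission
  imports Defs "HOL-Algebra.Generated_Groups"
begin

text \<open>
  The space of subgroups of a countable group is compact and zero-dimensional, so Borel probability
  measures on it are the same as finitely additive probabilities on its countably many clopen
  sets, and the weak* topology is convergence on clopen sets.  By Birkhoff's theorem the orbit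
  averages of clopen sets define an invariant measure attached to almost every point; a variance
  computation shows that it is almost surely ergodic, and pushing a measure forward along this
  map is its unique decomposition into extreme points.

  For density, cut the integers into blocks of length \<open>m\<close>.  Given finitely many subgroups
  \<open>H\<^sub>0, \<dots>, H\<^sub>l\<^sub>-\<^sub>1\<close> of the base, the configurations whose \<open>q\<close>-th block lies in
  \<open>H\<^sub>q\<close> for every \<open>q\<close>, the index being read modulo \<open>l\<close>, form a shift-periodic subgroup
  which, away from the ends of the blocks, looks like the given ones.  If the \<open>H\<^sub>k\<close> are
  distributed approximately according to an invariant measure, the uniform measure on the finite orbit of this subgroup
  approximates that measure, and it is ergodic.

  A subgroup of the lamplighter group outside the base is finitely generated, by a leading
  coefficient argument, and there are only countably many of these; the subgroups of the base
  form a closed set without isolated points, which is therefore the perfect kernel.  On it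
  conjugation acts through the shift.
\<close>

section \<open>Borel measures on zero-dimensional compact spaces\<close>

text \<open>Both simplices come from one construction: a zero-dimensional compact space, a
  continuous map \<open>T\<close> and a closed set \<open>Y\<close> that every measure must charge
  fully. For the base \<open>Y\<close> is the whole space, for the lamplighter group it is the set
  of subgroups of the base. The difficulty in the simplex property is that the decomposition must be
  a measure on the Borel sets of the weak* topology, and unique there. The component of a point is
  therefore defined without reference to any measure: one map serves all invariant measures, and
  ergodicity becomes the equality of a second moment with a square, an integral condition that is
  visibly measurable. The difficulty in density is the loss at the ends of the blocks. Its width
  depends only on the clopen sets tested, so it is fixed before the block length is chosen. What is
  sampled are averages along a whole block: they have the same integral as the clopen indicator, and
  one sampled subgroup accounts for a whole block of consecutive shifts.\<close>

lemma space_borel_of [simp]: "space (borel_of T) = topspace T"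
  by (auto simp: borel_of_def space_measure_of_conv)

lemma sets_borel_of: "sets (borel_of T) = sigma_sets (topspace T) {U. openin T U}"
  unfolding borel_of_def by (rule sets_measure_of) (auto dest: openin_subset)

lemma borel_of_openin: "openin T U \<Longrightarrow> U \<in> sets (borel_of T)"
  by (auto simp: sets_borel_of)

lemma borel_of_closedin: "closedin T U \<Longrightarrow> U \<in> sets (borel_of T)"
proof -
  assume U: "closedin T U"
  then have "topspace T - (topspace T - U) \<in> sets (borel_of T)"
    by (intro sets.compl_sets[of _ "borel_of T", simplified] borel_of_openin) (auto simp: closedin_def)
  with U show ?thesis
    by (simp add: double_diff closedin_subset)
qed

lemma borel_of_measurableI:
  assumes "\<And>x. x \<in> space M \<Longrightarrow> f x \<in> topspace T"
    and "\<And>U. openin T U \<Longrightarrow> f -` U \<inter> space M \<in> sets M"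
  shows "f \<in> M \<rightarrow>\<^sub>M borel_of T"
  unfolding borel_of_def
  by (rule measurable_measure_of) (use assms in \<open>auto dest: openin_subset\<close>)

lemma measurable_continuous_map:
  assumes "continuous_map T S f"
  shows "f \<in> borel_of T \<rightarrow>\<^sub>M borel_of S"
proof (rule borel_of_measurableI)
  show "f x \<in> topspace S" if "x \<in> space (borel_of T)" for x
    using that assms by (auto simp: continuous_map_def)
  show "f -` U \<inter> space (borel_of T) \<in> sets (borel_of T)" if "openin S U" for U
    using that assms openin_continuous_map_preimage[OF assms that]
    by (auto intro!: borel_of_openin simp: vimage_def Int_def conj_commute)
qed

lemma borel_measurable_continuous_map:
  fixes f :: "'a \<Rightarrow> real"
  assumes "continuous_map T euclideanreal f"
  shows "f \<in> borel_measurable (borel_of T)"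
proof (rule borel_measurableI)
  fix S :: "real set" assume "open S"
  then show "f -` S \<inter> space (borel_of T) \<in> sets (borel_of T)"
    using openin_continuous_map_preimage[OF assms, of S]
    by (auto intro!: borel_of_openin simp: vimage_def Int_def conj_commute)
qed

lemma prob_measures_eq: "prob_measures T = space (prob_algebra (borel_of T))"
  by (auto simp: prob_measures_def space_prob_algebra dest: sets_eq_imp_space_eq)

lemma prob_measuresD:
  assumes "\<mu> \<in> prob_measures T"
  shows "prob_space \<mu>" "sets \<mu> = sets (borel_of T)" "space \<mu> = topspace T"
  using assms by (auto simp: prob_measures_def)

lemma prob_measuresI:
  assumes "prob_space \<mu>" "sets \<mu> = sets (borel_of T)"
  shows "\<mu> \<in> prob_measures T"
  using assms sets_eq_imp_space_eq[OF assms(2)] by (auto simp: prob_measures_def)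

lemma topspace_weak_star [simp]: "topspace (weak_star T K) = K"
proof -
  \<comment> \<open>The zero function with \<open>U = UNIV\<close> is among the generators, so the
    generated topology lives on all measures and only the restriction to \<open>K\<close> bounds
    it.\<close>
  have "UNIV \<in> {{\<mu>. (\<integral>x. f x \<partial>\<mu>) \<in> U} | f U. continuous_map T euclideanreal f \<and> open U}"
    by (rule CollectI, rule exI[of _ "\<lambda>_. 0"], rule exI[of _ UNIV]) auto
  then show ?thesis
    by (auto simp: weak_star_def)
qed

lemma continuous_map_weak_star:
  assumes "continuous_map T euclideanreal f"
  shows "continuous_map (weak_star T K) euclideanreal (\<lambda>\<mu>. \<integral>x. f x \<partial>\<mu>)"
  unfolding weak_star_def
proof (rule continuous_map_from_subtopology)
  let ?S = "{{\<mu>. (\<integral>x. f x \<partial>\<mu>) \<in> U} | f U. continuous_map T euclideanreal f \<and> open U}"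
  have "UNIV \<in> ?S"
    by (rule CollectI, rule exI[of _ "\<lambda>_. 0"], rule exI[of _ UNIV]) auto
  then have top: "\<Union>?S = UNIV"
    by blast
  show "continuous_map (topology_generated_by ?S) euclideanreal (\<lambda>\<mu>. \<integral>x. f x \<partial>\<mu>)"
    unfolding continuous_map_def[of "topology_generated_by ?S"] topology_generated_by_topspace top
  proof (intro conjI allI impI)
    show "(\<lambda>\<mu>. \<integral>x. f x \<partial>\<mu>) \<in> UNIV \<rightarrow> topspace euclideanreal" by simp
    fix U :: "real set" assume "openin euclideanreal U"
    then show "openin (topology_generated_by ?S) {\<mu> \<in> UNIV. (\<integral>x. f x \<partial>\<mu>) \<in> U}"
      using assms by (intro topology_generated_by_Basis) auto
  qed
qed

lemma sets_mix [simp]: "sets (mix t \<mu> \<nu>) = sets \<mu>"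
  and space_mix [simp]: "space (mix t \<mu> \<nu>) = space \<mu>"
  by (auto simp: mix_def sets.space_closed space_measure_of_conv)

lemma emeasure_mix:
  assumes "sets \<nu> = sets \<mu>" "A \<in> sets \<mu>"
  shows "emeasure (mix t \<mu> \<nu>) A = ennreal t * emeasure \<mu> A + ennreal (1 - t) * emeasure \<nu> A"
  unfolding mix_def
proof (rule emeasure_measure_of_sigma)
  show "sigma_algebra (space \<mu>) (sets \<mu>)" ..
  show "positive (sets \<mu>) (\<lambda>A. ennreal t * emeasure \<mu> A + ennreal (1 - t) * emeasure \<nu> A)"
    by (auto simp: positive_def)
  show "countably_additive (sets \<mu>) (\<lambda>A. ennreal t * emeasure \<mu> A + ennreal (1 - t) * emeasure \<nu> A)"
    using assms(1)
    by (auto simp: countably_additive_def suminf_add[symmetric] ennreal_suminf_cmult suminf_emeasure)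
  show "A \<in> sets \<mu>" by fact
qed

lemma prob_space_mix:
  assumes "prob_space \<mu>" "prob_space \<nu>" "sets \<nu> = sets \<mu>" "0 \<le> t" "t \<le> 1"
  shows "prob_space (mix t \<mu> \<nu>)"
proof
  have "emeasure \<nu> (space \<mu>) = 1"
    using assms prob_space.emeasure_space_1[of \<nu>] sets_eq_imp_space_eq[of \<nu> \<mu>] by simp
  then show "emeasure (mix t \<mu> \<nu>) (space (mix t \<mu> \<nu>)) = 1"
    using assms prob_space.emeasure_space_1[of \<mu>]
    by (simp add: emeasure_mix ennreal_plus[symmetric] del: ennreal_plus)
qed

lemma measure_mix:
  assumes "prob_space \<mu>" "prob_space \<nu>" "sets \<nu> = sets \<mu>" "A \<in> sets \<mu>" "0 \<le> t" "t \<le> 1"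
  shows "measure (mix t \<mu> \<nu>) A = t * measure \<mu> A + (1 - t) * measure \<nu> A"
proof -
  interpret \<mu>: prob_space \<mu> by fact
  interpret \<nu>: prob_space \<nu> by fact
  have "emeasure (mix t \<mu> \<nu>) A = ennreal (t * measure \<mu> A + (1 - t) * measure \<nu> A)"
    using assms(5,6)
    by (simp add: emeasure_mix[OF assms(3,4)] \<mu>.emeasure_eq_measure \<nu>.emeasure_eq_measure
        ennreal_mult[symmetric] ennreal_plus[symmetric] del: ennreal_plus)
  then show ?thesis
    using assms(5,6) by (intro measure_eq_emeasure_eq_ennreal) auto
qed

section \<open>Clopen sets and the measures determined by them\<close>

definition clopens :: "'a topology \<Rightarrow> 'a set set" where
  "clopens X = {C. openin X C \<and> closedin X C}"

text \<open>Second-countable Stone spaces: \<open>clopen_basis\<close> is zero-dimensionality, and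
  countability of the clopen algebra stands in for metrizability. It also lets almost-everywhere
  statements, one for each clopen set, be combined.\<close>

locale stone_space =
  fixes X :: "'a topology"
  assumes compact: "compact_space X"
    and Hausdorff: "Hausdorff_space X"
    and countable_clopens: "countable (clopens X)"
    and clopen_basis: "\<And>U x. openin X U \<Longrightarrow> x \<in> U \<Longrightarrow> \<exists>C\<in>clopens X. x \<in> C \<and> C \<subseteq> U"
begin

lemma clopens_sub: "C \<in> clopens X \<Longrightarrow> C \<subseteq> topspace X"
  by (auto simp: clopens_def dest: openin_subset)

lemma clopens_Un: "C \<in> clopens X \<Longrightarrow> D \<in> clopens X \<Longrightarrow> C \<union> D \<in> clopens X"
  and clopens_Int: "C \<in> clopens X \<Longrightarrow> D \<in> clopens X \<Longrightarrow> C \<inter> D \<in> clopens X"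
  and clopens_Diff: "C \<in> clopens X \<Longrightarrow> D \<in> clopens X \<Longrightarrow> C - D \<in> clopens X"
  and clopens_top: "topspace X \<in> clopens X"
  and clopens_empty: "{} \<in> clopens X"
  by (auto simp: clopens_def)

lemma clopens_sets: "C \<in> clopens X \<Longrightarrow> C \<in> sets (borel_of X)"
  by (auto simp: clopens_def borel_of_openin)

lemma clopens_measurable: "\<mu> \<in> prob_measures X \<Longrightarrow> C \<in> clopens X \<Longrightarrow> C \<in> sets \<mu>"
  by (auto simp: prob_measuresD(2) clopens_sets)

lemma algebra_clopens: "algebra (topspace X) (clopens X)"
  unfolding algebra_iff_Un
  using clopens_sub by (auto simp: clopens_Un clopens_empty clopens_Diff clopens_top)

lemma openin_eq_Union_clopens: "openin X U \<Longrightarrow> U = \<Union>{C\<in>clopens X. C \<subseteq> U}"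
  using clopen_basis by blast

text \<open>An open set is the union of the clopen sets inside it, and there are only countably
  many. The clopen sets are thus an intersection-stable generator, so equality of measures and
  measurability of measure-valued maps are checked on them alone.\<close>

lemma sets_borel_of_clopens: "sets (borel_of X) = sigma_sets (topspace X) (clopens X)"
proof
  have "U \<in> sigma_sets (topspace X) (clopens X)" if "openin X U" for U
  proof -
    have "countable {C\<in>clopens X. C \<subseteq> U}"
      by (rule countable_subset[OF _ countable_clopens]) auto
    then have "\<Union>{C\<in>clopens X. C \<subseteq> U} \<in> sigma_sets (topspace X) (clopens X)"
      by (intro sigma_sets_UNION) auto
    then show ?thesis using openin_eq_Union_clopens[OF that] by simp
  qed
  then show "sets (borel_of X) \<subseteq> sigma_sets (topspace X) (clopens X)"
    unfolding sets_borel_of by (intro sigma_sets_mono) auto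
  show "sigma_sets (topspace X) (clopens X) \<subseteq> sets (borel_of X)"
    unfolding sets_borel_of by (intro sigma_sets_mono') (auto simp: clopens_def)
qed

lemma Int_stable_clopens: "Int_stable (clopens X)"
  by (auto simp: Int_stable_def clopens_Int)

lemma measure_eqI_clopens:
  assumes "\<mu> \<in> prob_measures X" "\<nu> \<in> prob_measures X"
    and "\<And>C. C \<in> clopens X \<Longrightarrow> measure \<mu> C = measure \<nu> C"
  shows "\<mu> = \<nu>"
proof -
  interpret \<mu>: prob_space \<mu> using assms by (simp add: prob_measuresD)
  interpret \<nu>: prob_space \<nu> using assms by (simp add: prob_measuresD)
  show ?thesis
  proof (rule measure_eqI_generator_eq[where E="clopens X" and \<Omega>="topspace X" and A="\<lambda>_. topspace X"])
    show "clopens X \<subseteq> Pow (topspace X)" using clopens_sub by auto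
    show "sets \<mu> = sigma_sets (topspace X) (clopens X)" "sets \<nu> = sigma_sets (topspace X) (clopens X)"
      using assms sets_borel_of_clopens by (auto simp: prob_measuresD)
  qed (use assms in \<open>auto simp: Int_stable_clopens clopens_top \<mu>.emeasure_eq_measure \<nu>.emeasure_eq_measure\<close>)
qed

text \<open>List the clopen sets disjoint from \<open>Z\<close> and remove more and more of them.
  With continuity from above, full measure of a closed set can then be tested on its clopen
  supersets.\<close>

lemma closed_decseq:
  assumes "closedin X Z"
  obtains A where "range A \<subseteq> clopens X" "decseq A" "(\<Inter>i::nat. A i) = Z"
proof -
  let ?F = "{C\<in>clopens X. C \<inter> Z = {}}"
  have ne: "?F \<noteq> {}" using clopens_empty by auto
  have cF: "countable ?F" by (rule countable_subset[OF _ countable_clopens]) auto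
  define g where "g = from_nat_into ?F"
  have g: "range g = ?F" unfolding g_def using ne cF by (rule range_from_nat_into)
  have gin: "g i \<in> clopens X" "g i \<inter> Z = {}" for i
    using g by auto
  define A where "A i = topspace X - (\<Union>j\<le>i. g j)" for i
  have UN: "(\<Union>j\<le>i. g j) \<in> clopens X" for i
    by (induction i) (auto simp: gin atMost_Suc clopens_Un)
  have "range A \<subseteq> clopens X"
    by (auto simp: A_def intro!: clopens_Diff clopens_top UN)
  moreover have "decseq A"
    by (auto simp: decseq_def A_def)
  moreover have "(\<Inter>i. A i) = topspace X - \<Union>?F"
    unfolding g[symmetric] A_def by auto
  moreover have "\<Union>?F = topspace X - Z"
  proof -
    have "openin X (topspace X - Z)" using assms by (simp add: closedin_def)
    from openin_eq_Union_clopens[OF this] show ?thesis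
      using clopens_sub by blast
  qed
  ultimately show ?thesis using that[of A] closedin_subset[OF assms] by (simp add: double_diff)
qed

lemma closed_full_measure:
  assumes "\<mu> \<in> prob_measures X" "closedin X Z"
    and "\<And>C. C \<in> clopens X \<Longrightarrow> Z \<subseteq> C \<Longrightarrow> measure \<mu> C = 1"
  shows "emeasure \<mu> Z = 1"
proof -
  interpret \<mu>: prob_space \<mu> using assms by (simp add: prob_measuresD)
  obtain A where A: "range A \<subseteq> clopens X" "decseq A" "(\<Inter>i::nat. A i) = Z"
    using closed_decseq[OF assms(2)] by blast
  have "(\<lambda>i. measure \<mu> (A i)) \<longlonglongrightarrow> measure \<mu> (\<Inter>i. A i)"
    using A clopens_measurable[OF assms(1)] by (intro \<mu>.finite_Lim_measure_decseq) auto
  moreover have "measure \<mu> (A i) = 1" for i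
    using A assms(3)[of "A i"] by auto
  ultimately have "(\<lambda>i. 1) \<longlonglongrightarrow> measure \<mu> Z"
    using A(3) by simp
  then have "measure \<mu> Z = 1"
    by (metis LIMSEQ_unique tendsto_const)
  then show ?thesis by (simp add: \<mu>.emeasure_eq_measure)
qed

text \<open>Caratheodory's extension, where continuity at the empty set is automatic: clopen sets
  are compact, so a decreasing sequence of them with empty intersection is empty from some index on.
  Measures obtained from limits of averages or from Tychonoff compactness arise here.\<close>

lemma finitely_additive_extends:
  fixes f :: "'a set \<Rightarrow> real"
  assumes nonneg: "\<And>C. C \<in> clopens X \<Longrightarrow> 0 \<le> f C" and total: "f (topspace X) = 1"
    and add: "\<And>C D. C \<in> clopens X \<Longrightarrow> D \<in> clopens X \<Longrightarrow> C \<inter> D = {} \<Longrightarrow> f (C \<union> D) = f C + f D"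
  shows "\<exists>\<mu>\<in>prob_measures X. \<forall>C\<in>clopens X. measure \<mu> C = f C"
proof -
  interpret algebra "topspace X" "clopens X" by (rule algebra_clopens)
  have f0: "f {} = 0"
    using add[of "{}" "{}"] by (simp add: clopens_empty)
  have "\<exists>\<mu> :: 'a set \<Rightarrow> ennreal. (\<forall>s\<in>clopens X. \<mu> s = ennreal (f s)) \<and>
      measure_space (topspace X) (sigma_sets (topspace X) (clopens X)) \<mu>"
  proof (rule caratheodory_empty_continuous)
    show "positive (clopens X) (\<lambda>s. ennreal (f s))"
      by (simp add: positive_def f0)
    show "additive (clopens X) (\<lambda>s. ennreal (f s))"
      by (simp add: additive_def add ennreal_plus nonneg)
    show "ennreal (f A) \<noteq> \<infinity>" for A by simp
    fix A :: "nat \<Rightarrow> 'a set" assume A: "range A \<subseteq> clopens X" "decseq A" "(\<Inter>i. A i) = {}"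
    have "\<exists>i. A i = {}"
    proof (rule ccontr)
      assume ne: "\<nexists>i. A i = {}"
      have "\<Inter>(range A) \<noteq> {}"
      proof (rule compact_space_imp_nest[OF compact])
        show "decseq A" by fact
      qed (use A ne in \<open>auto simp: clopens_def\<close>)
      with A show False by simp
    qed
    then obtain i where "A i = {}" by blast
    then have "A j = {}" if "i \<le> j" for j
      using A(2) that by (auto simp: decseq_def)
    then have "eventually (\<lambda>j. ennreal (f (A j)) = 0) sequentially"
      unfolding eventually_sequentially by (intro exI[of _ i]) (simp add: f0)
    then show "(\<lambda>i. ennreal (f (A i))) \<longlonglongrightarrow> 0"
      by (rule tendsto_eventually)
  qed
  then obtain m where m: "\<forall>s\<in>clopens X. m s = ennreal (f s)"
    "measure_space (topspace X) (sigma_sets (topspace X) (clopens X)) m" by blast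
  define \<mu> where "\<mu> = measure_of (topspace X) (clopens X) m"
  have sub: "clopens X \<subseteq> Pow (topspace X)" using clopens_sub by auto
  have sets: "sets \<mu> = sets (borel_of X)"
    using sub by (simp add: \<mu>_def sets_borel_of_clopens)
  have em: "emeasure \<mu> C = ennreal (f C)" if "C \<in> clopens X" for C
    using m that sub unfolding \<mu>_def
    by (subst emeasure_measure_of[OF refl]) (auto simp: measure_space_def)
  have "prob_space \<mu>"
    using em[OF clopens_top] sets_eq_imp_space_eq[OF sets]
    by (intro prob_spaceI) (simp add: total)
  then have "\<mu> \<in> prob_measures X" using sets by (rule prob_measuresI)
  moreover have "\<forall>C\<in>clopens X. measure \<mu> C = f C"
    by (simp add: measure_def em nonneg)
  ultimately show ?thesis by blast
qed

lemma continuous_map_indicator: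
  assumes "C \<in> clopens X"
  shows "continuous_map X euclideanreal (indicator C)"
  unfolding continuous_map_def
proof (intro conjI allI impI)
  fix U :: "real set"
  have "{x \<in> topspace X. indicator C x \<in> U} =
    (if 1 \<in> U then C else {}) \<union> (if 0 \<in> U then topspace X - C else {})"
    using clopens_sub[OF assms] by (auto simp: indicator_def)
  then show "openin X {x \<in> topspace X. indicator C x \<in> U}"
    using assms by (auto simp: clopens_def)
qed auto

lemma continuous_map_eval:
  assumes "C \<in> clopens X" "K \<subseteq> prob_measures X"
  shows "continuous_map (weak_star X K) euclideanreal (\<lambda>\<mu>. measure \<mu> C)"
proof (rule continuous_map_eq)
  show "continuous_map (weak_star X K) euclideanreal (\<lambda>\<mu>. \<integral>x. indicator C x \<partial>\<mu>)"
    by (rule continuous_map_weak_star[OF continuous_map_indicator[OF assms(1)]])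
  show "(\<integral>x. indicator C x \<partial>\<mu>) = measure \<mu> C" if "\<mu> \<in> topspace (weak_star X K)" for \<mu>
    using that assms clopens_sub[OF assms(1)]
    by (auto simp: Int_absorb2 prob_measuresD)
qed

text \<open>By compactness finitely many clopen sets, on each of which \<open>f\<close> stays within
  \<open>\<delta>\<close> of a constant, cover the space; made disjoint, they carry the step
  function.\<close>

lemma approx_by_clopens:
  fixes f :: "'a \<Rightarrow> real"
  assumes f: "continuous_map X euclideanreal f" and "0 < \<delta>"
  obtains l :: "(real \<times> 'a set) list" where "set l \<subseteq> UNIV \<times> clopens X"
    "\<And>x. x \<in> topspace X \<Longrightarrow> \<bar>f x - (\<Sum>(c,D)\<leftarrow>l. c * indicator D x)\<bar> \<le> \<delta>"
proof -
  define \<C> where "\<C> = {C\<in>clopens X. \<exists>a. \<forall>x\<in>C. \<bar>f x - a\<bar> \<le> \<delta>}"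
  have "\<exists>\<F>. finite \<F> \<and> \<F> \<subseteq> \<C> \<and> topspace X \<subseteq> \<Union>\<F>"
  proof (rule compactinD[of X "topspace X"])
    show "compactin X (topspace X)" using compact by (simp add: compact_space_def)
    show "openin X C" if "C \<in> \<C>" for C using that by (auto simp: \<C>_def clopens_def)
    show "topspace X \<subseteq> \<Union>\<C>"
    proof
      fix x assume x: "x \<in> topspace X"
      have "openin X {y\<in>topspace X. f y \<in> ball (f x) \<delta>}"
        using f by (intro openin_continuous_map_preimage[OF f]) auto
      then obtain C where "C \<in> clopens X" "x \<in> C" "C \<subseteq> {y\<in>topspace X. f y \<in> ball (f x) \<delta>}"
        using clopen_basis[of "{y\<in>topspace X. f y \<in> ball (f x) \<delta>}" x] x \<open>0 < \<delta>\<close> by auto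
      then have "C \<in> \<C>"
        by (auto simp: \<C>_def dist_real_def intro!: exI[of _ "f x"])
      with \<open>x \<in> C\<close> show "x \<in> \<Union>\<C>" by blast
    qed
  qed
  then obtain \<F> where \<F>: "finite \<F>" "\<F> \<subseteq> \<C>" "topspace X \<subseteq> \<Union>\<F>" by blast
  \<comment> \<open>The last clause keeps the induction going: each new set enters with the union of
    the earlier ones removed, and there the earlier terms must vanish.\<close>
  have "\<exists>l :: (real \<times> 'a set) list. set l \<subseteq> UNIV \<times> clopens X \<and> \<Union>\<F> \<in> clopens X \<and>
    (\<forall>x\<in>\<Union>\<F>. \<bar>f x - (\<Sum>(c,D)\<leftarrow>l. c * indicator D x)\<bar> \<le> \<delta>) \<and>
    (\<forall>x. x \<notin> \<Union>\<F> \<longrightarrow> (\<Sum>(c,D)\<leftarrow>l. c * indicator D x) = 0)"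
    using \<F>(1,2)
  proof (induction \<F> rule: finite_induct)
    case empty
    show ?case by (rule exI[of _ "[]"]) (auto simp: clopens_empty)
  next
    case (insert C \<F>)
    then obtain l :: "(real \<times> 'a set) list" where l: "set l \<subseteq> UNIV \<times> clopens X" "\<Union>\<F> \<in> clopens X"
      "\<forall>x\<in>\<Union>\<F>. \<bar>f x - (\<Sum>(c,D)\<leftarrow>l. c * indicator D x)\<bar> \<le> \<delta>"
      "\<forall>x. x \<notin> \<Union>\<F> \<longrightarrow> (\<Sum>(c,D)\<leftarrow>l. c * indicator D x) = 0" by auto
    from insert obtain a where a: "C \<in> clopens X" "\<forall>x\<in>C. \<bar>f x - a\<bar> \<le> \<delta>"
      by (auto simp: \<C>_def)
    show ?case
    proof (rule exI[of _ "(a, C - \<Union>\<F>) # l"], intro conjI ballI allI impI)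
      show "set ((a, C - \<Union>\<F>) # l) \<subseteq> UNIV \<times> clopens X"
        using l a by (auto intro: clopens_Diff)
      show "\<Union>(insert C \<F>) \<in> clopens X" using l a by (auto intro: clopens_Un)
      fix x assume "x \<in> \<Union>(insert C \<F>)"
      then show "\<bar>f x - (\<Sum>(c,D)\<leftarrow>(a, C - \<Union>\<F>) # l. c * indicator D x)\<bar> \<le> \<delta>"
        using l(3,4) a(2) by (cases "x \<in> \<Union>\<F>") (auto simp: indicator_def)
    next
      fix x assume "x \<notin> \<Union>(insert C \<F>)"
      then show "(\<Sum>(c,D)\<leftarrow>(a, C - \<Union>\<F>) # l. c * indicator D x) = 0"
        using l(4) by auto
    qed
  qed
  with \<F>(3) that show ?thesis by (metis subsetD)
qed

lemma integrable_clopen_step: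
  assumes "\<mu> \<in> prob_measures X" "set l \<subseteq> UNIV \<times> clopens X"
  shows "integrable \<mu> (\<lambda>x. \<Sum>(c,D)\<leftarrow>l. c * indicator D x :: real)"
    and "(\<integral>x. (\<Sum>(c,D)\<leftarrow>l. c * indicator D x) \<partial>\<mu>) = (\<Sum>(c,D)\<leftarrow>l. c * measure \<mu> D)"
proof -
  interpret \<mu>: prob_space \<mu> using assms by (simp add: prob_measuresD)
  have "integrable \<mu> (\<lambda>x. \<Sum>(c,D)\<leftarrow>l. c * indicator D x :: real) \<and>
    (\<integral>x. (\<Sum>(c,D)\<leftarrow>l. c * indicator D x) \<partial>\<mu>) = (\<Sum>(c,D)\<leftarrow>l. c * measure \<mu> D)"
    using assms(2)
  proof (induction l)
    case (Cons a l)
    obtain c D where a: "a = (c, D)" by fastforce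
    have D: "D \<in> sets \<mu>" "D \<inter> space \<mu> = D" using Cons clopens_measurable[OF assms(1)] clopens_sub
      by (auto simp: a prob_measuresD[OF assms(1)])
    then have "integrable \<mu> (\<lambda>x. c * indicator D x :: real)"
      by (intro integrable_mult_right) (auto simp: \<mu>.emeasure_eq_measure)
    with Cons D show ?case by (auto simp: a)
  qed auto
  then show "integrable \<mu> (\<lambda>x. \<Sum>(c,D)\<leftarrow>l. c * indicator D x :: real)"
    "(\<integral>x. (\<Sum>(c,D)\<leftarrow>l. c * indicator D x) \<partial>\<mu>) = (\<Sum>(c,D)\<leftarrow>l. c * measure \<mu> D)" by auto
qed

lemma integrable_continuous_map:
  assumes "\<mu> \<in> prob_measures X" "continuous_map X euclideanreal f"
  shows "integrable \<mu> f"
proof -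
  interpret \<mu>: prob_space \<mu> using assms by (simp add: prob_measuresD)
  have "compact (f ` topspace X)"
    using image_compactin[OF _ assms(2), of "topspace X"] compact
    by (simp add: compact_space_def)
  then obtain B where "\<forall>y\<in>f ` topspace X. norm y \<le> B"
    using compact_imp_bounded bounded_iff by metis
  moreover have "f \<in> borel_measurable \<mu>"
    using borel_measurable_continuous_map[OF assms(2)]
    by (simp add: prob_measuresD(2)[OF assms(1)] cong: measurable_cong_sets)
  ultimately show ?thesis
    by (intro \<mu>.integrable_const_bound[of _ B]) (auto simp: prob_measuresD(3)[OF assms(1)])
qed

text \<open>One step function serves all measures at once, because it approximates \<open>f\<close>
  uniformly in the point.\<close>

lemma integral_approx_by_clopens:
  assumes f: "continuous_map X euclideanreal f" and "0 < \<delta>"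
  obtains l :: "(real \<times> 'a set) list" where "set l \<subseteq> UNIV \<times> clopens X"
    "\<And>\<mu>. \<mu> \<in> prob_measures X \<Longrightarrow> \<bar>(\<integral>x. f x \<partial>\<mu>) - (\<Sum>(c,D)\<leftarrow>l. c * measure \<mu> D)\<bar> \<le> \<delta>"
proof -
  obtain l :: "(real \<times> 'a set) list" where l: "set l \<subseteq> UNIV \<times> clopens X"
    "\<And>x. x \<in> topspace X \<Longrightarrow> \<bar>f x - (\<Sum>(c,D)\<leftarrow>l. c * indicator D x)\<bar> \<le> \<delta>"
    using approx_by_clopens[OF assms] by blast
  show ?thesis
  proof (rule that[OF l(1)])
    fix \<mu> assume \<mu>: "\<mu> \<in> prob_measures X"
    interpret \<mu>: prob_space \<mu> using \<mu> by (simp add: prob_measuresD)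
    note int = integrable_clopen_step[OF \<mu> l(1)]
    have "\<bar>(\<integral>x. f x \<partial>\<mu>) - (\<Sum>(c,D)\<leftarrow>l. c * measure \<mu> D)\<bar>
      = \<bar>\<integral>x. (f x - (\<Sum>(c,D)\<leftarrow>l. c * indicator D x)) \<partial>\<mu>\<bar>"
      using int integrable_continuous_map[OF \<mu> f] by simp
    also have "\<dots> \<le> (\<integral>x. \<bar>f x - (\<Sum>(c,D)\<leftarrow>l. c * indicator D x)\<bar> \<partial>\<mu>)"
      by (rule integral_abs_bound)
    also have "\<dots> \<le> (\<integral>x. \<delta> \<partial>\<mu>)"
      using int integrable_continuous_map[OF \<mu> f] l(2) prob_measuresD(3)[OF \<mu>]
      by (intro integral_mono) auto
    finally show "\<bar>(\<integral>x. f x \<partial>\<mu>) - (\<Sum>(c,D)\<leftarrow>l. c * measure \<mu> D)\<bar> \<le> \<delta>"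
      by (simp add: \<mu>.prob_space)
  qed
qed

lemma sum_list_measure_close:
  assumes "\<And>D. D \<in> snd ` set l \<Longrightarrow> \<bar>measure \<nu> D - measure \<mu> D\<bar> \<le> e"
  shows "\<bar>(\<Sum>(c,D)\<leftarrow>l. c * measure \<nu> D) - (\<Sum>(c,D)\<leftarrow>l. c * measure \<mu> D)\<bar>
      \<le> (\<Sum>(c,D)\<leftarrow>l. \<bar>c\<bar>) * e"
  using assms
proof (induction l)
  case (Cons a l)
  obtain c D where a: "a = (c, D)" by fastforce
  have "\<bar>c * measure \<nu> D - c * measure \<mu> D\<bar> \<le> \<bar>c\<bar> * e"
    using Cons(2)[of D] by (simp add: a right_diff_distrib[symmetric] abs_mult mult_left_mono)
  with Cons.IH Cons.prems show ?case by (auto simp: a distrib_right)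
qed auto

text \<open>A generating weak* condition involves an arbitrary continuous function; approximating it
  by a step function leaves conditions on finitely many clopen masses. Together with
  \<open>continuous_map_eval\<close> this identifies the weak* topology with convergence on clopen
  sets.\<close>

lemma weak_star_nbhd:
  assumes "openin (weak_star X K) U" "\<mu> \<in> U" "K \<subseteq> prob_measures X"
  obtains F e where "finite F" "F \<subseteq> clopens X" "0 < e"
    "{\<nu>\<in>K. \<forall>C\<in>F. \<bar>measure \<nu> C - measure \<mu> C\<bar> < e} \<subseteq> U"
proof -
  let ?S = "{{\<mu>. (\<integral>x. f x \<partial>\<mu>) \<in> U} | f U. continuous_map X euclideanreal f \<and> open U}"
  obtain V where V: "generate_topology_on ?S V" "U = V \<inter> K"
    using assms(1) by (auto simp: weak_star_def openin_subtopology openin_topology_generated_by_iff)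
  have step: "\<exists>F e. finite F \<and> F \<subseteq> clopens X \<and> 0 < e \<and>
    {\<nu>\<in>prob_measures X. \<forall>C\<in>F. \<bar>measure \<nu> C - measure \<mu> C\<bar> < e} \<subseteq> V"
    if "\<mu> \<in> V" "\<mu> \<in> prob_measures X" for \<mu>
    using V(1) that
  proof (induction V rule: generate_topology_on.induct)
    case (Int a b)
    then obtain F e F' e' where "finite F" "F \<subseteq> clopens X" "0 < e"
      "{\<nu>\<in>prob_measures X. \<forall>C\<in>F. \<bar>measure \<nu> C - measure \<mu> C\<bar> < e} \<subseteq> a"
      "finite F'" "F' \<subseteq> clopens X" "0 < e'"
      "{\<nu>\<in>prob_measures X. \<forall>C\<in>F'. \<bar>measure \<nu> C - measure \<mu> C\<bar> < e'} \<subseteq> b" by blast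
    then show ?case by (intro exI[of _ "F \<union> F'"] exI[of _ "min e e'"]) auto
  next
    case (UN K)
    then show ?case by (meson UnionE Union_upper order_trans)
  next
    case (Basis s)
    then obtain f W where s: "s = {\<mu>. (\<integral>x. f x \<partial>\<mu>) \<in> W}" "continuous_map X euclideanreal f" "open W"
      by blast
    obtain d where d: "0 < d" "ball (\<integral>x. f x \<partial>\<mu>) d \<subseteq> W"
      using Basis s open_contains_ball by blast
    obtain l :: "(real \<times> 'a set) list" where l: "set l \<subseteq> UNIV \<times> clopens X"
      "\<And>\<mu>. \<mu> \<in> prob_measures X \<Longrightarrow> \<bar>(\<integral>x. f x \<partial>\<mu>) - (\<Sum>(c,D)\<leftarrow>l. c * measure \<mu> D)\<bar> \<le> d/4"
      using integral_approx_by_clopens[OF s(2), of "d/4"] d by auto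
    define L where "L = (\<Sum>(c,D)\<leftarrow>l. \<bar>c\<bar>)"
    have L: "0 \<le> L" unfolding L_def by (rule sum_list_nonneg) auto
    \<comment> \<open>The budget \<open>d\<close> is spent in quarters: two for replacing the
      integrals by step sums, one for the change of the step sum, which is at most
      \<open>L * e\<close>. The \<open>+ 1\<close> covers \<open>L = 0\<close>.\<close>
    define e where "e = d / (4 * (L + 1))"
    have e: "0 < e" "L * e \<le> d/4"
      using d L by (auto simp: e_def field_simps)
    show ?case
    proof (intro exI[of _ "snd ` set l"] exI[of _ e] conjI subsetI)
      fix \<nu> assume "\<nu> \<in> {\<nu> \<in> prob_measures X. \<forall>C\<in>snd ` set l. \<bar>measure \<nu> C - measure \<mu> C\<bar> < e}"
      then have \<nu>: "\<nu> \<in> prob_measures X" "\<And>D. D \<in> snd ` set l \<Longrightarrow> \<bar>measure \<nu> D - measure \<mu> D\<bar> \<le> e"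
        by auto
      have "\<bar>(\<integral>x. f x \<partial>\<nu>) - (\<integral>x. f x \<partial>\<mu>)\<bar> < d"
        using sum_list_measure_close[of l \<nu> \<mu> e, OF \<nu>(2)] l(2)[OF Basis(3)] l(2)[OF \<nu>(1)] e d
        unfolding L_def[symmetric] by linarith
      then show "\<nu> \<in> s" using d s by (auto simp: dist_real_def abs_minus_commute)
    qed (use l e in auto)
  qed auto
  have "\<mu> \<in> V" "\<mu> \<in> prob_measures X"
    using assms V openin_subset[OF assms(1)] by auto
  from step[OF this] obtain F e where "finite F" "F \<subseteq> clopens X" "0 < e"
    "{\<nu>\<in>prob_measures X. \<forall>C\<in>F. \<bar>measure \<nu> C - measure \<mu> C\<bar> < e} \<subseteq> V" by (elim exE conjE)
  then show ?thesis using that[of F e] assms(3) V(2) by blast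
qed

text \<open>A simplex is defined by Borel sets of the weak* topology, whereas measure-valued maps
  are handled through the sigma-algebra of \<open>prob_algebra\<close>. Clopen masses are weak*
  continuous, which gives one inclusion; for the other, every weak* open set is a union of countably
  many boxes.\<close>

lemma sets_borel_of_weak_star:
  assumes K: "K \<subseteq> prob_measures X"
  shows "sets (borel_of (weak_star X K)) = sets (restrict_space (prob_algebra (borel_of X)) K)"
    (is "sets ?L = sets ?R")
proof
  have sp: "space ?R = K" using K by (auto simp: space_restrict_space prob_measures_eq)
  have "(\<lambda>\<nu>. \<nu>) \<in> ?L \<rightarrow>\<^sub>M prob_algebra (borel_of X)"
  proof (rule measurable_prob_algebra_generated[OF sets_borel_of_clopens Int_stable_clopens])
    show "clopens X \<subseteq> Pow (topspace X)" using clopens_sub by auto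
    show "prob_space a" "sets a = sets (borel_of X)" if "a \<in> space ?L" for a
      using that K by (auto dest: prob_measuresD)
    show "(\<lambda>a. emeasure a A) \<in> borel_measurable ?L" if A: "A \<in> clopens X" for A
    proof -
      have "(\<lambda>a. ennreal (measure a A)) \<in> borel_measurable ?L"
        using borel_measurable_continuous_map[OF continuous_map_eval[OF A K]] by measurable
      moreover have "emeasure a A = ennreal (measure a A)" if "a \<in> space ?L" for a
      proof -
        interpret prob_space a using that K by (auto dest: prob_measuresD)
        show ?thesis by (rule emeasure_eq_measure)
      qed
      ultimately show ?thesis by (subst measurable_cong)
    qed
  qed
  then have "(\<lambda>\<nu>. \<nu>) \<in> ?L \<rightarrow>\<^sub>M ?R"
    by (rule measurable_restrict_space2[rotated]) auto
  from measurable_sets[OF this] show "sets ?R \<subseteq> sets ?L"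
    using sets.sets_into_space[of _ ?R] unfolding sp by (fastforce simp: Int_absorb2)
next
  let ?R = "restrict_space (prob_algebra (borel_of X)) K"
  have sp: "space ?R = K" using K by (auto simp: space_restrict_space prob_measures_eq)
  \<comment> \<open>Boxes with rational ends over finitely many clopen sets: a countable basis of
    the weak* topology on \<open>K\<close>.\<close>
  define N where "N l = {\<nu>\<in>K. \<forall>(C,a,b)\<in>set l. a < measure \<nu> C \<and> measure \<nu> C < b}"
    for l :: "('a set \<times> real \<times> real) list"
  let ?I = "lists (clopens X \<times> \<rat> \<times> \<rat>)"
  have "countable ?I"
    by (intro countable_lists countable_SIGMA countable_clopens) (auto simp: countable_rat)
  have N: "N l \<in> sets ?R" if "l \<in> ?I" for l
    using that
  proof (induction l)
    case Nil
    then show ?case using sets.top[of ?R] by (simp add: N_def sp del: sets.top)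
  next
    case (Cons x l)
    obtain C a b where x: "x = (C,a,b)" by (cases x) auto
    have C: "C \<in> sets (borel_of X)" using Cons x clopens_sets by auto
    have "(\<lambda>\<nu>. measure \<nu> C) \<in> borel_measurable ?R"
      using C by (intro measurable_restrict_space1) measurable
    then have "{\<nu>\<in>space ?R. a < measure \<nu> C \<and> measure \<nu> C < b} \<in> sets ?R"
      by measurable
    then have "{\<nu>\<in>K. a < measure \<nu> C \<and> measure \<nu> C < b} \<inter> N l \<in> sets ?R"
      using Cons by (auto simp: sp)
    moreover have "N (x # l) = {\<nu>\<in>K. a < measure \<nu> C \<and> measure \<nu> C < b} \<inter> N l"
      by (auto simp: N_def x)
    ultimately show ?case by simp
  qed
  have "U \<in> sets ?R" if U: "openin (weak_star X K) U" for U
  proof -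
    have "U = (\<Union>l\<in>{l\<in>?I. N l \<subseteq> U}. N l)"
    proof (intro equalityI subsetI)
      fix \<mu> assume \<mu>: "\<mu> \<in> U"
      then have "\<mu> \<in> K" using openin_subset[OF U] by auto
      obtain F e where F: "finite F" "F \<subseteq> clopens X" "0 < e"
        "{\<nu>\<in>K. \<forall>C\<in>F. \<bar>measure \<nu> C - measure \<mu> C\<bar> < e} \<subseteq> U"
        using weak_star_nbhd[OF U \<mu> K] by blast
      have "\<forall>C. \<exists>a b. a \<in> \<rat> \<and> b \<in> \<rat> \<and> measure \<mu> C - e < a \<and> a < measure \<mu> C \<and> measure \<mu> C < b \<and> b < measure \<mu> C + e"
        using Rats_dense_in_real F(3) by (metis diff_add_cancel less_add_same_cancel1)
      then obtain a b where ab: "\<And>C. a C \<in> \<rat> \<and> b C \<in> \<rat> \<and> measure \<mu> C - e < a C \<and> a C < measure \<mu> C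
          \<and> measure \<mu> C < b C \<and> b C < measure \<mu> C + e"
        by metis
      obtain xs where xs: "set xs = F" using finite_list[OF F(1)] by blast
      let ?l = "map (\<lambda>C. (C, a C, b C)) xs"
      have "?l \<in> ?I" using xs F ab by auto
      moreover have "N ?l \<subseteq> U"
      proof
        fix \<nu> assume "\<nu> \<in> N ?l"
        then have "\<nu> \<in> K" "\<forall>C\<in>F. a C < measure \<nu> C \<and> measure \<nu> C < b C" using xs by (auto simp: N_def)
        moreover then have "\<forall>C\<in>F. \<bar>measure \<nu> C - measure \<mu> C\<bar> < e"
          using ab by (smt (verit))
        ultimately show "\<nu> \<in> U" using F(4) by auto
      qed
      moreover have "\<mu> \<in> N ?l" using xs ab \<open>\<mu> \<in> K\<close> by (auto simp: N_def)
      ultimately show "\<mu> \<in> (\<Union>l\<in>{l\<in>?I. N l \<subseteq> U}. N l)" by blast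
    qed auto
    moreover have "(\<Union>l\<in>{l\<in>?I. N l \<subseteq> U}. N l) \<in> sets ?R"
      by (rule sets.countable_UN') (use N \<open>countable ?I\<close> in \<open>auto intro: countable_subset\<close>)
    ultimately show ?thesis by simp
  qed
  then show "sets (borel_of (weak_star X K)) \<subseteq> sets ?R"
    unfolding sets_borel_of using sets.sigma_sets_subset[of "{U. openin (weak_star X K) U}" ?R] sp by auto
qed

text \<open>The clopen masses of a probability measure form a point of a product of unit intervals,
  compact by Tychonoff; total mass one and finite additivity are closed conditions there. Extension
  to a measure is a continuous map from this closed set onto \<open>prob_measures X\<close>.\<close>

lemma compact_space_prob_measures: "compact_space (weak_star X (prob_measures X))"
proof -
  let ?P = "product_topology (\<lambda>_. euclideanreal) (clopens X)"
  let ?W = "weak_star X (prob_measures X)"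
  define B where "B = PiE (clopens X) (\<lambda>_. {0..1::real})"
  define A where "A = {p \<in> clopens X \<times> clopens X. fst p \<inter> snd p = {}}"
  define Z where "Z = {f\<in>B. f (topspace X) = 1 \<and> (\<forall>p\<in>A. f (fst p \<union> snd p) = f (fst p) + f (snd p))}"
  have compB: "compactin ?P B"
    unfolding B_def by (subst compactin_PiE) auto
  have proj: "continuous_map ?P euclideanreal (\<lambda>f. f C)" if "C \<in> clopens X" for C
    using continuous_map_product_projection[OF that, of "\<lambda>_. euclideanreal"] .
  have cl1: "closedin ?P {f\<in>topspace ?P. f (topspace X) = 1}"
    using proj[OF clopens_top] by (intro closedin_continuous_maps_eq[where Y=euclideanreal]) auto
  have cl2: "closedin ?P {f\<in>topspace ?P. f (fst p \<union> snd p) = f (fst p) + f (snd p)}" if "p \<in> A" for p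
  proof (rule closedin_continuous_maps_eq[where Y=euclideanreal])
    show "continuous_map ?P euclideanreal (\<lambda>f. f (fst p \<union> snd p))"
      using that by (intro proj) (auto simp: A_def clopens_Un)
    show "continuous_map ?P euclideanreal (\<lambda>f. f (fst p) + f (snd p))"
      using that by (intro continuous_map_add proj) (auto simp: A_def)
  qed auto
  have "Z = B \<inter> \<Inter>(insert {f\<in>topspace ?P. f (topspace X) = 1}
     ((\<lambda>p. {f\<in>topspace ?P. f (fst p \<union> snd p) = f (fst p) + f (snd p)}) ` A))"
    by (auto simp: Z_def B_def PiE_def)
  moreover have "closedin ?P (\<Inter>(insert {f\<in>topspace ?P. f (topspace X) = 1}
     ((\<lambda>p. {f\<in>topspace ?P. f (fst p \<union> snd p) = f (fst p) + f (snd p)}) ` A)))"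
    using cl1 cl2 by (intro closedin_Inter) auto
  ultimately have compZ: "compactin ?P Z"
    using compact_Int_closedin[OF compB] by auto
  \<comment> \<open>The choice is immaterial: a measure is determined by its values on clopen
    sets.\<close>
  define m where "m f = (SOME \<mu>. \<mu> \<in> prob_measures X \<and> (\<forall>C\<in>clopens X. measure \<mu> C = f C))" for f
  have m: "m f \<in> prob_measures X \<and> (\<forall>C\<in>clopens X. measure (m f) C = f C)" if "f \<in> Z" for f
    unfolding m_def
  proof (rule someI_ex)
    have "\<exists>\<mu>\<in>prob_measures X. \<forall>C\<in>clopens X. measure \<mu> C = f C"
    proof (rule finitely_additive_extends)
      show "f (C \<union> D) = f C + f D" if "C \<in> clopens X" "D \<in> clopens X" "C \<inter> D = {}" for C D
        using that \<open>f \<in> Z\<close> by (auto simp: Z_def A_def)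
    qed (use \<open>f \<in> Z\<close> in \<open>auto simp: Z_def B_def\<close>)
    then show "\<exists>\<mu>. \<mu> \<in> prob_measures X \<and> (\<forall>C\<in>clopens X. measure \<mu> C = f C)" by blast
  qed
  have ZP: "Z \<subseteq> topspace ?P" by (auto simp: Z_def B_def PiE_def)
  have "continuous_map (subtopology ?P Z) ?W m"
    unfolding continuous_map_def
  proof (intro conjI allI impI)
    show "m \<in> topspace (subtopology ?P Z) \<rightarrow> topspace ?W" using m by auto
    fix U assume U: "openin ?W U"
    show "openin (subtopology ?P Z) {f \<in> topspace (subtopology ?P Z). m f \<in> U}"
    proof (subst openin_subopen, intro ballI)
      fix f assume "f \<in> {f \<in> topspace (subtopology ?P Z). m f \<in> U}"
      then have f: "f \<in> Z" "m f \<in> U" by auto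
      obtain F e where F: "finite F" "F \<subseteq> clopens X" "0 < e"
        "{\<nu>\<in>prob_measures X. \<forall>C\<in>F. \<bar>measure \<nu> C - measure (m f) C\<bar> < e} \<subseteq> U"
        using weak_star_nbhd[OF U f(2)] by blast
      define V where "V = topspace ?P \<inter> \<Inter>((\<lambda>C. {g\<in>topspace ?P. g C \<in> ball (f C) e}) ` F)"
      have "openin ?P V"
        unfolding V_def
      proof (cases "F = {}")
        case False
        then have "openin ?P (\<Inter>((\<lambda>C. {g\<in>topspace ?P. g C \<in> ball (f C) e}) ` F))"
          using F
          by (intro openin_Inter ballI)
            (auto simp del: topspace_product_topology mem_ball intro!: openin_continuous_map_preimage[OF proj])
        then show "openin ?P (topspace ?P \<inter> \<Inter>((\<lambda>C. {g\<in>topspace ?P. g C \<in> ball (f C) e}) ` F))"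
          by (rule openin_Int[OF openin_topspace])
      qed (simp only: image_empty Inter_empty Int_UNIV_right openin_topspace)
      moreover have "f \<in> V" using f F ZP by (auto simp: V_def)
      moreover have "V \<inter> Z \<subseteq> {f \<in> topspace (subtopology ?P Z). m f \<in> U}"
      proof
        fix g assume g: "g \<in> V \<inter> Z"
        have "\<bar>measure (m g) C - measure (m f) C\<bar> < e" if "C \<in> F" for C
        proof -
          have "measure (m g) C = g C" "measure (m f) C = f C" using m f g F that by auto
          moreover have "dist (f C) (g C) < e" using g that by (auto simp: V_def)
          ultimately show ?thesis by (simp add: dist_real_def abs_minus_commute)
        qed
        then have "m g \<in> U" using F(4) m g by auto
        then show "g \<in> {f \<in> topspace (subtopology ?P Z). m f \<in> U}" using g ZP by auto
      qed
      ultimately show "\<exists>T. openin (subtopology ?P Z) T \<and> f \<in> T \<and> T \<subseteq> {f \<in> topspace (subtopology ?P Z). m f \<in> U}"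
        using f by (intro exI[of _ "V \<inter> Z"]) (auto simp: openin_subtopology)
    qed
  qed
  moreover have "compactin (subtopology ?P Z) Z"
    using compZ by (simp add: compactin_subtopology)
  ultimately have "compactin ?W (m ` Z)"
    by (rule image_compactin[rotated])
  moreover have "m ` Z = prob_measures X"
  proof (intro equalityI subsetI)
    fix \<mu> assume \<mu>: "\<mu> \<in> prob_measures X"
    interpret prob_space \<mu> using \<mu> by (simp add: prob_measuresD)
    define f where "f = restrict (measure \<mu>) (clopens X)"
    have "f \<in> Z"
      using prob_space clopens_measurable[OF \<mu>]
      by (auto simp: Z_def B_def f_def A_def clopens_top clopens_Un prob_measuresD(3)[OF \<mu>] finite_measure_Union)
    moreover have "m f = \<mu>"
      using m[OF \<open>f \<in> Z\<close>] \<mu> by (intro measure_eqI_clopens) (auto simp: f_def)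
    ultimately show "\<mu> \<in> m ` Z" by blast
  qed (use m in auto)
  ultimately show ?thesis by (simp add: compact_space_def)
qed

end

section \<open>The pointwise ergodic theorem for bounded functions\<close>

definition birkhoff_sum :: "('a \<Rightarrow> 'a) \<Rightarrow> ('a \<Rightarrow> real) \<Rightarrow> nat \<Rightarrow> 'a \<Rightarrow> real" where
  "birkhoff_sum T f n x = (\<Sum>i<n. f ((T ^^ i) x))"

lemma birkhoff_sum_add:
  "birkhoff_sum T f (m + n) x = birkhoff_sum T f m x + birkhoff_sum T f n ((T ^^ m) x)"
  by (induction n) (simp_all add: birkhoff_sum_def funpow_add add.commute[of m])

lemma birkhoff_sum_bounds:
  assumes "\<And>x. 0 \<le> f x" "\<And>x. f x \<le> 1"
  shows "0 \<le> birkhoff_sum T f n x" "birkhoff_sum T f n x \<le> n"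
  unfolding birkhoff_sum_def
  using assms sum_bounded_above[of "{..<n}" "\<lambda>i. f ((T ^^ i) x)" 1] by (auto intro: sum_nonneg)

lemma birkhoff_sum_shift:
  "birkhoff_sum T f n (T x) = birkhoff_sum T f n x + f ((T ^^ n) x) - f x"
proof -
  have "birkhoff_sum T f 1 x + birkhoff_sum T f n (T x) = birkhoff_sum T f n x + birkhoff_sum T f 1 ((T ^^ n) x)"
    using birkhoff_sum_add[of T f 1 n x] birkhoff_sum_add[of T f n 1 x] by simp
  then show ?thesis by (simp add: birkhoff_sum_def)
qed

locale measure_preserving_system = prob_space M for M :: "'a measure" +
  fixes T :: "'a \<Rightarrow> 'a"
  assumes T_measurable [measurable]: "T \<in> M \<rightarrow>\<^sub>M M"
    and invariant: "distr M M T = M"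
begin

lemma funpow_measurable [measurable]: "(T ^^ n) \<in> M \<rightarrow>\<^sub>M M"
  by (induction n) auto

lemma distr_funpow: "distr M M (T ^^ n) = M"
proof (induction n)
  case 0
  show ?case by (simp add: id_def distr_id2)
next
  case (Suc n)
  have "distr M M (T \<circ> (T ^^ n)) = distr (distr M M (T ^^ n)) M T"
    by (rule distr_distr[symmetric]) auto
  with Suc show ?case by (simp only: invariant funpow.simps)
qed

lemma integral_funpow:
  fixes f :: "'a \<Rightarrow> real"
  assumes [measurable]: "f \<in> borel_measurable M"
  shows "(\<integral>x. f ((T ^^ n) x) \<partial>M) = (\<integral>x. f x \<partial>M)"
  using integral_distr[of "T ^^ n" M M f] by (simp add: distr_funpow)

lemma integrable_funpow:
  fixes f :: "'a \<Rightarrow> real"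
  assumes [measurable]: "f \<in> borel_measurable M" and "integrable M f"
  shows "integrable M (\<lambda>x. f ((T ^^ n) x))"
  using integrable_distr[of "T ^^ n" M M f] assms by (simp add: distr_funpow)

lemma integral_birkhoff_sum:
  assumes [measurable]: "f \<in> borel_measurable M" and "integrable M f"
  shows "(\<integral>x. birkhoff_sum T f n x \<partial>M) = n * (\<integral>x. f x \<partial>M)"
    and "integrable M (birkhoff_sum T f n)"
  using assms by (auto simp: birkhoff_sum_def[abs_def] integrable_funpow integral_funpow)

text \<open>Katznelson-Weiss tiling. From each point one advances by a stretch on which the average
  of \<open>f\<close> is at least \<open>g\<close>, and invariance of \<open>g\<close> lets the
  stretches along an orbit be concatenated. Points admitting no stretch of length at most
  \<open>Suc m\<close> form \<open>E m\<close>, which shrinks to the empty set.\<close>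

lemma maximal_inequality:
  fixes f g :: "'a \<Rightarrow> real"
  assumes [measurable]: "f \<in> borel_measurable M" "g \<in> borel_measurable M"
    and f: "\<And>x. 0 \<le> f x" "\<And>x. f x \<le> 1"
    and g: "\<And>x. 0 \<le> g x" "\<And>x. g x \<le> 1"
    and inv: "\<And>x. x \<in> space M \<Longrightarrow> g (T x) = g x"
    and ex: "\<And>x. x \<in> space M \<Longrightarrow> \<exists>n\<ge>1. real n * g x \<le> birkhoff_sum T f n x"
  shows "(\<integral>x. g x \<partial>M) \<le> (\<integral>x. f x \<partial>M)"
proof -
  have [measurable]: "birkhoff_sum T f n \<in> borel_measurable M" for n
    unfolding birkhoff_sum_def[abs_def] by measurable
  have int: "integrable M f" "integrable M g"
    using f g by (auto intro!: integrable_const_bound[of _ 1])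
  have invn: "(T ^^ n) x \<in> space M" "g ((T ^^ n) x) = g x" if "x \<in> space M" for n x
  proof (induction n)
    case (Suc n)
    { case 1 show ?case using Suc measurable_space[OF T_measurable] by simp }
    { case 2 show ?case using Suc inv by simp }
  qed (use that in auto)
  define E where "E m = {x\<in>space M. \<forall>n\<in>{1..Suc m}. birkhoff_sum T f n x < n * g x}" for m :: nat
  have E [measurable]: "E m \<in> sets M" for m
    unfolding E_def by measurable
  have bound: "(\<integral>x. g x \<partial>M) \<le> (\<integral>x. f x \<partial>M) + measure M (E m)" for m
  proof -
    \<comment> \<open>On \<open>E m\<close>, raising \<open>f\<close> by one makes a stretch of
      length one sufficient, since \<open>g\<close> is at most 1; the price is the measure of
      \<open>E m\<close>.\<close>
    define f' where "f' x = f x + indicator (E m) x" for x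
    have [measurable]: "f' \<in> borel_measurable M"
      unfolding f'_def[abs_def] by measurable
    have f': "f x \<le> f' x" "0 \<le> f' x" for x using f by (auto simp: f'_def)
    have intf': "integrable M f'" "(\<integral>x. f' x \<partial>M) = (\<integral>x. f x \<partial>M) + measure M (E m)"
      using int E sets.sets_into_space[OF E, of m] by (auto simp: f'_def[abs_def] emeasure_eq_measure Int_absorb2)
    \<comment> \<open>Tiling stops once at most \<open>Suc m\<close> steps are left. Dropping them
      costs at most \<open>Suc m\<close> times \<open>g x\<close>, which is negligible against large
      \<open>L\<close>.\<close>
    have pw: "(real L - real (Suc m)) * g x \<le> birkhoff_sum T f' L x" if "x \<in> space M" for L x
      using that
    proof (induction L arbitrary: x rule: less_induct)
      case (less L)
      show ?case
      proof (cases "L \<le> Suc m")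
        case True
        then have "(real L - real (Suc m)) * g x \<le> 0"
          using g(1)[of x] by (intro mult_nonpos_nonneg) auto
        also have "0 \<le> birkhoff_sum T f' L x"
          unfolding birkhoff_sum_def using f' by (intro sum_nonneg) auto
        finally show ?thesis .
      next
        case False
        have "\<exists>n\<in>{1..Suc m}. n * g x \<le> birkhoff_sum T f' n x"
        proof (cases "x \<in> E m")
          case True
          then have "1 \<le> f' x" using f by (simp add: f'_def)
          then show ?thesis using g(2)[of x] by (intro bexI[of _ 1]) (auto simp: birkhoff_sum_def)
        next
          case False
          then obtain n where n: "n \<in> {1..Suc m}" "n * g x \<le> birkhoff_sum T f n x"
            using less.prems by (auto simp: E_def not_less)
          moreover have "birkhoff_sum T f n x \<le> birkhoff_sum T f' n x"
            unfolding birkhoff_sum_def using f' by (intro sum_mono) auto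
          ultimately show ?thesis by (intro bexI[of _ n]) auto
        qed
        then obtain n where n: "n \<in> {1..Suc m}" "n * g x \<le> birkhoff_sum T f' n x" by blast
        have "(real (L - n) - real (Suc m)) * g ((T ^^ n) x) \<le> birkhoff_sum T f' (L - n) ((T ^^ n) x)"
          using n False less.prems by (intro less.IH invn) auto
        moreover have "birkhoff_sum T f' L x = birkhoff_sum T f' n x + birkhoff_sum T f' (L - n) ((T ^^ n) x)"
          using birkhoff_sum_add[of T f' n "L - n" x] n False by simp
        moreover have "(real L - real (Suc m)) * g x = n * g x + (real (L - n) - real (Suc m)) * g x"
          using n False by (simp add: of_nat_diff algebra_simps)
        ultimately show ?thesis using n invn[OF less.prems] by simp
      qed
    qed
    have "(real L - real (Suc m)) * (\<integral>x. g x \<partial>M) \<le> L * (\<integral>x. f' x \<partial>M)" for L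
    proof -
      have "(\<integral>x. (real L - real (Suc m)) * g x \<partial>M) \<le> (\<integral>x. birkhoff_sum T f' L x \<partial>M)"
        using pw int intf' by (intro integral_mono integral_birkhoff_sum(2)) auto
      then show ?thesis using intf' by (simp add: integral_birkhoff_sum(1))
    qed
    then have *: "real L * ((\<integral>x. g x \<partial>M) - (\<integral>x. f' x \<partial>M)) \<le> real (Suc m) * (\<integral>x. g x \<partial>M)" for L
      by (simp add: algebra_simps)
    have "(\<integral>x. g x \<partial>M) \<le> (\<integral>x. f' x \<partial>M)"
    proof (rule ccontr)
      assume "\<not> ?thesis"
      then have "0 < (\<integral>x. g x \<partial>M) - (\<integral>x. f' x \<partial>M)" by simp
      from reals_Archimedean3[OF this] obtain L where
        "real (Suc m) * (\<integral>x. g x \<partial>M) < real L * ((\<integral>x. g x \<partial>M) - (\<integral>x. f' x \<partial>M))" by blast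
      with *[of L] show False by simp
    qed
    with intf' show ?thesis by simp
  qed
  have "(\<lambda>m. measure M (E m)) \<longlonglongrightarrow> measure M (\<Inter>m. E m)"
    by (intro finite_Lim_measure_decseq) (auto simp: decseq_def E_def)
  moreover have "(\<Inter>m. E m) = {}"
  proof (intro equals0I)
    fix x assume x: "x \<in> (\<Inter>m. E m)"
    then have "x \<in> space M" by (auto simp: E_def)
    then obtain n where "n \<ge> 1" "real n * g x \<le> birkhoff_sum T f n x" using ex by blast
    moreover have "x \<in> E n" using x by blast
    ultimately show False by (auto simp: E_def not_less[symmetric])
  qed
  ultimately have "(\<lambda>m. (\<integral>x. f x \<partial>M) + measure M (E m)) \<longlonglongrightarrow> (\<integral>x. f x \<partial>M) + 0"
    by (intro tendsto_intros) simp
  then show ?thesis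
    using bound by (intro LIMSEQ_le_const[of _ _ "\<integral>x. g x \<partial>M"]) auto
qed

definition upper_average :: "('a \<Rightarrow> real) \<Rightarrow> 'a \<Rightarrow> real" where
  "upper_average f x = real_of_ereal (limsup (\<lambda>n. ereal (birkhoff_sum T f n x / n)))"

context
  fixes f :: "'a \<Rightarrow> real"
  assumes f_measurable [measurable]: "f \<in> borel_measurable M"
    and f: "\<And>x. 0 \<le> f x" "\<And>x. f x \<le> 1"
begin

lemma average_bounds: "0 \<le> birkhoff_sum T f n x / n" "birkhoff_sum T f n x / n \<le> 1"
  using birkhoff_sum_bounds[of f T n x] f by (auto simp: divide_le_eq_1)

text \<open>The averages stay in the unit interval, at \<open>n = 0\<close> by the convention for
  division by zero, so the limsup is finite and nothing is lost in passing to a real number.\<close>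

lemma ereal_upper_average:
  "ereal (upper_average f x) = limsup (\<lambda>n. ereal (birkhoff_sum T f n x / n))"
  and upper_average_bounds: "0 \<le> upper_average f x" "upper_average f x \<le> 1"
proof -
  let ?l = "limsup (\<lambda>n. ereal (birkhoff_sum T f n x / n))"
  have "0 \<le> ?l"
    using average_bounds by (intro le_Limsup) (auto simp: eventually_sequentially zero_ereal_def)
  moreover have "?l \<le> 1"
    using average_bounds by (intro Limsup_bounded) (auto simp: one_ereal_def)
  ultimately show "ereal (upper_average f x) = ?l"
    and "0 \<le> upper_average f x" "upper_average f x \<le> 1"
    by (cases ?l; auto simp: upper_average_def one_ereal_def zero_ereal_def)+
qed

lemma upper_average_measurable [measurable]: "upper_average f \<in> borel_measurable M"
  unfolding upper_average_def[abs_def] birkhoff_sum_def by measurable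

text \<open>The sums at \<open>x\<close> and \<open>T x\<close> differ by one term at either end.
  The identity holds at every point, as \<open>maximal_inequality\<close> demands.\<close>

lemma upper_average_invariant: "upper_average f (T x) = upper_average f x"
proof -
  let ?u = "\<lambda>n. (f ((T ^^ n) x) - f x) / n"
  have "\<bar>?u n\<bar> \<le> inverse (real n)" for n
  proof -
    have "\<bar>f ((T ^^ n) x) - f x\<bar> \<le> 1" using f[of x] f[of "(T ^^ n) x"] by linarith
    then show ?thesis by (simp add: divide_simps)
  qed
  then have "?u \<longlonglongrightarrow> 0"
    by (intro Lim_null_comparison[OF _ lim_inverse_n]) auto
  then have "(\<lambda>n. ereal (?u n)) \<longlonglongrightarrow> 0" by (simp add: zero_ereal_def)
  from ereal_limsup_lim_add[OF this, of "\<lambda>n. ereal (birkhoff_sum T f n x / n)"]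
  have "limsup (\<lambda>n. ereal (?u n) + ereal (birkhoff_sum T f n x / n)) = limsup (\<lambda>n. ereal (birkhoff_sum T f n x / n))"
    by simp
  moreover have "ereal (?u n) + ereal (birkhoff_sum T f n x / n) = ereal (birkhoff_sum T f n (T x) / n)" for n
    by (simp add: birkhoff_sum_shift add_divide_distrib diff_divide_distrib)
  ultimately show ?thesis by (simp add: upper_average_def)
qed

lemma integral_upper_average: "(\<integral>x. upper_average f x \<partial>M) \<le> (\<integral>x. f x \<partial>M)"
proof (rule field_le_epsilon)
  fix d :: real assume d: "0 < d"
  \<comment> \<open>Where the truncation is inactive, lowering by \<open>d\<close> puts
    \<open>g x\<close> strictly below the limsup, so some average reaches it; where
    \<open>g x = 0\<close> the sum of length one already does.\<close>
  define g where "g x = max 0 (upper_average f x - d)" for x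
  have [measurable]: "g \<in> borel_measurable M"
    unfolding g_def[abs_def] by measurable
  have g: "0 \<le> g x" "g x \<le> 1" for x
    using upper_average_bounds[of x] d by (auto simp: g_def)
  have "(\<integral>x. g x \<partial>M) \<le> (\<integral>x. f x \<partial>M)"
  proof (rule maximal_inequality)
    show "g (T x) = g x" for x by (simp add: g_def upper_average_invariant)
    fix x
    show "\<exists>n\<ge>1. real n * g x \<le> birkhoff_sum T f n x"
    proof (rule ccontr)
      assume contra: "\<not> (\<exists>n\<ge>1. real n * g x \<le> birkhoff_sum T f n x)"
      then have "0 < g x"
        using birkhoff_sum_bounds(1)[of f T 1 x] f contra by (metis le_less_trans mult_1 not_le of_nat_1 order_refl)
      then have gx: "g x = upper_average f x - d" by (auto simp: g_def)
      have "eventually (\<lambda>n. ereal (birkhoff_sum T f n x / n) \<le> ereal (g x)) sequentially"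
        unfolding eventually_sequentially
      proof (intro exI[of _ 1] allI impI)
        fix n :: nat assume "1 \<le> n"
        then have "birkhoff_sum T f n x < real n * g x" using contra by (meson not_le)
        with \<open>1 \<le> n\<close> show "ereal (birkhoff_sum T f n x / n) \<le> ereal (g x)"
          by (simp add: divide_le_eq mult.commute)
      qed
      then have "limsup (\<lambda>n. ereal (birkhoff_sum T f n x / n)) \<le> ereal (g x)"
        by (rule Limsup_bounded)
      then have "upper_average f x \<le> g x" by (simp add: ereal_upper_average[symmetric])
      with gx d show False by simp
    qed
  qed (use f g in auto)
  moreover have int: "integrable M (upper_average f)" "integrable M g"
    using upper_average_bounds g by (auto intro!: integrable_const_bound[of _ 1])
  have "(\<integral>x. upper_average f x - d \<partial>M) \<le> (\<integral>x. g x \<partial>M)"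
    using int by (intro integral_mono) (auto simp: g_def)
  moreover have "(\<integral>x. upper_average f x - d \<partial>M) = (\<integral>x. upper_average f x \<partial>M) - d"
    using int by (simp add: prob_space)
  ultimately show "(\<integral>x. upper_average f x \<partial>M) \<le> (\<integral>x. f x \<partial>M) + d" by simp
qed

end

text \<open>The integral inequality, applied also to \<open>1 - f\<close>, controls the liminf. The
  gap \<open>d\<close> between limsup and liminf is nonnegative with integral at most 0, hence zero
  almost everywhere.\<close>

theorem birkhoff:
  fixes f :: "'a \<Rightarrow> real"
  assumes [measurable]: "f \<in> borel_measurable M" and f: "\<And>x. 0 \<le> f x" "\<And>x. f x \<le> 1"
  shows "AE x in M. convergent (\<lambda>n. birkhoff_sum T f n x / n)"
proof -
  define f' where "f' x = 1 - f x" for x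
  have f'm [measurable]: "f' \<in> borel_measurable M" unfolding f'_def[abs_def] by measurable
  have f': "\<And>x. 0 \<le> f' x" "\<And>x. f' x \<le> 1" using f by (auto simp: f'_def)
  define d where "d x = upper_average f x + upper_average f' x - 1" for x
  have [measurable]: "upper_average f \<in> borel_measurable M" "upper_average f' \<in> borel_measurable M"
    using f f' by (auto intro!: upper_average_measurable)
  have int: "integrable M (upper_average f)" "integrable M (upper_average f')" "integrable M f"
    using f f' upper_average_bounds[of f] upper_average_bounds[of f']
    by (auto intro!: integrable_const_bound[of _ 1])
  have av: "birkhoff_sum T f' n x / n = 1 - birkhoff_sum T f n x / n" if "n \<ge> 1" for n x
    using that by (simp add: birkhoff_sum_def f'_def sum_subtractf diff_divide_distrib)
  have liminf: "ereal (1 - upper_average f' x) = liminf (\<lambda>n. ereal (birkhoff_sum T f n x / n))" for x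
  proof -
    have "ereal (upper_average f' x) = limsup (\<lambda>n. ereal (birkhoff_sum T f' n x / n))"
      using f' by (intro ereal_upper_average) auto
    also have "\<dots> = limsup (\<lambda>n. ereal 1 + ereal (- (birkhoff_sum T f n x / n)))"
      using av by (intro Limsup_eq) (auto simp: eventually_sequentially intro!: exI[of _ 1])
    also have "\<dots> = 1 + limsup (\<lambda>n. - ereal (birkhoff_sum T f n x / n))"
      by (subst ereal_limsup_lim_add[where a=1]) (auto simp: one_ereal_def)
    also have "\<dots> = 1 - liminf (\<lambda>n. ereal (birkhoff_sum T f n x / n))"
      using ereal_Limsup_uminus[of sequentially "\<lambda>n. ereal (birkhoff_sum T f n x / n)"]
      by (simp add: minus_ereal_def)
    finally show ?thesis
      by (cases "liminf (\<lambda>n. ereal (birkhoff_sum T f n x / n))") (auto simp: one_ereal_def)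
  qed
  have nonneg: "0 \<le> d x" for x
  proof -
    have "liminf (\<lambda>n. ereal (birkhoff_sum T f n x / n)) \<le> limsup (\<lambda>n. ereal (birkhoff_sum T f n x / n))"
      by (intro Liminf_le_Limsup) simp
    then have "ereal (1 - upper_average f' x) \<le> ereal (upper_average f x)"
      using ereal_upper_average[of f x] f by (simp add: liminf[symmetric])
    then show ?thesis by (simp add: d_def)
  qed
  have "(\<integral>x. d x \<partial>M) \<le> 0"
    using int integral_upper_average[of f] integral_upper_average[of f'] f f' f'm assms(1)
    by (simp add: d_def f'_def prob_space)
  moreover have "0 \<le> (\<integral>x. d x \<partial>M)" using nonneg by simp
  ultimately have "(\<integral>x. d x \<partial>M) = 0" by simp
  then have "AE x in M. d x = 0"
    using int nonneg by (subst (asm) integral_nonneg_eq_0_iff_AE) (auto simp: d_def[abs_def])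
  then show ?thesis
  proof eventually_elim
    case (elim x)
    have "(\<lambda>n. ereal (birkhoff_sum T f n x / n)) \<longlonglongrightarrow> ereal (upper_average f x)"
    proof (rule Liminf_eq_Limsup)
      show "liminf (\<lambda>n. ereal (birkhoff_sum T f n x / n)) = ereal (upper_average f x)"
        using elim by (simp add: liminf[symmetric] d_def)
      show "limsup (\<lambda>n. ereal (birkhoff_sum T f n x / n)) = ereal (upper_average f x)"
        using ereal_upper_average[of f x] f by simp
    qed simp
    then show ?case by (auto simp: convergent_def)
  qed
qed

end

section \<open>Ergodic decomposition\<close>

text \<open>\<open>Y\<close> is the closed set on which the invariant measures are to live. The
  fixed point \<open>y0\<close> makes the set of these measures nonempty and supplies a default
  value for the components.\<close>

locale stone_system = stone_space X for X :: "'a topology" +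
  fixes T :: "'a \<Rightarrow> 'a" and Y :: "'a set" and y0 :: 'a
  assumes T_cont: "continuous_map X X T"
    and Y_closed: "closedin X Y"
    and T_Y: "T ` Y \<subseteq> Y"
    and y0: "y0 \<in> Y" "T y0 = y0"
begin

abbreviation B :: "'a measure" where "B \<equiv> borel_of X"

definition K :: "'a measure set" where
  "K = {\<mu>\<in>prob_measures X. (\<forall>A\<in>sets \<mu>. emeasure \<mu> {x\<in>topspace X. T x \<in> A} = emeasure \<mu> A) \<and>
     emeasure \<mu> Y = 1}"

lemma Y_sub: "Y \<subseteq> topspace X"
  by (rule closedin_subset[OF Y_closed])

lemma Y_sets [measurable]: "Y \<in> sets B"
  by (rule borel_of_closedin[OF Y_closed])

lemma T_in: "x \<in> topspace X \<Longrightarrow> T x \<in> topspace X"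
  using T_cont by (auto simp: continuous_map_def)

lemma T_measurable [measurable]: "T \<in> B \<rightarrow>\<^sub>M B"
  by (rule measurable_continuous_map[OF T_cont])

lemma funpow_Y: "x \<in> Y \<Longrightarrow> (T ^^ n) x \<in> Y"
  using T_Y by (induction n) auto

lemma clopens_vimage: "C \<in> clopens X \<Longrightarrow> {x\<in>topspace X. T x \<in> C} \<in> clopens X"
  using openin_continuous_map_preimage[OF T_cont] closedin_continuous_map_preimage[OF T_cont]
  by (auto simp: clopens_def)

declare clopens_sets [measurable]

lemma K_prob: "K \<subseteq> prob_measures X"
  by (auto simp: K_def)

lemma K_D:
  assumes "\<mu> \<in> K"
  shows "\<mu> \<in> prob_measures X" "prob_space \<mu>" "sets \<mu> = sets B" "space \<mu> = topspace X"
    "\<mu> \<in> space (prob_algebra B)"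
  using assms prob_measuresD[of \<mu> X] K_prob by (auto simp: prob_measures_eq[symmetric])

lemma K_measure_preserving_system:
  assumes "\<mu> \<in> K"
  shows "measure_preserving_system \<mu> T"
proof -
  interpret prob_space \<mu> by (rule K_D[OF assms])
  note [measurable_cong] = K_D(3)[OF assms]
  show ?thesis
  proof
    show "T \<in> \<mu> \<rightarrow>\<^sub>M \<mu>" by measurable
    show "distr \<mu> \<mu> T = \<mu>"
    proof (rule measure_eqI)
      fix A assume "A \<in> sets (distr \<mu> \<mu> T)"
      moreover have "T -` A \<inter> space \<mu> = {x\<in>topspace X. T x \<in> A}" by (auto simp: K_D(4)[OF assms])
      ultimately show "emeasure (distr \<mu> \<mu> T) A = emeasure \<mu> A"
        using assms \<open>T \<in> \<mu> \<rightarrow>\<^sub>M \<mu>\<close> by (auto simp: emeasure_distr K_def)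
    qed simp
  qed
qed

lemma K_AE_Y:
  assumes "\<mu> \<in> K"
  shows "AE x in \<mu>. x \<in> Y"
proof -
  interpret prob_space \<mu> by (rule K_D[OF assms])
  have "measure \<mu> Y = 1" using assms by (simp add: K_def measure_def)
  then show ?thesis by (rule AE_prob_1)
qed

text \<open>Invariance passes from the clopen generator to all Borel sets by uniqueness of measures,
  and mass one on \<open>Y\<close> is tested on clopen supersets. In this form the conditions are
  weak* closed and survive mixtures and limits of averages.\<close>

lemma K_iff_clopens:
  "\<mu> \<in> K \<longleftrightarrow> \<mu> \<in> prob_measures X \<and>
     (\<forall>C\<in>clopens X. measure \<mu> {x\<in>topspace X. T x \<in> C} = measure \<mu> C) \<and>
     (\<forall>C\<in>clopens X. Y \<subseteq> C \<longrightarrow> measure \<mu> C = 1)" (is "_ \<longleftrightarrow> ?R")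
proof
  assume \<mu>: "\<mu> \<in> K"
  interpret prob_space \<mu> by (rule K_D[OF \<mu>])
  have "measure \<mu> C = 1" if "C \<in> clopens X" "Y \<subseteq> C" for C
  proof -
    have "emeasure \<mu> Y \<le> emeasure \<mu> C"
      using that by (intro emeasure_mono) (auto simp: K_D[OF \<mu>])
    then have "emeasure \<mu> C = 1"
      using \<mu> emeasure_le_1[of C] by (auto simp: K_def intro: antisym)
    then show ?thesis by (simp add: measure_def)
  qed
  then show ?R using \<mu> by (auto simp: K_def measure_def clopens_measurable)
next
  assume R: ?R
  then have \<mu>: "\<mu> \<in> prob_measures X" by blast
  interpret prob_space \<mu> by (rule prob_measuresD[OF \<mu>])
  note [measurable_cong] = prob_measuresD(2)[OF \<mu>]
  have "distr \<mu> B T = \<mu>"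
  proof (rule measure_eqI_clopens)
    have "prob_space (distr \<mu> B T)" by (rule prob_space_distr) measurable
    then show "distr \<mu> B T \<in> prob_measures X" by (rule prob_measuresI) simp
    fix C assume C: "C \<in> clopens X"
    have "measure (distr \<mu> B T) C = measure \<mu> (T -` C \<inter> space \<mu>)"
      using C by (intro measure_distr) auto
    also have "T -` C \<inter> space \<mu> = {x\<in>topspace X. T x \<in> C}"
      by (auto simp: prob_measuresD(3)[OF \<mu>])
    finally show "measure (distr \<mu> B T) C = measure \<mu> C" using R C by simp
  qed (rule \<mu>)
  then have "emeasure \<mu> {x\<in>topspace X. T x \<in> A} = emeasure \<mu> A" if "A \<in> sets \<mu>" for A
  proof -
    have "emeasure (distr \<mu> B T) A = emeasure \<mu> (T -` A \<inter> space \<mu>)"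
      using that by (intro emeasure_distr) (auto simp: prob_measuresD(2)[OF \<mu>])
    moreover have "T -` A \<inter> space \<mu> = {x\<in>topspace X. T x \<in> A}"
      by (auto simp: prob_measuresD(3)[OF \<mu>])
    ultimately show ?thesis using \<open>distr \<mu> B T = \<mu>\<close> by simp
  qed
  moreover have "emeasure \<mu> Y = 1"
    using closed_full_measure[OF \<mu> Y_closed] R by blast
  ultimately show "\<mu> \<in> K" using \<mu> by (auto simp: K_def)
qed

lemma return_y0: "return B y0 \<in> K"
proof -
  have "y0 \<in> topspace X" using y0 Y_sub by auto
  moreover have "return B y0 \<in> prob_measures X"
    using \<open>y0 \<in> topspace X\<close> by (intro prob_measuresI prob_space_return) auto
  moreover have "{x\<in>topspace X. T x \<in> C} \<in> sets B" if "C \<in> clopens X" for C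
    using that clopens_vimage by (auto intro: clopens_sets)
  ultimately show ?thesis
    unfolding K_iff_clopens using y0 by (auto simp: measure_return clopens_sets indicator_def)
qed

definition avg :: "'a set \<Rightarrow> nat \<Rightarrow> 'a \<Rightarrow> real" where
  "avg C n x = birkhoff_sum T (indicator C) n x / n"

text \<open>Points of \<open>Y\<close> whose orbit frequencies exist on every clopen set. As there
  are countably many clopen sets, Birkhoff's theorem makes this a set of full measure for every
  measure in \<open>K\<close>.\<close>

definition generic :: "'a set" where
  "generic = {x\<in>Y. \<forall>C\<in>clopens X. convergent (\<lambda>n. avg C n x)}"

text \<open>The limit of the uniform measures along the orbit. Outside \<open>generic\<close> the
  point mass at \<open>y0\<close> keeps the values in \<open>K\<close>, so the map is total into
  \<open>K\<close>.\<close>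

definition component :: "'a \<Rightarrow> 'a measure" where
  "component x = (if x \<in> generic
     then (SOME \<mu>. \<mu> \<in> prob_measures X \<and> (\<forall>C\<in>clopens X. measure \<mu> C = lim (\<lambda>n. avg C n x)))
     else return B y0)"

lemma avg_measurable [measurable]: "C \<in> sets B \<Longrightarrow> avg C n \<in> borel_measurable B"
proof -
  assume [measurable]: "C \<in> sets B"
  have [measurable]: "(T ^^ i) \<in> B \<rightarrow>\<^sub>M B" for i by (induction i) auto
  show ?thesis unfolding avg_def[abs_def] birkhoff_sum_def by measurable
qed

lemma avg_bounds: "0 \<le> avg C n x" "avg C n x \<le> 1"
  using birkhoff_sum_bounds[of "indicator C" T n x]
  by (auto simp: avg_def divide_le_eq_1 indicator_def)

lemma generic_measurable [measurable]: "generic \<in> sets B"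
proof -
  \<comment> \<open>Cauchy instead of convergent: the former is visibly a countable combination of
    measurable conditions.\<close>
  have "{x\<in>space B. Cauchy (\<lambda>n. avg C n x)} \<in> sets B" if "C \<in> clopens X" for C
    using that by (intro sets_Collect_Cauchy avg_measurable clopens_sets)
  then have "Y \<inter> {x\<in>space B. \<forall>C\<in>clopens X. Cauchy (\<lambda>n. avg C n x)} \<in> sets B"
    by (intro sets.Int Y_sets sets.sets_Collect_countable_All' countable_clopens)
  also have "Y \<inter> {x\<in>space B. \<forall>C\<in>clopens X. Cauchy (\<lambda>n. avg C n x)} = generic"
    using Y_sub by (auto simp: generic_def Cauchy_convergent_iff)
  finally show ?thesis .
qed

lemma AE_generic:
  assumes "\<mu> \<in> K"
  shows "AE x in \<mu>. x \<in> generic"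
proof -
  interpret measure_preserving_system \<mu> T by (rule K_measure_preserving_system[OF assms])
  note [measurable_cong] = K_D(3)[OF assms]
  have "AE x in \<mu>. convergent (\<lambda>n. avg C n x)" if "C \<in> clopens X" for C
    unfolding avg_def using that by (intro birkhoff) (auto simp: indicator_def)
  then have "AE x in \<mu>. \<forall>C\<in>clopens X. convergent (\<lambda>n. avg C n x)"
    by (simp add: AE_ball_countable countable_clopens)
  with K_AE_Y[OF assms] show ?thesis by eventually_elim (auto simp: generic_def)
qed

lemma component_generic:
  assumes x: "x \<in> generic"
  shows "component x \<in> prob_measures X" "C \<in> clopens X \<Longrightarrow> (\<lambda>n. avg C n x) \<longlonglongrightarrow> measure (component x) C"
proof -
  have conv: "(\<lambda>n. avg C n x) \<longlonglongrightarrow> lim (\<lambda>n. avg C n x)" if "C \<in> clopens X" for C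
    using that x by (auto simp: generic_def convergent_LIMSEQ_iff[symmetric])
  have xY: "x \<in> topspace X" using x Y_sub by (auto simp: generic_def)
  have orb: "(T ^^ i) x \<in> topspace X" for i
    using xY T_in by (induction i) auto
  have "\<exists>\<mu>\<in>prob_measures X. \<forall>C\<in>clopens X. measure \<mu> C = lim (\<lambda>n. avg C n x)"
  proof (rule finitely_additive_extends)
    show "0 \<le> lim (\<lambda>n. avg C n x)" if "C \<in> clopens X" for C
      using avg_bounds by (intro LIMSEQ_le_const[OF conv[OF that]]) auto
    have "\<forall>\<^sub>F n in sequentially. avg (topspace X) n x = 1"
      unfolding eventually_sequentially
      by (intro exI[of _ 1]) (auto simp: avg_def birkhoff_sum_def orb)
    then show "lim (\<lambda>n. avg (topspace X) n x) = 1"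
      by (intro limI tendsto_eventually)
    fix C D assume CD: "C \<in> clopens X" "D \<in> clopens X" "C \<inter> D = {}"
    have "(\<lambda>n. avg C n x + avg D n x) \<longlonglongrightarrow> lim (\<lambda>n. avg C n x) + lim (\<lambda>n. avg D n x)"
      using CD by (intro tendsto_add conv)
    moreover have "avg C n x + avg D n x = avg (C \<union> D) n x" for n
      using CD by (simp add: avg_def birkhoff_sum_def add_divide_distrib[symmetric]
          sum.distrib[symmetric] indicator_add)
    ultimately show "lim (\<lambda>n. avg (C \<union> D) n x) = lim (\<lambda>n. avg C n x) + lim (\<lambda>n. avg D n x)"
      by (intro limI) simp
  qed
  then have "\<exists>\<mu>. \<mu> \<in> prob_measures X \<and> (\<forall>C\<in>clopens X. measure \<mu> C = lim (\<lambda>n. avg C n x))"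
    by blast
  from someI_ex[OF this] x conv
  show "component x \<in> prob_measures X" "C \<in> clopens X \<Longrightarrow> (\<lambda>n. avg C n x) \<longlonglongrightarrow> measure (component x) C"
    by (auto simp: component_def)
qed

text \<open>Once \<open>n \<ge> 1\<close>, every average of a clopen set containing the orbit equals
  one. This is applied to clopen neighbourhoods of \<open>Y\<close> and to the finite orbit of a
  periodic point.\<close>

lemma component_closed_orbit:
  assumes x: "x \<in> generic" and Z: "closedin X Z" "\<And>i. (T ^^ i) x \<in> Z"
  shows "emeasure (component x) Z = 1"
proof (rule closed_full_measure[OF component_generic(1)[OF x] Z(1)])
  fix C assume C: "C \<in> clopens X" "Z \<subseteq> C"
  have "\<forall>\<^sub>F n in sequentially. avg C n x = 1"
    unfolding eventually_sequentially
    using C Z(2) by (intro exI[of _ 1]) (auto simp: avg_def birkhoff_sum_def subset_iff)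
  then have "(\<lambda>n. avg C n x) \<longlonglongrightarrow> 1" by (rule tendsto_eventually)
  with component_generic(2)[OF x C(1)] show "measure (component x) C = 1" by (rule LIMSEQ_unique)
qed

text \<open>The frequencies of a clopen set and of its preimage differ by a boundary term of order
  \<open>1 / n\<close>, so the limit is invariant.\<close>

lemma component_in_K: "component x \<in> K"
proof (cases "x \<in> generic")
  case True
  note x = component_generic[OF True]
  interpret prob_space "component x" by (rule prob_measuresD[OF x(1)])
  have "measure (component x) {x \<in> topspace X. T x \<in> C} = measure (component x) C" if C: "C \<in> clopens X" for C
  proof (rule LIMSEQ_unique)
    have xt: "(T ^^ i) x \<in> topspace X" for i
      using True Y_sub funpow_Y by (auto simp: generic_def)
    let ?u = "\<lambda>n. (indicator C ((T ^^ n) x) - indicator C x) / real n"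
    have "\<bar>?u n\<bar> \<le> inverse (real n)" for n
      by (auto simp: divide_simps indicator_def)
    then have "?u \<longlonglongrightarrow> 0"
      by (intro Lim_null_comparison[OF _ lim_inverse_n]) auto
    then have "(\<lambda>n. avg C n x + ?u n) \<longlonglongrightarrow> measure (component x) C + 0"
      using x(2)[OF C] by (intro tendsto_add)
    moreover have "avg {x \<in> topspace X. T x \<in> C} n x = avg C n x + ?u n" for n
    proof -
      have "birkhoff_sum T (indicator {x \<in> topspace X. T x \<in> C}) n x = birkhoff_sum T (indicator C) n (T x)"
        unfolding birkhoff_sum_def using xt
        by (intro sum.cong) (auto simp: indicator_def funpow_swap1)
      then show ?thesis
        by (simp add: avg_def birkhoff_sum_shift add_divide_distrib diff_divide_distrib)
    qed
    ultimately show "(\<lambda>n. avg {x \<in> topspace X. T x \<in> C} n x) \<longlonglongrightarrow> measure (component x) C" by simp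
    show "(\<lambda>n. avg {x \<in> topspace X. T x \<in> C} n x) \<longlonglongrightarrow> measure (component x) {x \<in> topspace X. T x \<in> C}"
      by (rule x(2)[OF clopens_vimage[OF C]])
  qed
  moreover have "measure (component x) C = 1" if "C \<in> clopens X" "Y \<subseteq> C" for C
  proof -
    have "emeasure (component x) C = 1"
      using True that funpow_Y by (intro component_closed_orbit) (auto simp: clopens_def generic_def)
    then show ?thesis by (simp add: emeasure_eq_measure)
  qed
  ultimately show ?thesis using x(1) by (auto simp: K_iff_clopens)
next
  case False
  then show ?thesis by (simp add: component_def return_y0)
qed

lemma component_measurable [measurable]: "component \<in> B \<rightarrow>\<^sub>M prob_algebra B"
proof (rule measurable_prob_algebra_generated[OF sets_borel_of_clopens Int_stable_clopens])
  show "clopens X \<subseteq> Pow (topspace X)" using clopens_sub by auto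
  show "prob_space (component x)" "sets (component x) = sets B" for x using component_in_K K_D by auto
  fix C assume C: "C \<in> clopens X"
  have [measurable]: "C \<in> sets B" by (rule clopens_sets[OF C])
  have "(\<lambda>x. if x \<in> generic then ennreal (lim (\<lambda>n. avg C n x)) else indicator C y0) \<in> borel_measurable B"
    by measurable
  moreover have "emeasure (component x) C = (if x \<in> generic then ennreal (lim (\<lambda>n. avg C n x)) else indicator C y0)" for x
  proof -
    interpret prob_space "component x" by (rule K_D[OF component_in_K])
    show ?thesis
    proof (cases "x \<in> generic")
      case True
      then show ?thesis using limI[OF component_generic(2)[OF True C]] by (simp add: emeasure_eq_measure)
    next
      case False
      then show ?thesis using C by (simp add: component_def clopens_sets)
    qed
  qed
  ultimately show "(\<lambda>x. emeasure (component x) C) \<in> borel_measurable B" by simp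
qed

lemma component_measurable_subprob [measurable]: "component \<in> B \<rightarrow>\<^sub>M subprob_algebra B"
  by (rule measurable_prob_algebraD[OF component_measurable])

text \<open>For an invariant measure this is a version of the conditional probability of
  \<open>C\<close> given the invariant sets, chosen independently of the measure.\<close>

definition mass :: "'a set \<Rightarrow> 'a \<Rightarrow> real" where
  "mass C x = measure (component x) C"

lemma mass_bounds: "0 \<le> mass C x" "mass C x \<le> 1"
  using prob_space.prob_le_1[OF K_D(2)[OF component_in_K]] by (auto simp: mass_def)

lemma mass_measurable [measurable]: "C \<in> sets B \<Longrightarrow> mass C \<in> borel_measurable B"
proof -
  assume "C \<in> sets B"
  then have "(\<lambda>M. measure M C) \<in> prob_algebra B \<rightarrow>\<^sub>M borel" by measurable
  from measurable_compose[OF component_measurable this] show ?thesis by (simp add: mass_def[abs_def])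
qed

lemma emeasure_component: "emeasure (component x) C = ennreal (mass C x)"
proof -
  interpret prob_space "component x" by (rule K_D[OF component_in_K])
  show ?thesis by (simp add: emeasure_eq_measure mass_def)
qed

lemma mass_integrable:
  assumes "\<mu> \<in> prob_measures X" "C \<in> sets B"
  shows "integrable \<mu> (mass C)" "integrable \<mu> (\<lambda>x. (mass C x)\<^sup>2)"
proof -
  interpret prob_space \<mu> by (rule prob_measuresD[OF assms(1)])
  note [measurable_cong] = prob_measuresD(2)[OF assms(1)]
  show "integrable \<mu> (mass C)" "integrable \<mu> (\<lambda>x. (mass C x)\<^sup>2)"
    using assms(2) mass_bounds by (auto intro!: integrable_const_bound[of _ 1] simp: power_le_one)
qed

lemma integral_avg:
  assumes "\<mu> \<in> K" "C \<in> clopens X" "n \<ge> 1"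
  shows "(\<integral>x. avg C n x \<partial>\<mu>) = measure \<mu> C"
proof -
  interpret measure_preserving_system \<mu> T by (rule K_measure_preserving_system[OF assms(1)])
  note [measurable_cong] = K_D(3)[OF assms(1)]
  have [measurable]: "C \<in> sets B" by (rule clopens_sets[OF assms(2)])
  have "(\<integral>x. birkhoff_sum T (indicator C) n x \<partial>\<mu>) = n * (\<integral>x. indicator C x \<partial>\<mu>)"
    by (rule integral_birkhoff_sum) (auto intro!: integrable_const_bound[of _ 1] simp: indicator_def)
  then show ?thesis
    using assms(3) sets.sets_into_space[of C B] by (simp add: avg_def K_D(4)[OF assms(1)] Int_absorb2)
qed

text \<open>The averages with \<open>n \<ge> 1\<close> all have integral
  \<open>measure \<mu> C\<close>, and they converge boundedly to \<open>mass C\<close> almost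
  everywhere.\<close>

lemma integral_mass:
  assumes "\<mu> \<in> K" "C \<in> clopens X"
  shows "(\<integral>x. mass C x \<partial>\<mu>) = measure \<mu> C"
proof -
  interpret measure_preserving_system \<mu> T by (rule K_measure_preserving_system[OF assms(1)])
  note [measurable_cong] = K_D(3)[OF assms(1)]
  have [measurable]: "C \<in> sets B" by (rule clopens_sets[OF assms(2)])
  have "(\<lambda>n. \<integral>x. avg C n x \<partial>\<mu>) \<longlonglongrightarrow> (\<integral>x. mass C x \<partial>\<mu>)"
  proof (rule integral_dominated_convergence[where w="\<lambda>_. 1"])
    show "AE x in \<mu>. (\<lambda>n. avg C n x) \<longlonglongrightarrow> mass C x"
      using AE_generic[OF assms(1)] by eventually_elim (simp add: mass_def component_generic(2) assms)
    show "AE x in \<mu>. norm (avg C n x) \<le> 1" for n using avg_bounds by auto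
  qed auto
  moreover have "(\<lambda>n. \<integral>x. avg C n x \<partial>\<mu>) \<longlonglongrightarrow> measure \<mu> C"
    using integral_avg[OF assms]
    by (intro tendsto_eventually) (auto simp: eventually_sequentially intro!: exI[of _ 1])
  ultimately show ?thesis by (rule LIMSEQ_unique)
qed

lemma emeasure_bind_component:
  assumes "\<rho> \<in> prob_measures X" "A \<in> sets B"
  shows "emeasure (\<rho> \<bind> component) A = (\<integral>\<^sup>+x. emeasure (component x) A \<partial>\<rho>)"
  using assms by (intro emeasure_bind_prob_algebra[OF _ component_measurable]) (auto simp: prob_measures_eq)

lemma measure_bind_component:
  assumes "\<rho> \<in> prob_measures X" "A \<in> sets B"
  shows "measure (\<rho> \<bind> component) A = (\<integral>x. mass A x \<partial>\<rho>)"
proof -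
  have "emeasure (\<rho> \<bind> component) A = (\<integral>\<^sup>+x. ennreal (mass A x) \<partial>\<rho>)"
    by (simp add: emeasure_bind_component[OF assms] emeasure_component)
  also have "\<dots> = ennreal (\<integral>x. mass A x \<partial>\<rho>)"
    by (rule nn_integral_eq_integral[OF mass_integrable(1)[OF assms]]) (simp add: mass_bounds)
  finally show ?thesis
    by (intro measure_eq_emeasure_eq_ennreal) (simp_all add: mass_bounds)
qed

text \<open>Mixtures of components stay in \<open>K\<close> for an arbitrary mixing probability.
  This freedom is used with an invariant measure conditioned on a set, to split the measure in two
  inside \<open>K\<close>.\<close>

lemma bind_component_in_K:
  assumes "\<rho> \<in> prob_measures X"
  shows "\<rho> \<bind> component \<in> K"
proof -
  interpret prob_space \<rho> by (rule prob_measuresD[OF assms])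
  have "\<rho> \<bind> component \<in> prob_measures X"
    using prob_space_bind'[OF _ component_measurable] sets_bind'[OF _ component_measurable] assms
    by (auto simp: prob_measures_eq space_prob_algebra)
  moreover have "measure (\<rho> \<bind> component) {x \<in> topspace X. T x \<in> C} = measure (\<rho> \<bind> component) C" if C: "C \<in> clopens X" for C
    using C component_in_K
    by (simp add: measure_bind_component[OF assms] clopens_sets clopens_vimage mass_def K_iff_clopens)
  moreover have "measure (\<rho> \<bind> component) C = 1" if C: "C \<in> clopens X" "Y \<subseteq> C" for C
    using C component_in_K by (simp add: measure_bind_component[OF assms] clopens_sets mass_def K_iff_clopens prob_space)
  ultimately show ?thesis by (auto simp: K_iff_clopens)
qed

text \<open>The barycenter formula: an invariant measure is the mixture, weighted by itself, of the
  components of its points.\<close>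

lemma bind_component: "\<mu> \<in> K \<Longrightarrow> \<mu> \<bind> component = \<mu>"
  by (rule measure_eqI_clopens)
    (simp_all add: K_D bind_component_in_K measure_bind_component integral_mass clopens_sets)

lemma emeasure_barycenter:
  assumes "\<mu> \<in> K" "A \<in> sets B"
  shows "(\<integral>\<^sup>+x. emeasure (component x) A \<partial>\<mu>) = emeasure \<mu> A"
  using emeasure_bind_component[OF K_D(1)[OF assms(1)] assms(2)] by (simp add: bind_component assms)

section \<open>Ergodic measures as measures of zero variance\<close>

definition second_moment :: "'a set \<Rightarrow> 'a measure \<Rightarrow> real" where
  "second_moment C \<nu> = (\<integral>y. (mass C y)\<^sup>2 \<partial>\<nu>)"

text \<open>Ergodicity as vanishing variance of the orbit frequencies. By \<open>Erg_iff\<close>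
  this means that almost every point has the measure as its component, but in terms of integrals it
  is a measurable condition on the measure.\<close>

definition Erg :: "'a measure set" where
  "Erg = {\<nu>\<in>K. \<forall>C\<in>clopens X. second_moment C \<nu> = (measure \<nu> C)\<^sup>2}"

lemma variance_mass:
  assumes "\<nu> \<in> K" "C \<in> clopens X"
  shows "(\<integral>y. (mass C y - measure \<nu> C)\<^sup>2 \<partial>\<nu>) = second_moment C \<nu> - (measure \<nu> C)\<^sup>2"
proof -
  interpret prob_space \<nu> by (rule K_D[OF assms(1)])
  have C: "C \<in> sets B" by (rule clopens_sets[OF assms(2)])
  note int = mass_integrable[OF K_D(1)[OF assms(1)] C]
  have "(\<integral>y. (mass C y - measure \<nu> C)\<^sup>2 \<partial>\<nu>)
    = (\<integral>y. (mass C y)\<^sup>2 - 2 * measure \<nu> C * mass C y + (measure \<nu> C)\<^sup>2 \<partial>\<nu>)"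
    by (rule Bochner_Integration.integral_cong) (auto simp: power2_diff)
  also have "\<dots> = second_moment C \<nu> - 2 * measure \<nu> C * measure \<nu> C + (measure \<nu> C)\<^sup>2"
    using int by (simp add: second_moment_def integral_mass[OF assms] prob_space)
  finally show ?thesis by (simp add: power2_eq_square)
qed

lemma second_moment_ge: "\<nu> \<in> K \<Longrightarrow> C \<in> clopens X \<Longrightarrow> (measure \<nu> C)\<^sup>2 \<le> second_moment C \<nu>"
  using variance_mass[of \<nu> C] Bochner_Integration.integral_nonneg[of \<nu> "\<lambda>y. (mass C y - measure \<nu> C)\<^sup>2"]
  by simp

lemma second_moment_eq_iff:
  assumes "\<nu> \<in> K" "C \<in> clopens X"
  shows "second_moment C \<nu> = (measure \<nu> C)\<^sup>2 \<longleftrightarrow> (AE y in \<nu>. mass C y = measure \<nu> C)"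
proof -
  interpret prob_space \<nu> by (rule K_D[OF assms(1)])
  note [measurable_cong] = K_D(3)[OF assms(1)]
  have C [measurable]: "C \<in> sets B" by (rule clopens_sets[OF assms(2)])
  have "(mass C y - measure \<nu> C)\<^sup>2 \<le> 1" for y
  proof -
    have "\<bar>mass C y - measure \<nu> C\<bar> \<le> 1"
      using mass_bounds[of C y] prob_le_1[of C] measure_nonneg[of \<nu> C] by linarith
    then show ?thesis by (simp add: abs_square_le_1)
  qed
  then have "integrable \<nu> (\<lambda>y. (mass C y - measure \<nu> C)\<^sup>2)"
    by (intro integrable_const_bound[of _ 1]) auto
  then have "(\<integral>y. (mass C y - measure \<nu> C)\<^sup>2 \<partial>\<nu>) = 0 \<longleftrightarrow> (AE y in \<nu>. (mass C y - measure \<nu> C)\<^sup>2 = 0)"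
    by (intro integral_nonneg_eq_0_iff_AE) auto
  then show ?thesis by (simp add: variance_mass[OF assms])
qed

lemma component_eq_iff: "\<nu> \<in> K \<Longrightarrow> component y = \<nu> \<longleftrightarrow> (\<forall>C\<in>clopens X. mass C y = measure \<nu> C)"
  using measure_eqI_clopens[of "component y" \<nu>] component_in_K[of y] by (auto simp: K_D mass_def)

lemma Erg_iff: "\<nu> \<in> Erg \<longleftrightarrow> \<nu> \<in> K \<and> (AE y in \<nu>. component y = \<nu>)"
  by (auto simp: Erg_def second_moment_eq_iff AE_ball_countable countable_clopens component_eq_iff)

lemma second_moment_measurable [measurable]:
  assumes [measurable]: "C \<in> sets B"
  shows "second_moment C \<in> borel_measurable (subprob_algebra B)"
  unfolding second_moment_def[abs_def] by (rule integral_measurable_subprob_algebra) measurable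

text \<open>The variance of \<^term>\<open>mass C\<close> under \<^term>\<open>component x\<close> vanishes for almost every \<^term>\<open>x\<close>, because
  its integral is the difference of two expressions for the second moment.\<close>

lemma AE_component_Erg:
  assumes "\<nu> \<in> K"
  shows "AE x in \<nu>. component x \<in> Erg"
proof -
  interpret prob_space \<nu> by (rule K_D[OF assms])
  note [measurable_cong] = K_D(3)[OF assms]
  have "AE x in \<nu>. second_moment C (component x) = (measure (component x) C)\<^sup>2" if C: "C \<in> clopens X" for C
  proof -
    have [measurable]: "C \<in> sets B" by (rule clopens_sets[OF C])
    have sm: "0 \<le> second_moment C (component x)" "second_moment C (component x) \<le> 1" for x
    proof -
      interpret ex: prob_space "component x" by (rule K_D[OF component_in_K])
      have "second_moment C (component x) \<le> (\<integral>y. 1 \<partial>component x)"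
        unfolding second_moment_def using mass_bounds
        by (intro integral_mono mass_integrable K_D[OF component_in_K]) (auto simp: power_le_one)
      then show "second_moment C (component x) \<le> 1" by (simp add: ex.prob_space)
    qed (simp add: second_moment_def)
    have int: "integrable \<nu> (\<lambda>x. second_moment C (component x))"
      using sm by (intro integrable_const_bound[of _ 1]) auto
    \<comment> \<open>Integrating against \<open>component x\<close> and afterwards over
      \<open>x\<close> is integrating against the bind, which is \<open>\<nu>\<close> again; so the
      mean second moment of the components is that of \<open>\<nu>\<close>.\<close>
    have "(\<integral>x. second_moment C (component x) \<partial>\<nu>) = (\<integral>y. (mass C y)\<^sup>2 \<partial>(\<nu> \<bind> component))"
      unfolding second_moment_def
    proof (rule integral_bind[symmetric, where K=B and B=1 and B'=1])
      show "\<bar>(mass C x)\<^sup>2\<bar> \<le> 1" for x using mass_bounds[of C x] by (simp add: power_le_one)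
      show "AE x in \<nu>. emeasure (component x) (space (component x)) \<le> ennreal 1"
        using prob_space.emeasure_space_1[OF K_D(2)[OF component_in_K]] by simp
      show "finite_measure \<nu>" by (rule finite_measure_axioms)
    qed measurable
    also have "\<dots> = (\<integral>y. (mass C y)\<^sup>2 \<partial>\<nu>)" by (simp add: bind_component[OF assms])
    finally have eq: "(\<integral>x. second_moment C (component x) - (mass C x)\<^sup>2 \<partial>\<nu>) = 0"
      using int mass_integrable[OF K_D(1)[OF assms], of C] by simp
    have "AE x in \<nu>. second_moment C (component x) - (mass C x)\<^sup>2 = 0"
    proof (subst integral_nonneg_eq_0_iff_AE[symmetric])
      show "integrable \<nu> (\<lambda>x. second_moment C (component x) - (mass C x)\<^sup>2)"
        using int mass_integrable[OF K_D(1)[OF assms], of C] by simp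
      show "AE x in \<nu>. 0 \<le> second_moment C (component x) - (mass C x)\<^sup>2"
        using second_moment_ge[OF component_in_K C] by (simp add: mass_def)
    qed (rule eq)
    then show ?thesis by (simp add: mass_def)
  qed
  then show ?thesis
    by (simp add: Erg_def component_in_K AE_ball_countable countable_clopens)
qed

lemma K_eqI_AE:
  assumes "\<nu> \<in> K" "\<mu> \<in> K" "AE y in \<mu>. component y = \<nu>"
  shows "\<mu> = \<nu>"
proof (rule measure_eqI_clopens)
  interpret prob_space \<mu> by (rule K_D[OF assms(2)])
  note [measurable_cong] = K_D(3)[OF assms(2)]
  fix C assume C: "C \<in> clopens X"
  have [measurable]: "C \<in> sets B" by (rule clopens_sets[OF C])
  have "measure \<mu> C = (\<integral>x. mass C x \<partial>\<mu>)" by (rule integral_mass[OF assms(2) C, symmetric])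
  also have "\<dots> = (\<integral>x. measure \<nu> C \<partial>\<mu>)"
    using assms(3) by (intro integral_cong_AE) (auto simp: mass_def)
  finally show "measure \<mu> C = measure \<nu> C" by (simp add: prob_space)
qed (simp_all add: assms K_D)

lemma component_fibre_measurable: "\<nu> \<in> K \<Longrightarrow> {y\<in>topspace X. component y = \<nu>} \<in> sets B"
proof -
  assume \<nu>: "\<nu> \<in> K"
  have "{y\<in>space B. \<forall>C\<in>clopens X. mass C y = measure \<nu> C} \<in> sets B"
  proof (intro sets.sets_Collect_countable_All' countable_clopens)
    fix C assume "C \<in> clopens X"
    then have [measurable]: "C \<in> sets B" by (rule clopens_sets)
    show "{y\<in>space B. mass C y = measure \<nu> C} \<in> sets B" by measurable
  qed
  then show ?thesis by (simp add: component_eq_iff[OF \<nu>])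
qed

text \<open>An ergodic measure gives full mass to its fibre under \<open>component\<close>; both
  parts of a mixture inherit this, and a measure in \<open>K\<close> is determined by its almost
  sure component. Conversely, a non-constant \<open>mass C\<close> allows the measure to be cut
  along the set where it exceeds its mean.\<close>

lemma extreme_eq_Erg: "extreme_measures K = Erg"
proof (intro equalityI subsetI)
  fix \<nu> assume \<nu>: "\<nu> \<in> Erg"
  then have \<nu>K: "\<nu> \<in> K" by (simp add: Erg_def)
  let ?D = "{y\<in>topspace X. component y = \<nu>}"
  show "\<nu> \<in> extreme_measures K"
    unfolding extreme_measures_def
  proof (intro CollectI conjI ballI allI impI \<nu>K; elim conjE)
    fix \<nu>1 \<nu>2 t assume K12: "\<nu>1 \<in> K" "\<nu>2 \<in> K" and t: "0 < t" "t < 1" "\<nu> = mix t \<nu>1 \<nu>2"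
    interpret \<nu>: prob_space \<nu> by (rule K_D[OF \<nu>K])
    interpret \<nu>1: prob_space \<nu>1 by (rule K_D[OF K12(1)])
    interpret \<nu>2: prob_space \<nu>2 by (rule K_D[OF K12(2)])
    have "AE y in \<nu>. y \<in> ?D" using \<nu> AE_space[of \<nu>] by (auto simp: Erg_iff K_D[OF \<nu>K] elim: AE_mp)
    then have full: "measure \<nu> ?D = 1"
      using component_fibre_measurable[OF \<nu>K] by (subst (asm) \<nu>.prob_eq_1[symmetric]) (auto simp: K_D[OF \<nu>K])
    have eq: "measure \<nu> ?D = t * measure \<nu>1 ?D + (1 - t) * measure \<nu>2 ?D"
      using t K12 component_fibre_measurable[OF \<nu>K] by (simp add: measure_mix K_D)
    have le: "t * measure \<nu>1 ?D \<le> t" "(1 - t) * measure \<nu>2 ?D \<le> 1 - t"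
      using t by (auto intro!: mult_left_le)
    have "u = t \<and> v = 1 - t" if "1 = u + v" "u \<le> t" "v \<le> 1 - t" for u v
      using that by linarith
    from this[OF eq[unfolded full] le]
    have "t * measure \<nu>1 ?D = t" "(1 - t) * measure \<nu>2 ?D = 1 - t" by simp_all
    then have one: "measure \<nu>1 ?D = 1" "measure \<nu>2 ?D = 1" using t by auto
    have "AE y in \<nu>1. y \<in> ?D" "AE y in \<nu>2. y \<in> ?D"
      using \<nu>1.AE_prob_1[OF one(1)] \<nu>2.AE_prob_1[OF one(2)] by blast+
    then have "AE y in \<nu>1. component y = \<nu>" "AE y in \<nu>2. component y = \<nu>" by auto
    then show "\<nu>1 = \<nu>" "\<nu>2 = \<nu>"
      using K_eqI_AE[OF \<nu>K K12(1)] K_eqI_AE[OF \<nu>K K12(2)] by blast+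
  qed
next
  fix \<nu> assume ext: "\<nu> \<in> extreme_measures K"
  then have \<nu>K: "\<nu> \<in> K" by (simp add: extreme_measures_def)
  interpret prob_space \<nu> by (rule K_D[OF \<nu>K])
  note [measurable_cong] = K_D(3)[OF \<nu>K]
  show "\<nu> \<in> Erg"
  proof (rule ccontr)
    assume "\<nu> \<notin> Erg"
    then obtain C where C: "C \<in> clopens X" "\<not> (AE y in \<nu>. mass C y = measure \<nu> C)"
      using \<nu>K by (auto simp: Erg_def second_moment_eq_iff)
    have Cm [measurable]: "C \<in> sets B" by (rule clopens_sets[OF C(1)])
    define c where "c = measure \<nu> C"
    have int: "integrable \<nu> (mass C)" "(\<integral>x. mass C x \<partial>\<nu>) = c"
      using mass_integrable[OF K_D(1)[OF \<nu>K] Cm] integral_mass[OF \<nu>K C(1)] by (auto simp: c_def)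
    \<comment> \<open>Since \<open>c\<close> is the mean of \<open>mass C\<close>, a non-constant
      \<open>mass C\<close> exceeds \<open>c\<close> on a set of measure strictly between 0 and 1;
      the two extreme values are excluded separately below.\<close>
    define D where "D = {y\<in>topspace X. c < mass C y}"
    have "{y\<in>space B. c < mass C y} \<in> sets B" by measurable
    then have D [measurable]: "D \<in> sets B" by (simp add: D_def)
    have ind: "integrable \<nu> (\<lambda>x. indicator D x * f x)" if "integrable \<nu> f" for f :: "'a \<Rightarrow> real"
      using integrable_mult_indicator[of D \<nu> f] that D by (simp add: K_D[OF \<nu>K])
    define E where "E = topspace X - D"
    have E [measurable]: "E \<in> sets B" using D by (auto simp: E_def intro: sets.compl_sets[of _ B, simplified])
    define a where "a = measure \<nu> D"
    have aE: "measure \<nu> E = 1 - a"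
      using prob_compl[of D] D by (simp add: E_def a_def K_D[OF \<nu>K])
    have a0: "a \<noteq> 0"
    proof
      assume "a = 0"
      then have "AE y in \<nu>. y \<notin> D"
        using D by (intro AE_not_in) (auto simp: a_def emeasure_eq_measure null_sets_def K_D[OF \<nu>K])
      then have le: "AE y in \<nu>. 0 \<le> c - mass C y"
        using AE_space[of \<nu>] by eventually_elim (auto simp: D_def K_D[OF \<nu>K])
      have "(\<integral>x. c - mass C x \<partial>\<nu>) = 0" using int by (simp add: prob_space)
      then have "AE y in \<nu>. c - mass C y = 0"
        using le int by (subst (asm) integral_nonneg_eq_0_iff_AE) auto
      then have "AE y in \<nu>. mass C y = c" by eventually_elim simp
      with C(2) show False by (simp add: c_def)
    qed
    \<comment> \<open>The excess of \<open>mass C\<close> over its mean on \<open>D\<close>. Were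
      the part of \<open>\<nu>\<close> over \<open>D\<close> equal to \<open>\<nu>\<close>, this
      excess would vanish, which is the final contradiction.\<close>
    have pos: "(\<integral>x. indicator D x * (mass C x - c) \<partial>\<nu>) > 0"
    proof -
      have i: "integrable \<nu> (\<lambda>x. indicator D x * (mass C x - c))"
        using int by (intro ind) auto
      have nn: "AE x in \<nu>. 0 \<le> indicator D x * (mass C x - c)" by (auto simp: D_def indicator_def)
      have "(\<integral>x. indicator D x * (mass C x - c) \<partial>\<nu>) \<noteq> 0"
      proof
        assume "(\<integral>x. indicator D x * (mass C x - c) \<partial>\<nu>) = 0"
        then have "AE x in \<nu>. indicator D x * (mass C x - c) = 0"
          by (subst (asm) integral_nonneg_eq_0_iff_AE[OF i nn])
        then have "AE x in \<nu>. x \<notin> D" by (auto simp: D_def elim!: AE_mp)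
        then have "measure \<nu> D = 0" using D by (subst prob_eq_0) (auto simp: K_D[OF \<nu>K])
        with a0 show False by (simp add: a_def)
      qed
      moreover have "0 \<le> (\<integral>x. indicator D x * (mass C x - c) \<partial>\<nu>)"
        using nn by (rule integral_nonneg_AE)
      ultimately show ?thesis by simp
    qed
    have a1: "a \<noteq> 1"
    proof
      assume "a = 1"
      then have "AE x in \<nu>. x \<in> D" by (auto simp: a_def intro: AE_prob_1)
      then have "(\<integral>x. indicator D x * (mass C x - c) \<partial>\<nu>) = (\<integral>x. mass C x - c \<partial>\<nu>)"
        by (intro integral_cong_AE) (auto elim!: AE_mp)
      also have "\<dots> = 0" using int by (simp add: prob_space)
      finally show False using pos by simp
    qed
    have a: "0 < a" "a < 1" using a0 a1 prob_le_1[of D] by (auto simp: a_def less_le)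
    have emD: "emeasure \<nu> D = ennreal a" "emeasure \<nu> E = ennreal (1 - a)"
      using aE by (auto simp: a_def emeasure_eq_measure)
    \<comment> \<open>The conditioned measures enter only through their mixtures of components,
      which lie in \<open>K\<close> by construction; invariance of \<open>D\<close> never has to be
      discussed.\<close>
    define \<rho>1 where "\<rho>1 = uniform_measure \<nu> D"
    define \<rho>2 where "\<rho>2 = uniform_measure \<nu> E"
    have \<rho>: "\<rho>1 \<in> prob_measures X" "\<rho>2 \<in> prob_measures X"
      using a unfolding \<rho>1_def \<rho>2_def
      by (auto intro!: prob_measuresI prob_space_uniform_measure simp: emD K_D[OF \<nu>K])
    have cancel: "ennreal b * (z / ennreal b) = z" if "0 < b" for b z
      using that by (subst ennreal_times_divide, subst mult.commute, intro ennreal_mult_divide_eq) auto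
    have nu1: "ennreal a * emeasure (\<rho>1 \<bind> component) A = (\<integral>\<^sup>+x. emeasure (component x) A * indicator D x \<partial>\<nu>)"
      and nu2: "ennreal (1 - a) * emeasure (\<rho>2 \<bind> component) A = (\<integral>\<^sup>+x. emeasure (component x) A * indicator E x \<partial>\<nu>)"
      if A [measurable]: "A \<in> sets B" for A
    proof -
      have [measurable]: "(\<lambda>x. emeasure (component x) A) \<in> borel_measurable \<nu>" by measurable
      have "emeasure (\<rho>1 \<bind> component) A = (\<integral>\<^sup>+x. emeasure (component x) A * indicator D x \<partial>\<nu>) / ennreal a"
        unfolding emeasure_bind_component[OF \<rho>(1) A] unfolding \<rho>1_def emD[symmetric]
        by (rule nn_integral_uniform_measure) auto
      then show "ennreal a * emeasure (\<rho>1 \<bind> component) A = (\<integral>\<^sup>+x. emeasure (component x) A * indicator D x \<partial>\<nu>)"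
        using a by (simp only: cancel diff_gt_0_iff_gt)
      have "emeasure (\<rho>2 \<bind> component) A = (\<integral>\<^sup>+x. emeasure (component x) A * indicator E x \<partial>\<nu>) / ennreal (1 - a)"
        unfolding emeasure_bind_component[OF \<rho>(2) A] unfolding \<rho>2_def emD[symmetric]
        by (rule nn_integral_uniform_measure) auto
      then show "ennreal (1 - a) * emeasure (\<rho>2 \<bind> component) A = (\<integral>\<^sup>+x. emeasure (component x) A * indicator E x \<partial>\<nu>)"
        using a by (simp only: cancel diff_gt_0_iff_gt)
    qed
    have K12: "\<rho>1 \<bind> component \<in> K" "\<rho>2 \<bind> component \<in> K" using \<rho> by (auto intro: bind_component_in_K)
    have "\<nu> = mix a (\<rho>1 \<bind> component) (\<rho>2 \<bind> component)"
    proof (rule measure_eqI)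
      show "sets \<nu> = sets (mix a (\<rho>1 \<bind> component) (\<rho>2 \<bind> component))" using K12 by (simp add: K_D[OF \<nu>K] K_D)
      fix A assume "A \<in> sets \<nu>"
      then have A [measurable]: "A \<in> sets B" by (simp add: K_D[OF \<nu>K])
      have "emeasure (mix a (\<rho>1 \<bind> component) (\<rho>2 \<bind> component)) A =
        (\<integral>\<^sup>+x. emeasure (component x) A * indicator D x \<partial>\<nu>) + (\<integral>\<^sup>+x. emeasure (component x) A * indicator E x \<partial>\<nu>)"
        using A K12 by (simp add: emeasure_mix K_D nu1 nu2)
      also have "\<dots> = (\<integral>\<^sup>+x. emeasure (component x) A * indicator D x + emeasure (component x) A * indicator E x \<partial>\<nu>)"
        by (rule nn_integral_add[symmetric]) measurable
      also have "\<dots> = (\<integral>\<^sup>+x. emeasure (component x) A \<partial>\<nu>)"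
        by (rule nn_integral_cong) (auto simp: E_def indicator_def K_D[OF \<nu>K])
      finally show "emeasure \<nu> A = emeasure (mix a (\<rho>1 \<bind> component) (\<rho>2 \<bind> component)) A"
        by (simp add: emeasure_barycenter[OF \<nu>K A])
    qed
    then have "\<rho>1 \<bind> component = \<nu>" using ext K12 a by (auto simp: extreme_measures_def)
    then have "ennreal a * emeasure \<nu> C = (\<integral>\<^sup>+x. emeasure (component x) C * indicator D x \<partial>\<nu>)"
      using nu1[OF Cm] by simp
    also have "\<dots> = (\<integral>\<^sup>+x. ennreal (indicator D x * mass C x) \<partial>\<nu>)"
      by (rule nn_integral_cong) (auto simp: emeasure_component indicator_def)
    also have "\<dots> = ennreal (\<integral>x. indicator D x * mass C x \<partial>\<nu>)"
      using int mass_bounds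
      by (intro nn_integral_eq_integral ind) auto
    finally have "ennreal (a * c) = ennreal (\<integral>x. indicator D x * mass C x \<partial>\<nu>)"
      using a by (simp add: emeasure_eq_measure c_def ennreal_mult)
    then have eq: "a * c = (\<integral>x. indicator D x * mass C x \<partial>\<nu>)"
      using a mass_bounds by (subst (asm) ennreal_inj) (auto simp: c_def intro!: Bochner_Integration.integral_nonneg)
    have "(\<integral>x. indicator D x * (mass C x - c) \<partial>\<nu>) = (\<integral>x. indicator D x * mass C x \<partial>\<nu>) - (\<integral>x. indicator D x * c \<partial>\<nu>)"
      unfolding right_diff_distrib using int
      by (intro Bochner_Integration.integral_diff ind) auto
    also have "(\<integral>x. indicator D x * c \<partial>\<nu>) = a * c"
      using D sets.sets_into_space[OF D] by (simp add: a_def K_D[OF \<nu>K] Int_absorb2)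
    finally show False using pos eq by simp
  qed
qed

end

section \<open>The simplex of invariant measures\<close>

context stone_system
begin

text \<open>By \<open>K_iff_clopens\<close>, \<open>K\<close> is cut out of the compact space of all
  probability measures by equations between continuous evaluations.\<close>

lemma K_compact: "compactin (weak_star X (prob_measures X)) K"
proof -
  let ?W = "weak_star X (prob_measures X)"
  let ?c1 = "\<lambda>C. {\<mu>\<in>topspace ?W. measure \<mu> {x\<in>topspace X. T x \<in> C} = measure \<mu> C}"
  let ?c2 = "\<lambda>C. {\<mu>\<in>topspace ?W. measure \<mu> C = 1}"
  have eval: "continuous_map ?W euclideanreal (\<lambda>\<mu>. measure \<mu> C)" if "C \<in> clopens X" for C
    by (rule continuous_map_eval[OF that order_refl])
  have "closedin ?W (?c1 C)" if "C \<in> clopens X" for C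
    by (rule closedin_continuous_maps_eq[where Y=euclideanreal])
      (auto intro: eval that clopens_vimage)
  moreover have "closedin ?W (?c2 C)" if "C \<in> clopens X" for C
    by (rule closedin_continuous_maps_eq[where Y=euclideanreal]) (auto intro: eval that)
  ultimately have "closedin ?W (\<Inter>(insert (topspace ?W) (?c1 ` clopens X \<union> ?c2 ` {C\<in>clopens X. Y \<subseteq> C})))"
    using closedin_topspace[of ?W] by (intro closedin_Inter) auto
  also have "\<Inter>(insert (topspace ?W) (?c1 ` clopens X \<union> ?c2 ` {C\<in>clopens X. Y \<subseteq> C})) = K"
    unfolding Inter_insert Inter_Un_distrib by (auto simp: K_iff_clopens)
  finally show ?thesis
    by (rule closedin_compact_space[OF compact_space_prob_measures])
qed

lemma K_convex: "convex_measures K"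
  unfolding convex_measures_def
proof (intro ballI allI impI, elim conjE)
  fix \<mu> \<nu> and t :: real assume \<mu>: "\<mu> \<in> K" and \<nu>: "\<nu> \<in> K" and t: "0 \<le> t" "t \<le> 1"
  have "mix t \<mu> \<nu> \<in> prob_measures X"
    using \<mu> \<nu> t by (intro prob_measuresI prob_space_mix) (auto simp: K_D)
  moreover have "measure (mix t \<mu> \<nu>) C = t * measure \<mu> C + (1 - t) * measure \<nu> C" if "C \<in> clopens X" for C
    using \<mu> \<nu> t that by (intro measure_mix) (auto simp: K_D clopens_sets)
  ultimately show "mix t \<mu> \<nu> \<in> K"
    using \<mu> \<nu> by (auto simp: K_iff_clopens clopens_vimage)
qed

abbreviation BK :: "'a measure measure" where "BK \<equiv> borel_of (weak_star X K)"

lemma sets_BK: "sets BK = sets (restrict_space (prob_algebra B) K)"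
  by (rule sets_borel_of_weak_star[OF K_prob])

lemma measurable_BK_incl: "(\<lambda>\<nu>. \<nu>) \<in> BK \<rightarrow>\<^sub>M prob_algebra B"
  unfolding measurable_cong_sets[OF sets_BK refl]
  by (intro measurable_restrict_space1 measurable_ident_sets) simp

lemma measurable_BK_emeasure: "A \<in> sets B \<Longrightarrow> (\<lambda>\<nu>. emeasure \<nu> A) \<in> borel_measurable BK"
  by (rule measurable_compose[OF measurable_prob_algebraD[OF measurable_BK_incl] measurable_emeasure_subprob_algebra])

lemma component_measurable_BK: "component \<in> B \<rightarrow>\<^sub>M BK"
  unfolding measurable_cong_sets[OF refl sets_BK]
  by (rule measurable_restrict_space2) (auto simp: component_in_K)

lemma Erg_sets: "Erg \<in> sets BK"
proof -
  have "{\<nu>\<in>space BK. second_moment C \<nu> = (measure \<nu> C)\<^sup>2} \<in> sets BK" if C: "C \<in> clopens X" for C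
  proof -
    have [measurable]: "C \<in> sets B" by (rule clopens_sets[OF C])
    have [measurable]: "second_moment C \<in> borel_measurable BK"
      by (rule measurable_compose[OF measurable_prob_algebraD[OF measurable_BK_incl] second_moment_measurable]) measurable
    have [measurable]: "(\<lambda>\<nu>. measure \<nu> C) \<in> borel_measurable BK"
      by (rule measurable_compose[OF measurable_prob_algebraD[OF measurable_BK_incl] measurable_measure_subprob_algebra]) measurable
    show ?thesis by measurable
  qed
  then have "{\<nu>\<in>space BK. \<forall>C\<in>clopens X. second_moment C \<nu> = (measure \<nu> C)\<^sup>2} \<in> sets BK"
    by (intro sets.sets_Collect_countable_All' countable_clopens)
  then show ?thesis by (simp add: Erg_def)
qed

text \<open>Uniqueness of the ergodic decomposition: an ergodic \<^term>\<open>\<nu>\<close> gives the fibre of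
  \<^term>\<open>component\<close> over \<^term>\<open>\<nu>\<close> full measure, so a decomposition is recovered from its
  barycenter as the image under \<^term>\<open>component\<close>.\<close>

lemma ergodic_decomposition:
  assumes \<mu>: "\<mu> \<in> K"
  shows "\<exists>!m. prob_space m \<and> space m = K \<and> sets m = sets BK \<and> Erg \<in> sets m \<and> emeasure m Erg = 1 \<and>
     (\<forall>A\<in>sets B. emeasure \<mu> A = (\<integral>\<^sup>+\<nu>. emeasure \<nu> A \<partial>m))" (is "\<exists>!m. ?P m")
proof (rule ex1I)
  interpret prob_space \<mu> by (rule K_D[OF \<mu>])
  have component [measurable]: "component \<in> \<mu> \<rightarrow>\<^sub>M BK"
    using component_measurable_BK by (simp add: measurable_cong_sets[OF K_D(3)[OF \<mu>] refl])
  let ?m = "distr \<mu> BK component"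
  have "emeasure ?m Erg = 1"
  proof -
    have "emeasure ?m Erg = emeasure \<mu> (component -` Erg \<inter> space \<mu>)"
      by (rule emeasure_distr[OF component Erg_sets])
    also have "component -` Erg \<inter> space \<mu> = {x\<in>space \<mu>. component x \<in> Erg}" by auto
    also have "emeasure \<mu> {x\<in>space \<mu>. component x \<in> Erg} = 1"
      using AE_component_Erg[OF \<mu>] measurable_sets[OF component Erg_sets]
      by (intro emeasure_eq_1_AE) (auto simp: vimage_def Int_def conj_commute)
    finally show ?thesis .
  qed
  moreover have "emeasure \<mu> A = (\<integral>\<^sup>+\<nu>. emeasure \<nu> A \<partial>?m)" if A: "A \<in> sets B" for A
    using measurable_BK_emeasure[OF A] emeasure_barycenter[OF \<mu> A]
    by (subst nn_integral_distr[OF component]) simp_all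
  ultimately show "?P ?m" using Erg_sets by (auto intro: prob_space_distr[OF component])
next
  fix m assume m: "?P m"
  interpret prob_space m using m by blast
  have component [measurable]: "component \<in> \<mu> \<rightarrow>\<^sub>M BK"
    using component_measurable_BK by (simp add: measurable_cong_sets[OF K_D(3)[OF \<mu>] refl])
  have AE_Erg: "AE \<nu> in m. \<nu> \<in> Erg"
    using m by (intro AE_prob_1) (simp add: measure_def)
  show "m = distr \<mu> BK component"
  proof (rule measure_eqI)
    show "sets m = sets (distr \<mu> BK component)" using m by simp
    fix D assume D: "D \<in> sets m"
    then have D': "D \<in> sets BK" using m by simp
    let ?D = "component -` D \<inter> space B"
    have De: "?D \<in> sets B" by (rule measurable_sets[OF component_measurable_BK D'])
    have "emeasure m D = (\<integral>\<^sup>+\<nu>. indicator D \<nu> \<partial>m)" using D by simp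
    \<comment> \<open>For ergodic \<open>\<nu>\<close> the preimage of \<open>D\<close> under
      \<open>component\<close> has mass one or zero according to whether \<open>\<nu>\<close> lies
      in \<open>D\<close>. So \<open>D\<close> is traded for a Borel set of points, to which the
      barycenter formula applies.\<close>
    also have "\<dots> = (\<integral>\<^sup>+\<nu>. emeasure \<nu> ?D \<partial>m)"
    proof (rule nn_integral_cong_AE, use AE_Erg in eventually_elim)
      fix \<nu> assume "\<nu> \<in> Erg"
      then have \<nu>: "\<nu> \<in> K" "AE y in \<nu>. component y = \<nu>" by (auto simp: Erg_iff)
      interpret \<nu>: prob_space \<nu> by (rule K_D[OF \<nu>(1)])
      have sp: "space \<nu> = space B" "sets \<nu> = sets B" using K_D[OF \<nu>(1)] by auto
      show "indicator D \<nu> = emeasure \<nu> ?D"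
      proof (cases "\<nu> \<in> D")
        case True
        have "AE y in \<nu>. y \<in> ?D" using \<nu>(2) AE_space by eventually_elim (use True sp in auto)
        then have "emeasure \<nu> ?D = 1" using De sp by (intro \<nu>.emeasure_eq_1_AE) auto
        with True show ?thesis by simp
      next
        case False
        have "AE y in \<nu>. y \<notin> ?D" using \<nu>(2) by eventually_elim (use False in auto)
        then have "emeasure \<nu> ?D = 0" using De sp by (subst AE_iff_measurable[symmetric, where P="\<lambda>y. y \<notin> ?D"]) auto
        with False show ?thesis by simp
      qed
    qed
    also have "\<dots> = emeasure \<mu> ?D" using m De by simp
    also have "\<dots> = emeasure (distr \<mu> BK component) D"
      using D' K_D(4)[OF \<mu>] by (subst emeasure_distr[OF component]) auto
    finally show "emeasure m D = emeasure (distr \<mu> BK component) D" .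
  qed
qed

lemma choquet_K: "choquet_simplex X K"
  unfolding choquet_simplex_def extreme_eq_Erg
  using K_prob return_y0 K_convex K_compact ergodic_decomposition by blast

section \<open>Periodic orbits and their uniform measures\<close>

lemma periodic_birkhoff_sum:
  assumes "(T ^^ P) x = x"
  shows "birkhoff_sum T f (q * P + r) x = q * birkhoff_sum T f P x + birkhoff_sum T f r x"
proof (induction q)
  case (Suc q)
  have "birkhoff_sum T f (P + (q * P + r)) x = birkhoff_sum T f P x + birkhoff_sum T f (q * P + r) x"
    using birkhoff_sum_add[of T f P "q * P + r" x] assms by simp
  with Suc show ?case by (simp add: algebra_simps)
qed simp

text \<open>With \<open>n = q * P + r\<close> the \<open>q\<close> full periods contribute their
  exact average, and the incomplete one changes the sum by at most \<open>P\<close>.\<close>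

lemma periodic_generic:
  assumes x: "x \<in> Y" "(T ^^ P) x = x" and "0 < P"
  shows "x \<in> generic" "C \<in> clopens X \<Longrightarrow> mass C x = avg C P x"
proof -
  have lim: "(\<lambda>n. avg C n x) \<longlonglongrightarrow> avg C P x" for C
  proof (rule LIM_zero_cancel, rule Lim_null_comparison)
    show "(\<lambda>n. real P * inverse (real n)) \<longlonglongrightarrow> 0"
      using tendsto_mult_right_zero[OF lim_inverse_n] .
    show "\<forall>\<^sub>F n in sequentially. norm (avg C n x - avg C P x) \<le> real P * inverse (real n)"
      unfolding eventually_sequentially
    proof (intro exI[of _ 1] allI impI)
      fix n :: nat assume n: "1 \<le> n"
      define q r where "q = n div P" and "r = n mod P"
      have nq: "n = q * P + r" and r: "r \<le> P" using \<open>0 < P\<close> by (auto simp: q_def r_def less_imp_le)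
      let ?S = "\<lambda>n. birkhoff_sum T (indicator C) n x"
      have SP: "?S P = P * avg C P x" "0 \<le> avg C P x" "avg C P x \<le> 1"
        using \<open>0 < P\<close> avg_bounds by (auto simp: avg_def)
      have "real n * (avg C n x - avg C P x) = ?S r - r * avg C P x"
        using n periodic_birkhoff_sum[OF x(2), of "indicator C" q r] SP(1)
        by (simp add: avg_def[of C n] nq[symmetric] right_diff_distrib) (simp add: nq algebra_simps)
      moreover have "0 \<le> ?S r" "?S r \<le> r" by (auto intro!: birkhoff_sum_bounds simp: indicator_def)
      moreover have "0 \<le> r * avg C P x" "r * avg C P x \<le> r" using SP by (auto intro: mult_left_le)
      ultimately have "\<bar>real n * (avg C n x - avg C P x)\<bar> \<le> P" using r by linarith
      then have "real n * \<bar>avg C n x - avg C P x\<bar> \<le> P" by (simp only: abs_mult abs_of_nat)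
      then show "norm (avg C n x - avg C P x) \<le> real P * inverse (real n)"
        using n by (simp add: divide_inverse[symmetric] pos_le_divide_eq mult.commute)
    qed
  qed
  then show g: "x \<in> generic" using x(1) by (auto simp: generic_def convergent_def)
  show "mass C x = avg C P x" if "C \<in> clopens X"
    unfolding mass_def using component_generic(2)[OF g that] lim by (rule LIMSEQ_unique)
qed

text \<open>The component is carried by the finite orbit, and all points of the orbit have the same
  average over a period, hence the same component. \<open>Erg_iff\<close> then applies.\<close>

lemma periodic_Erg:
  assumes x: "x \<in> Y" "(T ^^ P) x = x" and "0 < P"
  shows "component x \<in> Erg"
proof -
  have per: "(T ^^ P) ((T ^^ i) x) = (T ^^ i) x" for i
    by (metis x(2) add.commute comp_apply funpow_add)
  have orbit: "component ((T ^^ i) x) = component x" for i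
  proof (induction i)
    case (Suc i)
    let ?y = "(T ^^ i) x"
    have "mass C (T ?y) = mass C ?y" if C: "C \<in> clopens X" for C
    proof -
      have "mass C (T ?y) = avg C P (T ?y)" "mass C ?y = avg C P ?y"
        using periodic_generic(2)[OF _ _ \<open>0 < P\<close> C, of ?y] periodic_generic(2)[OF _ _ \<open>0 < P\<close> C, of "T ?y"]
          funpow_Y[OF x(1)] per[of i] per[of "Suc i"] funpow_Y[OF x(1), of "Suc i"] by auto
      then show ?thesis by (simp add: avg_def birkhoff_sum_shift per)
    qed
    then have "component (T ?y) = component ?y" by (simp add: component_eq_iff[OF component_in_K] mass_def)
    with Suc show ?case by simp
  qed simp
  let ?O = "(\<lambda>i. (T ^^ i) x) ` {..<P}"
  have "closedin X ?O"
    using funpow_Y[OF x(1)] Y_sub by (intro closedin_Hausdorff_finite[OF Hausdorff]) auto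
  moreover have "(T ^^ i) x \<in> ?O" for i
    using funpow_mod_eq[OF x(2), of i] \<open>0 < P\<close> by (intro image_eqI[of _ _ "i mod P"]) auto
  ultimately have "emeasure (component x) ?O = 1"
    using periodic_generic(1)[OF assms] by (intro component_closed_orbit)
  moreover interpret prob_space "component x" by (rule K_D[OF component_in_K])
  have "AE y in component x. y \<in> ?O" using calculation by (intro AE_prob_1) (simp add: measure_def)
  then have "AE y in component x. component y = component x" by eventually_elim (use orbit in auto)
  then show ?thesis by (simp add: Erg_iff component_in_K)
qed

end

section \<open>Density of the extreme points\<close>

text \<open>Integer weights become repetitions, so a weighted sum over representatives turns into a
  plain sum over sample points.\<close>

lemma weighted_list:
  assumes "finite S"
  shows "\<exists>xs. set xs \<subseteq> rep ` S \<and> length xs = (\<Sum>s\<in>S. c s) \<and>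
    (\<forall>h::'a \<Rightarrow> real. sum_list (map h xs) = (\<Sum>s\<in>S. real (c s) * h (rep s)))"
  using assms
proof (induction S rule: finite_induct)
  case (insert s S)
  then obtain xs where "set xs \<subseteq> rep ` S" "length xs = (\<Sum>s\<in>S. c s)"
    "\<forall>h::'a \<Rightarrow> real. sum_list (map h xs) = (\<Sum>s\<in>S. real (c s) * h (rep s))" by blast
  with insert show ?case
    by (intro exI[of _ "replicate (c s) (rep s) @ xs"]) (auto simp: sum_list_replicate)
qed simp

text \<open>The functions take finitely many values, so they cut \<open>Y\<close> into finitely many
  pieces on which all of them are constant. Taking a point of each piece about \<open>N\<close>
  times its probability reproduces the integrals. Cutting up \<open>Y\<close>, of full measure,
  keeps the sample inside \<open>Y\<close>.\<close>

lemma (in prob_space) empirical_approximation: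
  fixes f :: "'i \<Rightarrow> 'a \<Rightarrow> real"
  assumes "finite F" and f_meas: "\<And>i. i \<in> F \<Longrightarrow> f i \<in> borel_measurable M"
    and fin: "\<And>i. i \<in> F \<Longrightarrow> finite (f i ` space M)"
    and f: "\<And>i x. i \<in> F \<Longrightarrow> 0 \<le> f i x" "\<And>i x. i \<in> F \<Longrightarrow> f i x \<le> 1"
    and Y: "Y \<in> events" "prob Y = 1" and "0 < \<epsilon>"
  shows "\<exists>L>0. \<exists>xs. (\<forall>k<L. xs k \<in> Y) \<and> (\<forall>i\<in>F. \<bar>(\<Sum>k<L. f i (xs k)) / real L - (\<integral>x. f i x \<partial>M)\<bar> < \<epsilon>)"
proof -
  \<comment> \<open>\<open>restrict\<close> makes the vector of values an element of a product of
    finite sets, so only finitely many vectors occur.\<close>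
  define g where "g x = restrict (\<lambda>i. f i x) F" for x
  define S where "S = g ` Y"
  have YM: "Y \<subseteq> space M" using Y(1) by (rule sets.sets_into_space)
  have "S \<subseteq> PiE F (\<lambda>i. f i ` space M)" using YM by (auto simp: S_def g_def)
  then have finS: "finite S" by (rule finite_subset) (intro finite_PiE assms fin)
  define A where "A s = {x\<in>Y. g x = s}" for s
  have A: "A s \<in> events" if "s \<in> S" for s
  proof -
    have "s \<in> extensional F" using that by (auto simp: S_def g_def)
    then have "A s = Y \<inter> {x\<in>space M. \<forall>i\<in>F. f i x = s i}"
      using YM unfolding A_def g_def by (auto simp: fun_eq_iff extensional_def restrict_def)
    also have "\<dots> \<in> events"
      using f_meas by (intro sets.Int Y(1) sets.sets_Collect_countable_All' countable_finite \<open>finite F\<close>)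
        (auto intro: borel_measurable_eq)
    finally show ?thesis .
  qed
  define q where "q s = prob (A s)" for s
  have disj: "disjoint_family_on A S" by (auto simp: disjoint_family_on_def A_def)
  have "(\<Sum>s\<in>S. q s) = prob (\<Union>s\<in>S. A s)"
    unfolding q_def using A by (intro finite_measure_finite_Union[symmetric] finS disj) auto
  also have "(\<Union>s\<in>S. A s) = Y" by (auto simp: S_def A_def)
  finally have sumq: "(\<Sum>s\<in>S. q s) = 1" using Y by simp
  have q0: "0 \<le> q s" for s by (simp add: q_def)
  have val: "0 \<le> s i" "s i \<le> 1" if "s \<in> S" "i \<in> F" for s i
    using that f by (auto simp: S_def g_def)
  have int: "(\<integral>x. f i x \<partial>M) = (\<Sum>s\<in>S. q s * s i)" if i: "i \<in> F" for i
  proof -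
    have "(\<integral>x. f i x \<partial>M) = (\<integral>x. (\<Sum>s\<in>S. s i * indicator (A s) x) \<partial>M)"
    proof (rule integral_cong_AE)
      show "f i \<in> borel_measurable M" by (rule f_meas[OF i])
      show "(\<lambda>x. \<Sum>s\<in>S. s i * indicator (A s) x) \<in> borel_measurable M"
        using A by (intro borel_measurable_sum borel_measurable_times) auto
      have "f i x = (\<Sum>s\<in>S. s i * indicator (A s) x)" if "x \<in> Y" for x
      proof -
        have "(\<Sum>s\<in>S. s i * indicator (A s) x) = (\<Sum>s\<in>{g x}. s i * indicator (A s) x)"
          using that finS by (intro sum.mono_neutral_right) (auto simp: S_def A_def)
        then show ?thesis using that i by (simp add: A_def g_def)
      qed
      moreover have "AE x in M. x \<in> Y" using Y(2) by (rule AE_prob_1)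
      ultimately show "AE x in M. f i x = (\<Sum>s\<in>S. s i * indicator (A s) x)" by (auto elim!: AE_mp)
    qed
    also have "\<dots> = (\<Sum>s\<in>S. (\<integral>x. s i * indicator (A s) x \<partial>M))"
      using A by (intro Bochner_Integration.integral_sum integrable_mult_right) (auto simp: emeasure_eq_measure)
    also have "\<dots> = (\<Sum>s\<in>S. q s * s i)"
      using A sets.sets_into_space by (intro sum.cong refl) (simp add: q_def Int_absorb2 mult.commute)
    finally show ?thesis .
  qed
  have "\<forall>s. \<exists>x. s \<in> S \<longrightarrow> x \<in> A s" by (auto simp: S_def A_def)
  then obtain rep where rep: "\<And>s. s \<in> S \<Longrightarrow> rep s \<in> A s" by metis
  \<comment> \<open>Rounding down loses at most one sample per piece: the sample size lies between
    \<open>N - card S\<close> and \<open>N\<close>, and the sums are off by at most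
    \<open>2 * card S\<close>. This \<open>N\<close> makes the sample large enough to bring the
    error of the mean below \<open>\<epsilon>\<close>.\<close>
  obtain N :: nat where N: "2 * real (card S) / \<epsilon> + real (card S) < real N"
    using reals_Archimedean2 by blast
  define c where "c s = nat \<lfloor>real N * q s\<rfloor>" for s
  have c: "real (c s) \<le> N * q s" "N * q s - 1 \<le> real (c s)" for s
    using q0[of s] by (auto simp: c_def)
  obtain xs where xs: "set xs \<subseteq> rep ` S" "length xs = (\<Sum>s\<in>S. c s)"
    "\<forall>h::'a \<Rightarrow> real. sum_list (map h xs) = (\<Sum>s\<in>S. real (c s) * h (rep s))"
    using weighted_list[OF finS, of rep c] by (elim exE conjE)
  define L where "L = length xs"
  have L: "real N - card S \<le> L" "real L \<le> N"
  proof -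
    have "real N - card S = (\<Sum>s\<in>S. N * q s - 1)"
      by (simp add: sum_subtractf sum_distrib_left[symmetric] sumq)
    also have "\<dots> \<le> (\<Sum>s\<in>S. real (c s))" by (intro sum_mono c)
    finally show "real N - card S \<le> L" by (simp add: L_def xs)
    have "(\<Sum>s\<in>S. real (c s)) \<le> (\<Sum>s\<in>S. N * q s)" by (intro sum_mono c)
    then show "real L \<le> N" by (simp add: L_def xs sum_distrib_left[symmetric] sumq)
  qed
  have L2: "2 * real (card S) / \<epsilon> < real L" using N L by linarith
  have "0 \<le> 2 * real (card S) / \<epsilon>" using \<open>0 < \<epsilon>\<close> by simp
  with L2 have Lpos: "0 < L" by linarith
  have "\<bar>(\<Sum>k<L. f i (xs ! k)) / real L - (\<integral>x. f i x \<partial>M)\<bar> < \<epsilon>" if i: "i \<in> F" for i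
  proof -
    define I where "I = (\<integral>x. f i x \<partial>M)"
    have I: "0 \<le> I" "I \<le> 1"
      using q0 val sumq unfolding I_def int[OF i]
      by (auto intro!: sum_nonneg mult_nonneg_nonneg i)
        (metis (no_types, lifting) mult_left_le sum_mono i)
    have rv: "f i (rep s) = s i" if "s \<in> S" for s
    proof -
      have "g (rep s) i = s i" using rep[OF that] by (simp add: A_def)
      then show ?thesis using i by (simp add: g_def)
    qed
    have S1: "(\<Sum>k<L. f i (xs ! k)) = (\<Sum>s\<in>S. real (c s) * s i)"
      using xs(3)[rule_format, of "f i"] rv by (simp add: sum_list_sum_nth L_def atLeast0LessThan)
    have "real N * I - card S \<le> (\<Sum>s\<in>S. real (c s) * s i)"
    proof -
      have "real N * I - card S = (\<Sum>s\<in>S. N * q s * s i - 1)"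
        by (simp add: sum_subtractf I_def int[OF i] sum_distrib_left mult.assoc)
      also have "\<dots> \<le> (\<Sum>s\<in>S. real (c s) * s i)"
      proof (rule sum_mono)
        fix s assume s: "s \<in> S"
        have "N * q s * s i - 1 \<le> N * q s * s i - s i" using val[OF s i] by simp
        also have "\<dots> = (N * q s - 1) * s i" by (simp add: algebra_simps)
        also have "\<dots> \<le> real (c s) * s i" using c val[OF s i] by (intro mult_right_mono)
        finally show "N * q s * s i - 1 \<le> real (c s) * s i" .
      qed
      finally show ?thesis .
    qed
    moreover have "(\<Sum>s\<in>S. real (c s) * s i) \<le> real N * I"
    proof -
      have "(\<Sum>s\<in>S. real (c s) * s i) \<le> (\<Sum>s\<in>S. N * q s * s i)"
        using c val i by (intro sum_mono mult_right_mono) auto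
      then show ?thesis by (simp add: I_def int[OF i] sum_distrib_left mult.assoc)
    qed
    moreover have "L * I \<le> N * I" "N * I - card S \<le> L * I"
    proof -
      show "L * I \<le> N * I" using L I by (intro mult_right_mono) auto
      have "(real N - card S) * I \<le> L * I" using L I by (intro mult_right_mono)
      moreover have "card S * I \<le> card S" using I by (intro mult_left_le) auto
      ultimately show "N * I - card S \<le> L * I" by (simp add: left_diff_distrib)
    qed
    ultimately have "\<bar>(\<Sum>k<L. f i (xs ! k)) - L * I\<bar> \<le> 2 * card S"
      unfolding S1 by linarith
    moreover have "(\<Sum>k<L. f i (xs ! k)) / L - I = ((\<Sum>k<L. f i (xs ! k)) - L * I) / L"
      using Lpos by (simp add: diff_divide_distrib)
    ultimately have "\<bar>(\<Sum>k<L. f i (xs ! k)) / L - I\<bar> \<le> 2 * card S / L"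
      using Lpos by (simp add: divide_right_mono)
    also have "\<dots> < \<epsilon>" using L2 Lpos \<open>0 < \<epsilon>\<close> by (simp add: field_simps)
    finally show ?thesis by (simp add: I_def)
  qed
  moreover have "xs ! k \<in> Y" if "k < L" for k
  proof -
    have "xs ! k \<in> rep ` S" using that xs(1) by (auto simp: L_def)
    then show ?thesis using rep by (auto simp: A_def)
  qed
  ultimately show ?thesis using Lpos by blast
qed

text \<open>A form of the specification property: prescribed orbit segments are followed one after
  the other by a periodic point. The margin \<open>r\<close> depends only on the clopen sets and is
  fixed before \<open>M\<close>, \<open>L\<close> and the segments; a block loses at most
  \<open>2 * r\<close> of its \<open>M\<close> times.\<close>

locale gluing_system = stone_system +
  assumes gluing: "\<And>F. finite F \<Longrightarrow> F \<subseteq> clopens X \<Longrightarrow>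
    \<exists>r. \<forall>M L xs. 0 < M \<longrightarrow> 0 < L \<longrightarrow> (\<forall>k<L. xs k \<in> Y) \<longrightarrow>
      (\<exists>x\<in>Y. (T ^^ (M * L)) x = x \<and>
        (\<forall>C\<in>F. \<forall>k<L. \<forall>j. r \<le> j \<longrightarrow> j + r < M \<longrightarrow>
          ((T ^^ (k * M + j)) x \<in> C \<longleftrightarrow> (T ^^ j) (xs k) \<in> C)))"
begin

lemma birkhoff_sum_blocks:
  "birkhoff_sum T f (M * L) x = (\<Sum>k<L. birkhoff_sum T f M ((T ^^ (k * M)) x))"
  by (induction L) (simp_all add: birkhoff_sum_def[of T f 0] birkhoff_sum_add add.commute[of M] mult.commute)

lemma birkhoff_sum_close:
  assumes "\<And>j. r \<le> j \<Longrightarrow> j + r < M \<Longrightarrow> (T ^^ j) x \<in> C \<longleftrightarrow> (T ^^ j) y \<in> C"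
  shows "\<bar>birkhoff_sum T (indicator C) M x - birkhoff_sum T (indicator C) M y\<bar> \<le> 2 * real r"
proof -
  let ?d = "\<lambda>j. indicator C ((T ^^ j) x) - indicator C ((T ^^ j) y) :: real"
  \<comment> \<open>The indices where agreement is not assumed: at most \<open>r\<close> near each
    end of the block.\<close>
  let ?J = "{j. j < M \<and> (j < r \<or> M \<le> j + r)}"
  have "\<bar>birkhoff_sum T (indicator C) M x - birkhoff_sum T (indicator C) M y\<bar> = \<bar>\<Sum>j<M. ?d j\<bar>"
    by (simp add: birkhoff_sum_def sum_subtractf)
  also have "\<dots> \<le> (\<Sum>j<M. \<bar>?d j\<bar>)" by (rule sum_abs)
  also have "\<dots> = (\<Sum>j\<in>?J. \<bar>?d j\<bar>)"
  proof (intro sum.mono_neutral_right ballI)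
    fix i assume "i \<in> {..<M} - ?J"
    then have "r \<le> i" "i + r < M" by auto
    from assms[OF this] show "\<bar>?d i\<bar> = 0" by (simp add: indicator_def)
  qed auto
  also have "\<dots> \<le> (\<Sum>j\<in>?J. 1)" by (intro sum_mono) (auto simp: indicator_def)
  also have "\<dots> = real (card ?J)" by simp
  also have "card ?J \<le> card ({..<r} \<union> {M - r..<M})" by (intro card_mono) auto
  also have "\<dots> \<le> card {..<r} + card {M - r..<M}" by (rule card_Un_le)
  also have "\<dots> \<le> 2 * r" by simp
  finally show ?thesis by simp
qed

text \<open>The sampled functions are the block averages \<open>avg C M\<close>, whose integral is
  the mass of \<open>C\<close>. The sample points are the segments to be followed, and the orbit
  average of the resulting periodic point is the sample mean up to the losses at block ends.\<close>

lemma extreme_dense: "weak_star X K closure_of extreme_measures K = K"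
proof
  show "weak_star X K closure_of extreme_measures K \<subseteq> K"
    using closure_of_subset_topspace[of "weak_star X K"] by simp
  show "K \<subseteq> weak_star X K closure_of extreme_measures K"
  proof
    fix \<mu> assume \<mu>: "\<mu> \<in> K"
    interpret prob_space \<mu> by (rule K_D[OF \<mu>])
    note [measurable_cong] = K_D(3)[OF \<mu>]
    have "\<exists>\<nu>\<in>Erg. \<nu> \<in> U" if U: "\<mu> \<in> U" "openin (weak_star X K) U" for U
    proof -
      obtain F d where F: "finite F" "F \<subseteq> clopens X" "0 < d"
        "{\<nu>\<in>K. \<forall>C\<in>F. \<bar>measure \<nu> C - measure \<mu> C\<bar> < d} \<subseteq> U"
        using weak_star_nbhd[OF U(2,1) K_prob] by blast
      obtain r :: nat where r: "\<And>M L xs. 0 < M \<Longrightarrow> 0 < L \<Longrightarrow> (\<forall>k<L. xs k \<in> Y) \<Longrightarrow>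
        (\<exists>x\<in>Y. (T ^^ (M * L)) x = x \<and>
        (\<forall>C\<in>F. \<forall>k<L. \<forall>j. r \<le> j \<longrightarrow> j + r < M \<longrightarrow>
          ((T ^^ (k * M + j)) x \<in> C \<longleftrightarrow> (T ^^ j) (xs k) \<in> C)))"
        using gluing[OF F(1,2)] by blast
      \<comment> \<open>This length makes the loss at the block ends, at most
        \<open>2 * r / M\<close> after averaging, smaller than \<open>d/2\<close>; sampling gets the
        other half.\<close>
      obtain M :: nat where M: "4 * real r / d < real M" using reals_Archimedean2 by blast
      have "0 \<le> 4 * real r / d" using F(3) by simp
      with M have Mpos: "0 < M" by linarith
      have "\<exists>L>0. \<exists>xs. (\<forall>k<L. xs k \<in> Y) \<and>
        (\<forall>C\<in>F. \<bar>(\<Sum>k<L. avg C M (xs k)) / real L - (\<integral>x. avg C M x \<partial>\<mu>)\<bar> < d/2)"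
      proof (rule empirical_approximation)
        fix C assume C: "C \<in> F"
        show "avg C M \<in> borel_measurable \<mu>"
          using C F(2) clopens_sets by (auto simp: measurable_cong_sets[OF K_D(3)[OF \<mu>] refl] intro!: avg_measurable)
        \<comment> \<open>A block average is a multiple of \<open>1 / M\<close> between 0 and 1, so
          it takes finitely many values, as \<open>empirical_approximation\<close> requires.\<close>
        have "avg C M ` space \<mu> \<subseteq> (\<lambda>k. real k / real M) ` {..M}"
        proof
          fix v assume "v \<in> avg C M ` space \<mu>"
          then obtain x where v: "v = avg C M x" by blast
          have "birkhoff_sum T (indicator C) M x = real (card {i\<in>{..<M}. (T ^^ i) x \<in> C})"
            by (simp add: birkhoff_sum_def indicator_def of_bool_def[symmetric] Int_def conj_commute)
          moreover have "card {i\<in>{..<M}. (T ^^ i) x \<in> C} \<le> card {..<M}" by (intro card_mono) auto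
          ultimately show "v \<in> (\<lambda>k. real k / real M) ` {..M}" by (auto simp: v avg_def)
        qed
        then show "finite (avg C M ` space \<mu>)" by (rule finite_subset) simp
      next
        show "Y \<in> events" by (simp add: K_D(3)[OF \<mu>])
        show "prob Y = 1" using \<mu> by (simp add: K_def measure_def)
      qed (use F avg_bounds in auto)
      then obtain L xs where L: "0 < L" "\<forall>k<L. xs k \<in> Y"
        "\<And>C. C \<in> F \<Longrightarrow> \<bar>(\<Sum>k<L. avg C M (xs k)) / real L - (\<integral>x. avg C M x \<partial>\<mu>)\<bar> < d/2" by blast
      obtain x where x: "x \<in> Y" "(T ^^ (M * L)) x = x"
        "\<And>C k j. C \<in> F \<Longrightarrow> k < L \<Longrightarrow> r \<le> j \<Longrightarrow> j + r < M \<Longrightarrow>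
          ((T ^^ (k * M + j)) x \<in> C \<longleftrightarrow> (T ^^ j) (xs k) \<in> C)"
        using r[OF Mpos L(1,2)] by blast
      have P: "0 < M * L" using Mpos L(1) by simp
      have "\<bar>measure (component x) C - measure \<mu> C\<bar> < d" if C: "C \<in> F" for C
      proof -
        have CX: "C \<in> clopens X" using C F(2) by auto
        let ?S = "\<lambda>x. birkhoff_sum T (indicator C) M x"
        have "measure (component x) C = avg C (M * L) x"
          using periodic_generic(2)[OF x(1,2) P CX] by (simp add: mass_def)
        also have "\<dots> = (\<Sum>k<L. ?S ((T ^^ (k * M)) x)) / (real M * real L)"
          by (simp add: avg_def birkhoff_sum_blocks)
        finally have ex: "measure (component x) C = (\<Sum>k<L. ?S ((T ^^ (k * M)) x)) / (real M * real L)" .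
        have "\<bar>(\<Sum>k<L. ?S ((T ^^ (k * M)) x)) - (\<Sum>k<L. ?S (xs k))\<bar>
          \<le> (\<Sum>k<L. \<bar>?S ((T ^^ (k * M)) x) - ?S (xs k)\<bar>)"
          unfolding sum_subtractf[symmetric] by (rule sum_abs)
        also have "\<dots> \<le> (\<Sum>k<L. 2 * real r)"
          using x(3)[OF C]
          by (intro sum_mono birkhoff_sum_close) (simp add: funpow_add[symmetric, THEN fun_cong, simplified] add.commute)
        finally have "\<bar>(\<Sum>k<L. ?S ((T ^^ (k * M)) x)) - (\<Sum>k<L. ?S (xs k))\<bar> \<le> real L * (2 * real r)" by simp
        then have "\<bar>((\<Sum>k<L. ?S ((T ^^ (k * M)) x)) - (\<Sum>k<L. ?S (xs k))) / (real M * real L)\<bar>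
          \<le> real L * (2 * real r) / (real M * real L)"
          unfolding abs_divide abs_mult abs_of_nat by (rule divide_right_mono) simp
        also have "\<dots> = 2 * real r / real M" using L(1) by simp
        also have "\<dots> < d/2" using M Mpos F(3) by (simp add: field_simps)
        finally have 1: "\<bar>measure (component x) C - (\<Sum>k<L. ?S (xs k)) / (real M * real L)\<bar> < d/2"
          by (simp add: ex diff_divide_distrib)
        have "(\<Sum>k<L. avg C M (xs k)) / real L = (\<Sum>k<L. ?S (xs k)) / (real M * real L)"
          by (simp add: avg_def sum_divide_distrib[symmetric])
        then have 2: "\<bar>(\<Sum>k<L. ?S (xs k)) / (real M * real L) - measure \<mu> C\<bar> < d/2"
          using L(3)[OF C] integral_avg[OF \<mu> CX, of M] Mpos by simp
        have "\<bar>u - w\<bar> < d" if "\<bar>u - v\<bar> < d/2" "\<bar>v - w\<bar> < d/2" for u v w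
          using that by linarith
        from this[OF 1 2] show ?thesis .
      qed
      then have "component x \<in> U" using F(4) component_in_K by auto
      moreover have "component x \<in> Erg" by (rule periodic_Erg[OF x(1,2) P])
      ultimately show ?thesis by blast
    qed
    then show "\<mu> \<in> weak_star X K closure_of extreme_measures K"
      using \<mu> by (auto simp: in_closure_of extreme_eq_Erg)
  qed
qed

theorem poulsen_K: "poulsen_simplex X K"
  by (simp add: poulsen_simplex_def choquet_K extreme_dense)

end

section \<open>The space of subgroups of a countable group\<close>

text \<open>A Baire argument inside \<open>Q\<close>: the points of \<open>Q - P\<close> are
  countably many closed sets with empty interior in \<open>Q\<close>, as \<open>Q\<close> has no
  isolated points, whereas \<open>Q - P\<close> is open in \<open>Q\<close>. By symmetry two
  candidates for the perfect kernel coincide, so the definite description is justified.\<close>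

lemma perfect_subset_perfect:
  assumes "compact_space X" "Hausdorff_space X"
    and P: "closedin X P" "countable (topspace X - P)"
    and Q: "closedin X Q" "X derived_set_of Q = Q"
  shows "Q \<subseteq> P"
proof (rule ccontr)
  assume "\<not> Q \<subseteq> P"
  let ?Q = "subtopology X Q"
  have Qsub: "Q \<subseteq> topspace X" using Q(1) by (rule closedin_subset)
  have comp: "compact_space ?Q"
    using assms(1) Q(1) by (simp add: closedin_compact_space compact_space_subtopology)
  have haus: "Hausdorff_space ?Q" by (rule Hausdorff_space_subtopology[OF assms(2)])
  have top: "topspace ?Q = Q" using Qsub by auto
  let ?G = "(\<lambda>z. {z}) ` (Q - P)"
  have "?Q interior_of \<Union>?G = {}"
  proof (rule Baire_category_alt)
    show "completely_metrizable_space ?Q \<or> locally_compact_space ?Q \<and> regular_space ?Q"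
      using comp haus compact_imp_locally_compact_space compact_Hausdorff_imp_regular_space by blast
    have "countable (Q - P)"
      by (rule countable_subset[OF _ P(2)]) (use Qsub in auto)
    then show "countable ?G" by simp
  next
    fix T assume "T \<in> ?G"
    then obtain z where z: "z \<in> Q" "T = {z}" by auto
    have "closedin ?Q {z}" using z top by (intro closedin_Hausdorff_singleton[OF haus]) auto
    moreover have "?Q interior_of {z} = {}"
    proof (rule ccontr)
      assume "?Q interior_of {z} \<noteq> {}"
      then have "?Q interior_of {z} = {z}" using interior_of_subset[of ?Q "{z}"] by auto
      then have "openin ?Q {z}" by (metis openin_interior_of)
      then obtain U where U: "openin X U" "{z} = U \<inter> Q" by (auto simp: openin_subtopology)
      have "z \<in> X derived_set_of Q" using z Q(2) by simp
      then obtain y where "y \<noteq> z" "y \<in> Q" "y \<in> U"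
        using U by (auto simp: in_derived_set_of)
      with U show False by auto
    qed
    ultimately show "closedin ?Q T \<and> ?Q interior_of T = {}" using z by simp
  qed
  moreover have "\<Union>?G = Q - P" by auto
  moreover have "openin ?Q (Q - P)"
    unfolding openin_subtopology using P(1) Qsub
    by (intro exI[of _ "topspace X - P"]) (auto simp: closedin_def)
  ultimately show False using \<open>\<not> Q \<subseteq> P\<close> by (simp add: interior_of_openin)
qed

lemma perfect_kernel_eqI:
  assumes "compact_space X" "Hausdorff_space X"
    and P: "closedin X P" "X derived_set_of P = P" "countable (topspace X - P)"
  shows "perfect_kernel X = P"
  unfolding perfect_kernel_def
proof (rule the_equality)
  fix Q assume "closedin X Q \<and> X derived_set_of Q = Q \<and> countable (topspace X - Q)"
  then show "Q = P"
    using perfect_subset_perfect[OF assms(1,2)] P by blast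
qed (use P in blast)

section \<open>Compactness and finite windows in the space of subgroups\<close>

locale countable_group = group G for G (structure) +
  assumes countable_carrier: "countable (carrier G)"
begin

definition cylinder :: "'a set \<Rightarrow> 'a set \<Rightarrow> 'a set set" where
  "cylinder W H = {K\<in>Sub G. K \<inter> W = H \<inter> W}"

abbreviation subbasis :: "'a set set set" where
  "subbasis \<equiv> {{H. x \<in> H} | x. x \<in> carrier G} \<union> {{H. x \<notin> H} | x. x \<in> carrier G}"

lemma Union_subbasis: "\<Union>subbasis = UNIV"
proof (rule sym, rule UNIV_eq_I)
  fix H :: "'a set"
  have "H \<in> {H. \<one> \<in> H} \<or> H \<in> {H. \<one> \<notin> H}" by auto
  moreover have "{H. \<one> \<in> H} \<in> subbasis" "{H. \<one> \<notin> H} \<in> subbasis" using one_closed by blast+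
  ultimately show "H \<in> \<Union>subbasis" by (meson UnionI)
qed

lemma topspace_Sub_top [simp]: "topspace (Sub_top G) = Sub G"
  unfolding Sub_top_def topspace_subtopology topology_generated_by_topspace Union_subbasis by simp

lemma openin_mem: "x \<in> carrier G \<Longrightarrow> openin (Sub_top G) {H\<in>Sub G. x \<in> H}"
  and openin_not_mem: "x \<in> carrier G \<Longrightarrow> openin (Sub_top G) {H\<in>Sub G. x \<notin> H}"
proof -
  assume x: "x \<in> carrier G"
  have "openin (topology_generated_by subbasis) {H. x \<in> H}" "openin (topology_generated_by subbasis) {H. x \<notin> H}"
    using x by (auto intro!: topology_generated_by_Basis)
  then show "openin (Sub_top G) {H\<in>Sub G. x \<in> H}" "openin (Sub_top G) {H\<in>Sub G. x \<notin> H}"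
    unfolding Sub_top_def openin_subtopology by blast+
qed

lemma clopen_mem: "x \<in> carrier G \<Longrightarrow> {H\<in>Sub G. x \<in> H} \<in> clopens (Sub_top G)"
  and clopen_not_mem: "x \<in> carrier G \<Longrightarrow> {H\<in>Sub G. x \<notin> H} \<in> clopens (Sub_top G)"
proof -
  assume x: "x \<in> carrier G"
  have "Sub G - {H\<in>Sub G. x \<in> H} = {H\<in>Sub G. x \<notin> H}" "Sub G - {H\<in>Sub G. x \<notin> H} = {H\<in>Sub G. x \<in> H}"
    by auto
  then show "{H\<in>Sub G. x \<in> H} \<in> clopens (Sub_top G)" "{H\<in>Sub G. x \<notin> H} \<in> clopens (Sub_top G)"
    using openin_mem[OF x] openin_not_mem[OF x] by (auto simp: clopens_def closedin_def)
qed

lemma cylinder_clopen: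
  assumes "finite W" "W \<subseteq> carrier G"
  shows "cylinder W H \<in> clopens (Sub_top G)"
  using assms
proof (induction W rule: finite_induct)
  case empty
  have "cylinder {} H = topspace (Sub_top G)" by (auto simp: cylinder_def)
  then show ?case unfolding clopens_def by (metis (mono_tags) closedin_topspace mem_Collect_eq openin_topspace)
next
  case (insert x W)
  have "cylinder (insert x W) H =
    cylinder W H \<inter> (if x \<in> H then {K\<in>Sub G. x \<in> K} else {K\<in>Sub G. x \<notin> K})"
    using insert(2) by (auto simp: cylinder_def)
  moreover have "(if x \<in> H then {K\<in>Sub G. x \<in> K} else {K\<in>Sub G. x \<notin> K}) \<in> clopens (Sub_top G)"
    using insert clopen_mem clopen_not_mem by auto
  ultimately show ?case using insert by (auto simp: clopens_def)
qed

lemma cylinder_nbhd: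
  assumes "openin (Sub_top G) U" "H \<in> U"
  obtains W where "finite W" "W \<subseteq> carrier G" "cylinder W H \<subseteq> U"
proof -
  obtain V where V: "generate_topology_on subbasis V" "U = V \<inter> Sub G"
    using assms(1) by (auto simp: Sub_top_def openin_subtopology openin_topology_generated_by_iff)
  have "\<exists>W. finite W \<and> W \<subseteq> carrier G \<and> cylinder W H \<subseteq> V" if "H \<in> V"
    using V(1) that
  proof (induction V rule: generate_topology_on.induct)
    case (Int a b)
    then obtain W W' where "finite W" "W \<subseteq> carrier G" "cylinder W H \<subseteq> a"
      "finite W'" "W' \<subseteq> carrier G" "cylinder W' H \<subseteq> b" by auto
    moreover have "cylinder (W \<union> W') H \<subseteq> cylinder W H \<inter> cylinder W' H"
      by (auto simp: cylinder_def)
    ultimately show ?case by (intro exI[of _ "W \<union> W'"]) blast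
  next
    case (UN K)
    then show ?case by (meson UnionE Union_upper order_trans)
  next
    case (Basis s)
    then obtain x where x: "x \<in> carrier G" "s = {H. x \<in> H} \<or> s = {H. x \<notin> H}" by auto
    with Basis show ?case by (intro exI[of _ "{x}"]) (auto simp: cylinder_def)
  qed auto
  then show ?thesis using assms V that by (auto simp: cylinder_def)
qed

text \<open>Each subgroup axiom constrains at most three coordinates of a characteristic function,
  so the subgroups form a closed subset of a compact product. The map \<open>h\<close> carries
  compactness over to the topology given by the subbasis.\<close>

lemma compact_Sub_top: "compact_space (Sub_top G)"
proof -
  let ?P = "product_topology (\<lambda>_. discrete_topology (UNIV :: bool set)) (carrier G)"
  define h where "h f = {x\<in>carrier G. f x}" for f :: "'a \<Rightarrow> bool"
  define Z where "Z = {f\<in>topspace ?P. h f \<in> Sub G}"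
  have proj: "continuous_map ?P (discrete_topology UNIV) (\<lambda>f. f x)" if "x \<in> carrier G" for x
    using continuous_map_product_projection[OF that, of "\<lambda>_. discrete_topology (UNIV :: bool set)"] .
  have cl: "closedin ?P {f\<in>topspace ?P. f x \<in> S}" if "x \<in> carrier G" for x S
    by (rule closedin_continuous_map_preimage[OF proj[OF that]]) simp
  have op: "openin ?P {f\<in>topspace ?P. f x \<in> S}" if "x \<in> carrier G" for x S
    by (rule openin_continuous_map_preimage[OF proj[OF that]]) simp
  let ?I = "\<lambda>x. {f\<in>topspace ?P. f x \<in> {False}} \<union> {f\<in>topspace ?P. f (inv x) \<in> {True}}"
  let ?M = "\<lambda>p. {f\<in>topspace ?P. f (fst p) \<in> {False}} \<union> {f\<in>topspace ?P. f (snd p) \<in> {False}}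
    \<union> {f\<in>topspace ?P. f (fst p \<otimes> snd p) \<in> {True}}"
  have "Z = \<Inter>(insert {f\<in>topspace ?P. f \<one> \<in> {True}} (?I ` carrier G \<union> ?M ` (carrier G \<times> carrier G)))"
  proof (intro equalityI subsetI)
    fix f assume "f \<in> Z"
    then have f: "f \<in> topspace ?P" "subgroup (h f) G" by (auto simp: Z_def Sub_def)
    have "f (inv x)" if "x \<in> carrier G" "f x" for x
      using subgroup.m_inv_closed[OF f(2), of x] that by (simp add: h_def)
    moreover have "f (x \<otimes> y)" if "x \<in> carrier G" "f x" "y \<in> carrier G" "f y" for x y
      using subgroup.m_closed[OF f(2), of x y] that by (simp add: h_def)
    moreover have "f \<one>" using subgroup.one_closed[OF f(2)] by (simp add: h_def)
    ultimately show "f \<in> \<Inter>(insert {f\<in>topspace ?P. f \<one> \<in> {True}} (?I ` carrier G \<union> ?M ` (carrier G \<times> carrier G)))"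
      using f(1) by auto
  next
    fix f assume f: "f \<in> \<Inter>(insert {f\<in>topspace ?P. f \<one> \<in> {True}} (?I ` carrier G \<union> ?M ` (carrier G \<times> carrier G)))"
    have fI: "f \<in> ?I x" if "x \<in> carrier G" for x using f that by blast
    have fM: "f \<in> ?M (x, y)" if "x \<in> carrier G" "y \<in> carrier G" for x y using f that by blast
    have "f \<in> {f\<in>topspace ?P. f \<one> \<in> {True}}" using f by blast
    then have f1: "f \<one>" "f \<in> topspace ?P" by blast+
    have "subgroup (h f) G"
    proof (rule subgroupI)
      show "h f \<subseteq> carrier G" by (auto simp: h_def)
      show "h f \<noteq> {}" using f1 one_closed by (auto simp: h_def)
      show "inv x \<in> h f" if "x \<in> h f" for x
        using fI[of x] that by (auto simp: h_def)
      show "x \<otimes> y \<in> h f" if "x \<in> h f" "y \<in> h f" for x y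
        using fM[of x y] that by (auto simp: h_def)
    qed
    then show "f \<in> Z" using f1 by (simp add: Z_def Sub_def)
  qed
  also have "closedin ?P \<dots>"
  proof (rule closedin_Inter)
    have cI: "closedin ?P (?I x)" if "x \<in> carrier G" for x
      using that by (intro closedin_Un cl) auto
    have cM: "closedin ?P (?M p)" if "p \<in> carrier G \<times> carrier G" for p
      using that by (intro closedin_Un cl) auto
    have c1: "closedin ?P {f\<in>topspace ?P. f \<one> \<in> {True}}" by (intro cl one_closed)
    show "closedin ?P A" if "A \<in> insert {f\<in>topspace ?P. f \<one> \<in> {True}} (?I ` carrier G \<union> ?M ` (carrier G \<times> carrier G))" for A
      using that cI cM c1 by blast
  qed simp
  finally have "compactin ?P Z"
    by (intro closedin_compact_space) (auto simp: compact_space_product_topology compact_space_discrete_topology)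
  then have "compactin (subtopology ?P Z) Z" by (simp add: compactin_subtopology)
  moreover have "continuous_map (subtopology ?P Z) (Sub_top G) h"
    unfolding Sub_top_def
  proof (rule continuous_map_into_subtopology)
    show "h \<in> topspace (subtopology ?P Z) \<rightarrow> Sub G" by (auto simp: Z_def)
    show "continuous_map (subtopology ?P Z) (topology_generated_by subbasis) h"
    proof (rule continuous_on_generated_topo)
      show "h ` topspace (subtopology ?P Z) \<subseteq> \<Union>subbasis" unfolding Union_subbasis by simp
      fix U assume "U \<in> subbasis"
      then obtain x S where x: "x \<in> carrier G" "h -` U = {f. f x \<in> S}"
      proof (elim UnE CollectE exE conjE)
        fix x assume "U = {H. x \<in> H}" "x \<in> carrier G"
        then show thesis by (intro that[of x "{True}"]) (auto simp: h_def)
      next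
        fix x assume "U = {H. x \<notin> H}" "x \<in> carrier G"
        then show thesis by (intro that[of x "{False}"]) (auto simp: h_def)
      qed
      have "h -` U \<inter> topspace (subtopology ?P Z) = {f\<in>topspace ?P. f x \<in> S} \<inter> Z"
        unfolding x(2) by auto
      then show "openin (subtopology ?P Z) (h -` U \<inter> topspace (subtopology ?P Z))"
        using op[OF x(1), of S] by (auto simp: openin_subtopology)
    qed
  qed
  ultimately have "compactin (Sub_top G) (h ` Z)" by (rule image_compactin)
  moreover have "h ` Z = Sub G"
  proof (intro equalityI subsetI)
    fix H assume H: "H \<in> Sub G"
    then have sub: "H \<subseteq> carrier G" by (auto simp: Sub_def dest: subgroup.subset)
    let ?f = "restrict (\<lambda>x. x \<in> H) (carrier G)"
    have "h ?f = H" using sub by (auto simp: h_def)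
    moreover then have "?f \<in> Z" using H by (auto simp: Z_def)
    ultimately show "H \<in> h ` Z" by blast
  qed (auto simp: Z_def)
  ultimately show ?thesis by (simp add: compact_space_def)
qed

text \<open>By compactness finitely many cylinders contained in the clopen set cover it. Subgroups
  that agree on the union \<open>W\<close> of their windows lie in the same ones of these
  cylinders.\<close>

lemma clopen_determined:
  assumes "C \<in> clopens (Sub_top G)"
  obtains W where "finite W" "W \<subseteq> carrier G"
    "\<And>H K. H \<in> Sub G \<Longrightarrow> K \<in> Sub G \<Longrightarrow> H \<inter> W = K \<inter> W \<Longrightarrow> H \<in> C \<longleftrightarrow> K \<in> C"
proof -
  have C: "openin (Sub_top G) C" "closedin (Sub_top G) C" using assms by (auto simp: clopens_def)
  have "\<forall>H. \<exists>W. H \<in> C \<longrightarrow> finite W \<and> W \<subseteq> carrier G \<and> cylinder W H \<subseteq> C"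
    using cylinder_nbhd[OF C(1)] by metis
  then obtain w where w: "\<And>H. H \<in> C \<Longrightarrow> finite (w H) \<and> w H \<subseteq> carrier G \<and> cylinder (w H) H \<subseteq> C"
    by metis
  have CS: "C \<subseteq> Sub G" using openin_subset[OF C(1)] by simp
  have "compactin (Sub_top G) C" by (rule closedin_compact_space[OF compact_Sub_top C(2)])
  then obtain \<F> where \<F>: "finite \<F>" "\<F> \<subseteq> (\<lambda>H. cylinder (w H) H) ` C" "C \<subseteq> \<Union>\<F>"
  proof (rule compactinD[THEN exE])
    show "openin (Sub_top G) U" if "U \<in> (\<lambda>H. cylinder (w H) H) ` C" for U
      using that w cylinder_clopen by (auto simp: clopens_def)
    show "C \<subseteq> \<Union>((\<lambda>H. cylinder (w H) H) ` C)" using CS by (auto simp: cylinder_def)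
  qed blast
  then obtain D where D: "finite D" "D \<subseteq> C" "\<F> = (\<lambda>H. cylinder (w H) H) ` D"
    using finite_subset_image[OF \<F>(1,2)] by blast
  define W where "W = \<Union>(w ` D)"
  have half: "K \<in> C" if "H \<in> C" "K \<in> Sub G" "H \<inter> W = K \<inter> W" for H K
  proof -
    obtain H0 where H0: "H0 \<in> D" "H \<in> cylinder (w H0) H0" using \<F>(3) D(3) \<open>H \<in> C\<close> by auto
    have "w H0 \<subseteq> W" using H0 by (auto simp: W_def)
    then have "K \<inter> w H0 = H \<inter> w H0" using that(3) by auto
    then have "K \<in> cylinder (w H0) H0" using H0(2) that(2) by (simp add: cylinder_def)
    then show ?thesis using w H0 D by auto
  qed
  show ?thesis
  proof (rule that[of W])
    show "finite W" "W \<subseteq> carrier G" using D w by (auto simp: W_def)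
    show "H \<in> C \<longleftrightarrow> K \<in> C" if "H \<in> Sub G" "K \<in> Sub G" "H \<inter> W = K \<inter> W" for H K
      using half[of H K] half[of K H] that by auto
  qed
qed

sublocale stone_space "Sub_top G"
proof
  show "compact_space (Sub_top G)" by (rule compact_Sub_top)
  show "Hausdorff_space (Sub_top G)"
    unfolding Hausdorff_space_def
  proof (intro allI impI, elim conjE)
    fix H K assume HK: "H \<in> topspace (Sub_top G)" "K \<in> topspace (Sub_top G)" "H \<noteq> K"
    then have "H \<subseteq> carrier G" "K \<subseteq> carrier G" by (auto simp: Sub_def dest: subgroup.subset)
    then obtain x where x: "x \<in> carrier G" "x \<in> H \<longleftrightarrow> x \<notin> K" using HK(3) by blast
    have O: "openin (Sub_top G) {H\<in>Sub G. x \<in> H}" "openin (Sub_top G) {H\<in>Sub G. x \<notin> H}"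
      by (rule openin_mem[OF x(1)], rule openin_not_mem[OF x(1)])
    show "\<exists>U V. openin (Sub_top G) U \<and> openin (Sub_top G) V \<and> H \<in> U \<and> K \<in> V \<and> disjnt U V"
    proof (cases "x \<in> H")
      case True
      then show ?thesis using O HK(1,2) x(2)
        by (intro exI[of _ "{H\<in>Sub G. x \<in> H}"] exI[of _ "{H\<in>Sub G. x \<notin> H}"]) (simp add: disjnt_def, blast)
    next
      case False
      then show ?thesis using O HK(1,2) x(2)
        by (intro exI[of _ "{H\<in>Sub G. x \<notin> H}"] exI[of _ "{H\<in>Sub G. x \<in> H}"]) (simp add: disjnt_def, blast)
    qed
  qed
  show "\<exists>C\<in>clopens (Sub_top G). H \<in> C \<and> C \<subseteq> U" if U: "openin (Sub_top G) U" "H \<in> U" for U H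
  proof -
    obtain W where W: "finite W" "W \<subseteq> carrier G" "cylinder W H \<subseteq> U"
      using cylinder_nbhd[OF U] by blast
    then show ?thesis using cylinder_clopen[OF W(1,2), of H] openin_subset[OF U(1)] U(2)
      by (intro bexI[of _ "cylinder W H"]) (auto simp: cylinder_def)
  qed
  \<comment> \<open>A clopen set is recovered from a finite window and the finite set of traces of
    its members there; a countable group has countably many such pairs.\<close>
  show "countable (clopens (Sub_top G))"
  proof (rule countable_subset)
    let ?Fin = "{W. finite W \<and> W \<subseteq> carrier G}"
    let ?FinFin = "{D. finite D \<and> D \<subseteq> ?Fin}"
    have cF: "countable ?Fin"
      using countable_Collect_finite_subset[OF countable_carrier] by (simp add: conj_commute)
    have cFF: "countable ?FinFin"
      using countable_Collect_finite_subset[OF cF] by (simp add: conj_commute)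
    show "countable ((\<lambda>(W, D). {K\<in>Sub G. K \<inter> W \<in> D}) ` (?Fin \<times> ?FinFin))"
      by (intro countable_image countable_SIGMA cF cFF)
    show "clopens (Sub_top G) \<subseteq> (\<lambda>(W, D). {K\<in>Sub G. K \<inter> W \<in> D}) ` (?Fin \<times> ?FinFin)"
    proof
      fix C assume C: "C \<in> clopens (Sub_top G)"
      obtain W where W: "finite W" "W \<subseteq> carrier G"
        "\<And>H K. H \<in> Sub G \<Longrightarrow> K \<in> Sub G \<Longrightarrow> H \<inter> W = K \<inter> W \<Longrightarrow> H \<in> C \<longleftrightarrow> K \<in> C"
        using clopen_determined[OF C] by blast
      define D where "D = (\<lambda>K. K \<inter> W) ` C"
      have CS: "C \<subseteq> Sub G" using C openin_subset by (fastforce simp: clopens_def)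
      have "D \<subseteq> Pow W" by (auto simp: D_def)
      then have "finite D" using W(1) by (metis finite_Pow_iff finite_subset)
      moreover have "D \<subseteq> ?Fin" using \<open>D \<subseteq> Pow W\<close> W finite_subset by blast
      moreover have "C = {K\<in>Sub G. K \<inter> W \<in> D}"
        using CS W(3) by (auto simp: D_def)
      ultimately show "C \<in> (\<lambda>(W, D). {K\<in>Sub G. K \<inter> W \<in> D}) ` (?Fin \<times> ?FinFin)"
        using W by (intro image_eqI[of _ _ "(W, D)"]) auto
    qed
  qed
qed

text \<open>Membership of \<open>x\<close> in the image is membership of \<open>\<psi> x\<close> in
  the original subgroup, so subbasic sets pull back to subbasic sets. This covers both the shift and
  the conjugations.\<close>

lemma continuous_map_image_Sub:
  assumes \<phi>: "\<And>H. H \<in> Sub G \<Longrightarrow> \<phi> ` H \<in> Sub G"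
    and \<psi>: "\<And>x. x \<in> carrier G \<Longrightarrow> \<psi> x \<in> carrier G"
      "\<And>x. x \<in> carrier G \<Longrightarrow> \<phi> (\<psi> x) = x" "\<And>x. x \<in> carrier G \<Longrightarrow> \<psi> (\<phi> x) = x"
  shows "continuous_map (Sub_top G) (Sub_top G) ((`) \<phi>)"
proof -
  have mem: "x \<in> \<phi> ` H \<longleftrightarrow> \<psi> x \<in> H" if "x \<in> carrier G" "H \<in> Sub G" for x H
  proof
    have "H \<subseteq> carrier G" using that(2) by (auto simp: Sub_def dest: subgroup.subset)
    then show "\<psi> x \<in> H" if "x \<in> \<phi> ` H" using that \<psi>(3) by auto
    show "x \<in> \<phi> ` H" if "\<psi> x \<in> H" using that \<psi>(2)[OF \<open>x \<in> carrier G\<close>] by (metis imageI)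
  qed
  have "continuous_map (Sub_top G) (topology_generated_by subbasis) ((`) \<phi>)"
  proof (rule continuous_on_generated_topo)
    show "(`) \<phi> ` topspace (Sub_top G) \<subseteq> \<Union>subbasis" unfolding Union_subbasis by simp
    fix U assume "U \<in> subbasis"
    then consider x where "U = {H. x \<in> H}" "x \<in> carrier G" | x where "U = {H. x \<notin> H}" "x \<in> carrier G" by auto
    then show "openin (Sub_top G) ((`) \<phi> -` U \<inter> topspace (Sub_top G))"
    proof cases
      case 1
      then have "(`) \<phi> -` U \<inter> topspace (Sub_top G) = {H\<in>Sub G. \<psi> x \<in> H}" using mem by auto
      then show ?thesis using openin_mem \<psi>(1) 1 by simp
    next
      case 2
      then have "(`) \<phi> -` U \<inter> topspace (Sub_top G) = {H\<in>Sub G. \<psi> x \<notin> H}" using mem by auto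
      then show ?thesis using openin_not_mem \<psi>(1) 2 by simp
    qed
  qed
  moreover have "(`) \<phi> \<in> topspace (Sub_top G) \<rightarrow> Sub G" using \<phi> by auto
  ultimately have "continuous_map (Sub_top G) (subtopology (topology_generated_by subbasis) (Sub G)) ((`) \<phi>)"
    by (rule continuous_map_into_subtopology)
  then show ?thesis by (simp only: Sub_top_def)
qed

lemma clopens_determined:
  assumes "finite F" "F \<subseteq> clopens (Sub_top G)"
  shows "\<exists>W. finite W \<and> W \<subseteq> carrier G \<and>
    (\<forall>C\<in>F. \<forall>H\<in>Sub G. \<forall>K\<in>Sub G. H \<inter> W = K \<inter> W \<longrightarrow> (H \<in> C \<longleftrightarrow> K \<in> C))"
  using assms
proof (induction F rule: finite_induct)
  case empty
  show ?case by (rule exI[of _ "{}"]) simp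
next
  case (insert C F)
  then obtain W where W: "finite W" "W \<subseteq> carrier G"
    "\<forall>C\<in>F. \<forall>H\<in>Sub G. \<forall>K\<in>Sub G. H \<inter> W = K \<inter> W \<longrightarrow> (H \<in> C \<longleftrightarrow> K \<in> C)" by auto
  have "C \<in> clopens (Sub_top G)" using insert by simp
  from clopen_determined[OF this] obtain W' where W': "finite W'" "W' \<subseteq> carrier G"
    "\<And>H K. H \<in> Sub G \<Longrightarrow> K \<in> Sub G \<Longrightarrow> H \<inter> W' = K \<inter> W' \<Longrightarrow> H \<in> C \<longleftrightarrow> K \<in> C" by blast
  show ?case
  proof (intro exI[of _ "W \<union> W'"] conjI ballI impI)
    fix D H K assume D: "D \<in> insert C F" and HK: "H \<in> Sub G" "K \<in> Sub G" "H \<inter> (W \<union> W') = K \<inter> (W \<union> W')"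
    have eq: "H \<inter> W = K \<inter> W" "H \<inter> W' = K \<inter> W'" using HK(3) by auto
    show "H \<in> D \<longleftrightarrow> K \<in> D"
    proof (cases "D = C")
      case True
      then show ?thesis using W'(3)[OF HK(1,2) eq(2)] by simp
    next
      case False
      then have "D \<in> F" using D by simp
      from W(3)[rule_format, OF this HK(1,2) eq(1)] show ?thesis .
    qed
  qed (use W W' in auto)
qed

text \<open>Finitely many clopen sets are all decided by one finite window, which reduces the gluing
  property to traces on finite sets of group elements.\<close>

lemma gluing_systemI:
  assumes T: "continuous_map (Sub_top G) (Sub_top G) T"
    and Y: "closedin (Sub_top G) Y" "T ` Y \<subseteq> Y" "y0 \<in> Y" "T y0 = y0"
    and window: "\<And>W. finite W \<Longrightarrow> W \<subseteq> carrier G \<Longrightarrow>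
      \<exists>r. \<forall>M l xs. 0 < M \<longrightarrow> 0 < l \<longrightarrow> (\<forall>k<l. xs k \<in> Y) \<longrightarrow>
        (\<exists>x\<in>Y. (T ^^ (M * l)) x = x \<and>
          (\<forall>k<l. \<forall>j. r \<le> j \<longrightarrow> j + r < M \<longrightarrow> (T ^^ (k * M + j)) x \<inter> W = (T ^^ j) (xs k) \<inter> W))"
  shows "gluing_system (Sub_top G) T Y y0"
proof
  have funpow: "(T ^^ i) x \<in> Sub G" if "x \<in> Y" for i x
  proof -
    have "(T ^^ i) x \<in> Y" using that Y(2) by (induction i) auto
    then show ?thesis using closedin_subset[OF Y(1)] by auto
  qed
  fix F assume F: "finite F" "F \<subseteq> clopens (Sub_top G)"
  obtain W where W: "finite W" "W \<subseteq> carrier G"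
    "\<forall>C\<in>F. \<forall>H\<in>Sub G. \<forall>K\<in>Sub G. H \<inter> W = K \<inter> W \<longrightarrow> (H \<in> C \<longleftrightarrow> K \<in> C)"
    using clopens_determined[OF F] by (elim exE conjE)
  from window[OF W(1,2)] obtain r where r: "\<forall>M l xs. 0 < M \<longrightarrow> 0 < l \<longrightarrow> (\<forall>k<l. xs k \<in> Y) \<longrightarrow>
    (\<exists>x\<in>Y. (T ^^ (M * l)) x = x \<and>
      (\<forall>k<l. \<forall>j. r \<le> j \<longrightarrow> j + r < M \<longrightarrow> (T ^^ (k * M + j)) x \<inter> W = (T ^^ j) (xs k) \<inter> W))"
    by (elim exE)
  show "\<exists>r. \<forall>M l xs. 0 < M \<longrightarrow> 0 < l \<longrightarrow> (\<forall>k<l. xs k \<in> Y) \<longrightarrow>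
    (\<exists>x\<in>Y. (T ^^ (M * l)) x = x \<and>
      (\<forall>C\<in>F. \<forall>k<l. \<forall>j. r \<le> j \<longrightarrow> j + r < M \<longrightarrow>
        ((T ^^ (k * M + j)) x \<in> C \<longleftrightarrow> (T ^^ j) (xs k) \<in> C)))"
  proof (intro exI[of _ r] allI impI)
    fix M l :: nat and xs assume a: "0 < M" "0 < l" "\<forall>k<l. xs k \<in> Y"
    from r[THEN spec, THEN spec, THEN spec, THEN mp, THEN mp, THEN mp, OF a]
    obtain x where x: "x \<in> Y" "(T ^^ (M * l)) x = x"
      "\<forall>k<l. \<forall>j. r \<le> j \<longrightarrow> j + r < M \<longrightarrow> (T ^^ (k * M + j)) x \<inter> W = (T ^^ j) (xs k) \<inter> W"
      by (elim bexE conjE)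
    have "(T ^^ (k * M + j)) x \<in> C \<longleftrightarrow> (T ^^ j) (xs k) \<in> C"
      if "C \<in> F" "k < l" "r \<le> j" "j + r < M" for C k j
      by (rule W(3)[rule_format, OF that(1) funpow[OF x(1)] funpow x(3)[rule_format, OF that(2-4)]])
        (use a(3) that(2) in simp)
    with x(1,2) show "\<exists>x\<in>Y. (T ^^ (M * l)) x = x \<and>
      (\<forall>C\<in>F. \<forall>k<l. \<forall>j. r \<le> j \<longrightarrow> j + r < M \<longrightarrow>
        ((T ^^ (k * M + j)) x \<in> C \<longleftrightarrow> (T ^^ j) (xs k) \<in> C))" by (intro bexI[of _ x]) simp_all
  qed
qed (use T Y in blast)+

section \<open>The conjugation action and the measures it preserves\<close>

definition conjugate :: "'a \<Rightarrow> 'a \<Rightarrow> 'a" where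
  "conjugate g = (\<lambda>h. g \<otimes> h \<otimes> inv g)"

lemma conjugate_mult:
  assumes "g \<in> carrier G" "h \<in> carrier G" "x \<in> carrier G"
  shows "conjugate g (conjugate h x) = conjugate (g \<otimes> h) x"
  using assms by (simp add: conjugate_def inv_mult_group m_assoc)

lemma conjugate_one: "x \<in> carrier G \<Longrightarrow> conjugate \<one> x = x"
  by (simp add: conjugate_def)

lemma conjugate_closed: "g \<in> carrier G \<Longrightarrow> x \<in> carrier G \<Longrightarrow> conjugate g x \<in> carrier G"
  by (simp add: conjugate_def)

lemma conjugate_Sub:
  assumes "g \<in> carrier G" "H \<in> Sub G"
  shows "conjugate g ` H \<in> Sub G"
proof -
  have H: "subgroup H G" using assms(2) by (simp add: Sub_def)
  have sub: "H \<subseteq> carrier G" by (rule subgroup.subset[OF H])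
  have "subgroup (conjugate g ` H) G"
  proof (rule subgroupI)
    show "conjugate g ` H \<subseteq> carrier G" using sub assms(1) by (auto intro!: conjugate_closed)
    show "conjugate g ` H \<noteq> {}" using subgroup.one_closed[OF H] by auto
  next
    fix x assume "x \<in> conjugate g ` H"
    then obtain h where h: "h \<in> H" "x = conjugate g h" by auto
    then have "inv x = conjugate g (inv h)"
      using assms(1) sub by (auto simp: conjugate_def inv_mult_group m_assoc)
    then show "inv x \<in> conjugate g ` H" using subgroup.m_inv_closed[OF H h(1)] by simp
    fix y assume "y \<in> conjugate g ` H"
    then obtain k where k: "k \<in> H" "y = conjugate g k" by auto
    have [simp]: "h \<in> carrier G" "k \<in> carrier G" using h k sub by auto
    have cancel: "inv g \<otimes> (g \<otimes> z) = z" if "z \<in> carrier G" for z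
      using assms(1) that by (simp add: m_assoc[symmetric])
    have "x \<otimes> y = conjugate g (h \<otimes> k)"
      unfolding h(2) k(2) conjugate_def using assms(1) by (simp add: m_assoc cancel)
    then show "x \<otimes> y \<in> conjugate g ` H" using subgroup.m_closed[OF H h(1) k(1)] by simp
  qed
  then show ?thesis by (simp add: Sub_def)
qed

lemma conjugate_image_mult:
  assumes "g \<in> carrier G" "h \<in> carrier G" "H \<in> Sub G"
  shows "conjugate g ` conjugate h ` H = conjugate (g \<otimes> h) ` H"
proof -
  have "H \<subseteq> carrier G" using assms(3) by (auto simp: Sub_def dest: subgroup.subset)
  then show ?thesis unfolding image_image using assms(1,2) by (intro image_cong refl conjugate_mult) auto
qed

lemma conjugate_image_one: "H \<in> Sub G \<Longrightarrow> conjugate \<one> ` H = H"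
proof -
  assume "H \<in> Sub G"
  then have "H \<subseteq> carrier G" by (auto simp: Sub_def dest: subgroup.subset)
  then have "conjugate \<one> ` H = id ` H" by (intro image_cong) (auto simp: conjugate_one)
  then show ?thesis by simp
qed

lemma continuous_map_conjugate:
  assumes g: "g \<in> carrier G"
  shows "continuous_map (Sub_top G) (Sub_top G) ((`) (conjugate g))"
proof (rule continuous_map_image_Sub[where \<psi>="conjugate (inv g)"])
  show "conjugate g ` H \<in> Sub G" if "H \<in> Sub G" for H by (rule conjugate_Sub[OF g that])
qed (simp_all add: g conjugate_closed conjugate_mult conjugate_one)

text \<open>The stabiliser of the measure under conjugation. Closure under product and inverse
  leaves invariance to be checked on generators only.\<close>

definition preserving :: "'a set measure \<Rightarrow> 'a set" where
  "preserving \<mu> = {g\<in>carrier G. \<forall>B\<in>sets \<mu>. emeasure \<mu> {V\<in>Sub G. conjugate g ` V \<in> B} = emeasure \<mu> B}"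

lemma preservingD:
  "g \<in> preserving \<mu> \<Longrightarrow> B \<in> sets \<mu> \<Longrightarrow> emeasure \<mu> {V\<in>Sub G. conjugate g ` V \<in> B} = emeasure \<mu> B"
  by (simp add: preserving_def)

lemma conjugate_vimage_sets:
  assumes "\<mu> \<in> prob_measures (Sub_top G)" "g \<in> carrier G" "B \<in> sets \<mu>"
  shows "{V\<in>Sub G. conjugate g ` V \<in> B} \<in> sets \<mu>"
proof -
  have "(`) (conjugate g) -` B \<inter> space (borel_of (Sub_top G)) \<in> sets (borel_of (Sub_top G))"
    using measurable_continuous_map[OF continuous_map_conjugate[OF assms(2)]] assms(1,3)
    by (intro measurable_sets) (auto simp: prob_measuresD)
  also have "(`) (conjugate g) -` B \<inter> space (borel_of (Sub_top G)) = {V\<in>Sub G. conjugate g ` V \<in> B}" by auto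
  finally show ?thesis using assms(1) by (simp add: prob_measuresD)
qed

lemma preserving_mult:
  assumes \<mu>: "\<mu> \<in> prob_measures (Sub_top G)" and g: "g \<in> preserving \<mu>" and h: "h \<in> preserving \<mu>"
  shows "g \<otimes> h \<in> preserving \<mu>"
proof -
  have gh: "g \<in> carrier G" "h \<in> carrier G" using g h by (auto simp: preserving_def)
  have "emeasure \<mu> {V\<in>Sub G. conjugate (g \<otimes> h) ` V \<in> B} = emeasure \<mu> B" if B: "B \<in> sets \<mu>" for B
  proof -
    let ?B = "{V\<in>Sub G. conjugate g ` V \<in> B}"
    have eq: "{V\<in>Sub G. conjugate (g \<otimes> h) ` V \<in> B} = {V\<in>Sub G. conjugate h ` V \<in> ?B}"
      using gh by (auto simp: conjugate_image_mult conjugate_Sub)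
    show ?thesis
      unfolding eq preservingD[OF h conjugate_vimage_sets[OF \<mu> gh(1) B]] by (rule preservingD[OF g B])
  qed
  then show ?thesis using gh by (simp add: preserving_def)
qed

lemma preserving_inv:
  assumes \<mu>: "\<mu> \<in> prob_measures (Sub_top G)" and g: "g \<in> preserving \<mu>"
  shows "inv g \<in> preserving \<mu>"
proof -
  have gc: "g \<in> carrier G" using g by (simp add: preserving_def)
  have "emeasure \<mu> {V\<in>Sub G. conjugate (inv g) ` V \<in> B} = emeasure \<mu> B" if B: "B \<in> sets \<mu>" for B
  proof -
    let ?B = "{V\<in>Sub G. conjugate (inv g) ` V \<in> B}"
    have BS: "B \<subseteq> Sub G" using sets.sets_into_space[OF B] by (simp add: prob_measuresD(3)[OF \<mu>])
    have "emeasure \<mu> {V\<in>Sub G. conjugate g ` V \<in> ?B} = emeasure \<mu> ?B"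
      by (rule preservingD[OF g conjugate_vimage_sets[OF \<mu> inv_closed[OF gc] B]])
    moreover have "{V\<in>Sub G. conjugate g ` V \<in> ?B} = B"
      using BS gc by (auto simp: conjugate_image_mult conjugate_Sub conjugate_image_one)
    ultimately show ?thesis by simp
  qed
  then show ?thesis using gc by (simp add: preserving_def)
qed

end

section \<open>The lamplighter group and its base\<close>

definition zeroA :: "int \<Rightarrow> nat \<Rightarrow> nat" where
  "zeroA = (\<lambda>_ _. 0)"

text \<open>The outer \<open>mod p\<close> matters at coordinates equal to 0, where
  \<open>p - 0\<close> is not a reduced residue.\<close>

definition negA :: "nat \<Rightarrow> (int \<Rightarrow> nat \<Rightarrow> nat) \<Rightarrow> (int \<Rightarrow> nat \<Rightarrow> nat)" where
  "negA p \<omega> = (\<lambda>i j. (p - \<omega> i j) mod p)"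

definition cut :: "int set \<Rightarrow> (int \<Rightarrow> nat \<Rightarrow> nat) \<Rightarrow> (int \<Rightarrow> nat \<Rightarrow> nat)" where
  "cut I \<omega> = (\<lambda>i. if i \<in> I then \<omega> i else (\<lambda>_. 0))"

lemma shift_shift [simp]: "shift k (shift l \<omega>) = shift (k + l) \<omega>"
  by (simp add: shift_def add.assoc)

lemma shift_0 [simp]: "shift 0 \<omega> = \<omega>"
  by (simp add: shift_def)

lemma shift_add [simp]: "shift k (A_add p a b) = A_add p (shift k a) (shift k b)"
  by (simp add: shift_def A_add_def)

lemma shift_neg [simp]: "shift k (negA p a) = negA p (shift k a)"
  by (simp add: shift_def negA_def)

lemma shift_zero [simp]: "shift k zeroA = zeroA"
  by (simp add: shift_def zeroA_def)

lemma neg_zero [simp]: "negA p zeroA = zeroA"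
  by (simp add: negA_def zeroA_def)

lemma cut_cut [simp]: "cut I (cut I a) = cut I a"
  by (auto simp: cut_def fun_eq_iff)

lemma cut_add [simp]: "cut I (A_add p a b) = A_add p (cut I a) (cut I b)"
  by (auto simp: cut_def A_add_def fun_eq_iff)

lemma cut_neg [simp]: "cut I (negA p a) = negA p (cut I a)"
  by (auto simp: cut_def negA_def fun_eq_iff)

lemma cut_zero [simp]: "cut I zeroA = zeroA"
  by (auto simp: cut_def zeroA_def fun_eq_iff)

lemma cut_id: "(\<And>i. \<omega> i \<noteq> (\<lambda>_. 0) \<Longrightarrow> i \<in> I) \<Longrightarrow> cut I \<omega> = \<omega>"
  unfolding cut_def by (rule ext) (metis (full_types))

lemma image_shift_funpow: "((`) (shift 1) ^^ i) H = shift (int i) ` H"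
proof (induction i)
  case (Suc i)
  then show ?case by (simp add: image_image)
qed (simp add: shift_def)

locale lamplighter =
  fixes n p :: nat
  assumes p: "2 \<le> p" and n: "1 \<le> n"
begin

abbreviation "A \<equiv> A_grp n p"
abbreviation "AC \<equiv> A_carrier n p"
abbreviation "L \<equiv> L_grp n p"
abbreviation "add \<equiv> A_add p"
abbreviation "neg \<equiv> negA p"

lemma carrier_A [simp]: "carrier A = AC" and mult_A [simp]: "x \<otimes>\<^bsub>A\<^esub> y = add x y"
  and one_A [simp]: "\<one>\<^bsub>A\<^esub> = zeroA"
  by (simp_all add: A_grp_def zeroA_def)

lemma carrier_L [simp]: "carrier L = AC \<times> UNIV"
  and mult_L [simp]: "(a, k) \<otimes>\<^bsub>L\<^esub> (b, l) = (add a (shift k b), k + l)"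
  and one_L [simp]: "\<one>\<^bsub>L\<^esub> = (zeroA, 0)"
  by (simp_all add: L_grp_def zeroA_def)

lemma zero_AC [simp]: "zeroA \<in> AC"
  using p by (simp add: A_carrier_def zeroA_def)

lemma add_AC [simp]: "a \<in> AC \<Longrightarrow> b \<in> AC \<Longrightarrow> add a b \<in> AC"
proof -
  assume ab: "a \<in> AC" "b \<in> AC"
  have "{i. add a b i \<noteq> (\<lambda>_. 0)} \<subseteq> {i. a i \<noteq> (\<lambda>_. 0)} \<union> {i. b i \<noteq> (\<lambda>_. 0)}"
    by (auto simp: A_add_def)
  then have "finite {i. add a b i \<noteq> (\<lambda>_. 0)}"
    using ab by (auto simp: A_carrier_def elim: finite_subset)
  then show ?thesis using ab p by (auto simp: A_carrier_def) (auto simp: A_add_def)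
qed

lemma neg_AC [simp]: "a \<in> AC \<Longrightarrow> neg a \<in> AC"
proof -
  assume a: "a \<in> AC"
  have "{i. neg a i \<noteq> (\<lambda>_. 0)} \<subseteq> {i. a i \<noteq> (\<lambda>_. 0)}"
    by (auto simp: negA_def)
  then have "finite {i. neg a i \<noteq> (\<lambda>_. 0)}"
    using a by (auto simp: A_carrier_def elim: finite_subset)
  then show ?thesis using a p by (auto simp: A_carrier_def) (auto simp: negA_def)
qed

lemma cut_AC [simp]: "a \<in> AC \<Longrightarrow> cut I a \<in> AC"
proof -
  assume a: "a \<in> AC"
  have "{i. cut I a i \<noteq> (\<lambda>_. 0)} \<subseteq> {i. a i \<noteq> (\<lambda>_. 0)}"
    by (auto simp: cut_def)
  then have "finite {i. cut I a i \<noteq> (\<lambda>_. 0)}"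
    using a by (auto simp: A_carrier_def elim: finite_subset)
  then show ?thesis using a p by (auto simp: A_carrier_def) (auto simp: cut_def)
qed

lemma shift_AC [simp]: "a \<in> AC \<Longrightarrow> shift k a \<in> AC"
proof -
  assume a: "a \<in> AC"
  have "{i. shift k a i \<noteq> (\<lambda>_. 0)} = (\<lambda>i. i - k) ` {i. a i \<noteq> (\<lambda>_. 0)}"
    by (auto simp: shift_def intro!: image_eqI[of _ "\<lambda>i. i - k" "_ + k"])
  then have "finite {i. shift k a i \<noteq> (\<lambda>_. 0)}"
    using a by (auto simp: A_carrier_def)
  then show ?thesis using a by (auto simp: A_carrier_def) (auto simp: shift_def)
qed

lemma add_assoc: "add (add a b) c = add a (add b c)"
  by (simp add: A_add_def mod_add_left_eq mod_add_right_eq add.assoc)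

lemma add_commute: "add a b = add b a"
  by (simp add: A_add_def add.commute)

lemma add_zero [simp]: "a \<in> AC \<Longrightarrow> add a zeroA = a" "a \<in> AC \<Longrightarrow> add zeroA a = a"
  by (auto simp: A_add_def A_carrier_def zeroA_def)

lemma add_neg [simp]: "a \<in> AC \<Longrightarrow> add (neg a) a = zeroA" "a \<in> AC \<Longrightarrow> add a (neg a) = zeroA"
proof -
  assume a: "a \<in> AC"
  have "((p - a i j) mod p + a i j) mod p = 0" for i j
  proof -
    have "a i j \<le> p" using a by (auto simp: A_carrier_def less_imp_le)
    then show ?thesis by (simp add: mod_add_left_eq)
  qed
  then show "add (neg a) a = zeroA" by (simp add: A_add_def negA_def zeroA_def)
  then show "add a (neg a) = zeroA" by (simp add: add_commute)
qed

lemma group_A: "group A"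
proof (rule groupI)
  fix x assume "x \<in> carrier A"
  then show "\<exists>y\<in>carrier A. y \<otimes>\<^bsub>A\<^esub> x = \<one>\<^bsub>A\<^esub>"
    by (intro bexI[of _ "neg x"]) auto
qed (auto simp: add_assoc)

lemma inv_A [simp]: "a \<in> AC \<Longrightarrow> inv\<^bsub>A\<^esub> a = neg a"
  by (rule group.inv_equality[OF group_A]) auto

lemma group_L: "group L"
proof (rule groupI)
  fix x assume "x \<in> carrier L"
  then obtain a k where x: "x = (a, k)" "a \<in> AC" by auto
  then show "\<exists>y\<in>carrier L. y \<otimes>\<^bsub>L\<^esub> x = \<one>\<^bsub>L\<^esub>"
    by (intro bexI[of _ "(neg (shift (-k) a), -k)"]) auto
qed (auto simp: add_assoc)

lemma inv_L [simp]: "a \<in> AC \<Longrightarrow> inv\<^bsub>L\<^esub> (a, k) = (neg (shift (-k) a), -k)"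
  by (rule group.inv_equality[OF group_L]) auto

lemma Sub_A_iff:
  "H \<in> Sub A \<longleftrightarrow> H \<subseteq> AC \<and> zeroA \<in> H \<and> (\<forall>a\<in>H. \<forall>b\<in>H. add a b \<in> H) \<and> (\<forall>a\<in>H. neg a \<in> H)"
proof
  assume "H \<in> Sub A"
  then have H: "subgroup H A" by (simp add: Sub_def)
  have sub: "H \<subseteq> AC" using subgroup.subset[OF H] by simp
  moreover have "neg a \<in> H" if "a \<in> H" for a
    using subgroup.m_inv_closed[OF H that] sub that by auto
  ultimately show "H \<subseteq> AC \<and> zeroA \<in> H \<and> (\<forall>a\<in>H. \<forall>b\<in>H. add a b \<in> H) \<and> (\<forall>a\<in>H. neg a \<in> H)"
    using subgroup.m_closed[OF H] subgroup.one_closed[OF H] by auto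
next
  assume H: "H \<subseteq> AC \<and> zeroA \<in> H \<and> (\<forall>a\<in>H. \<forall>b\<in>H. add a b \<in> H) \<and> (\<forall>a\<in>H. neg a \<in> H)"
  then have "subgroup H A"
    by (intro group.subgroupI[OF group_A]) (auto simp: subset_iff)
  then show "H \<in> Sub A" by (simp add: Sub_def)
qed

lemma Sub_AD:
  assumes "H \<in> Sub A"
  shows "H \<subseteq> AC" "zeroA \<in> H" "a \<in> H \<Longrightarrow> b \<in> H \<Longrightarrow> add a b \<in> H" "a \<in> H \<Longrightarrow> neg a \<in> H"
proof -
  note H = assms[unfolded Sub_A_iff]
  show "H \<subseteq> AC" "zeroA \<in> H" using H by simp_all
  show "a \<in> H \<Longrightarrow> b \<in> H \<Longrightarrow> add a b \<in> H" using H by simp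
  show "a \<in> H \<Longrightarrow> neg a \<in> H" using H by simp
qed

text \<open>A configuration is recovered from the finite set of triples recording its nonzero
  coordinates.\<close>

lemma countable_AC: "countable AC"
proof -
  let ?f = "\<lambda>\<omega>::int \<Rightarrow> nat \<Rightarrow> nat. {(i, j, \<omega> i j) | i j. \<omega> i j \<noteq> 0}"
  have "finite (?f \<omega>)" if "\<omega> \<in> AC" for \<omega>
  proof -
    have "?f \<omega> \<subseteq> {i. \<omega> i \<noteq> (\<lambda>_. 0)} \<times> {..<n} \<times> {..<p}"
    proof (intro subsetI, elim CollectE exE conjE)
      fix t i j assume t: "t = (i, j, \<omega> i j)" and nz: "\<omega> i j \<noteq> 0"
      then have "\<omega> i \<noteq> (\<lambda>_. 0)" by auto
      moreover have "j < n"
      proof (rule ccontr)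
        assume "\<not> j < n"
        then have "\<omega> i j = 0" using that by (simp add: A_carrier_def)
        with nz show False by contradiction
      qed
      moreover have "\<omega> i j < p" using that by (simp add: A_carrier_def)
      ultimately show "t \<in> {i. \<omega> i \<noteq> (\<lambda>_. 0)} \<times> {..<n} \<times> {..<p}" by (simp add: t)
    qed
    moreover have "finite ({i. \<omega> i \<noteq> (\<lambda>_. 0)} \<times> {..<n} \<times> {..<p})"
      using that by (simp add: A_carrier_def)
    ultimately show ?thesis by (rule finite_subset)
  qed
  then have "?f ` AC \<subseteq> {F. finite F}" by auto
  then have "countable (?f ` AC)"
    by (rule countable_subset) (rule countable_Collect_finite)
  moreover have "inj_on ?f AC"
  proof (rule inj_onI)
    fix a b assume eq: "?f a = ?f b"
    have "a i j = b i j" for i j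
    proof (cases "a i j = 0 \<and> b i j = 0")
      case False
      then have "(i, j, a i j) \<in> ?f a \<or> (i, j, b i j) \<in> ?f b" by auto
      then have "(i, j, a i j) \<in> ?f b \<or> (i, j, b i j) \<in> ?f a" using eq by metis
      then show ?thesis by auto
    qed auto
    then show "a = b" by (intro ext)
  qed
  ultimately show ?thesis by (rule countable_image_inj_on)
qed

lemma countable_group_A: "countable_group A"
  by (simp add: countable_group_def countable_group_axioms_def group_A countable_AC)

lemma countable_group_L: "countable_group L"
  by (simp add: countable_group_def countable_group_axioms_def group_L countable_AC)

lemma shift_Sub: "H \<in> Sub A \<Longrightarrow> shift k ` H \<in> Sub A"
  unfolding Sub_A_iff
proof (elim conjE, intro conjI ballI)
  assume H: "H \<subseteq> AC" "zeroA \<in> H" "\<forall>a\<in>H. \<forall>b\<in>H. add a b \<in> H" "\<forall>a\<in>H. neg a \<in> H"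
  show "shift k ` H \<subseteq> AC" using H by auto
  show "zeroA \<in> shift k ` H" using H(2) by (metis shift_zero imageI)
  fix a assume "a \<in> shift k ` H"
  then obtain a' where a: "a = shift k a'" "a' \<in> H" by blast
  then show "neg a \<in> shift k ` H" using H(4) by (metis shift_neg imageI)
  fix b assume "b \<in> shift k ` H"
  then obtain b' where b: "b = shift k b'" "b' \<in> H" by blast
  show "add a b \<in> shift k ` H" using a b H(3) by (metis shift_add imageI)
qed

lemma mem_shift_image: "\<omega> \<in> shift k ` H \<longleftrightarrow> shift (-k) \<omega> \<in> H"
proof
  assume "shift (-k) \<omega> \<in> H"
  then have "shift k (shift (-k) \<omega>) \<in> shift k ` H" by (rule imageI)
  then show "\<omega> \<in> shift k ` H" by simp
qed auto

section \<open>Gluing blocks of configurations\<close>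

lemma bounded_support:
  assumes "finite W" "W \<subseteq> AC"
  obtains r :: nat where "\<And>\<omega> i. \<omega> \<in> W \<Longrightarrow> \<omega> i \<noteq> (\<lambda>_. 0) \<Longrightarrow> \<bar>i\<bar> \<le> int r"
proof -
  have "finite (\<Union>\<omega>\<in>W. {i. \<omega> i \<noteq> (\<lambda>_. 0)})"
    using assms by (auto simp: A_carrier_def)
  then have fin: "finite ((\<lambda>i. nat \<bar>i\<bar>) ` (\<Union>\<omega>\<in>W. {i. \<omega> i \<noteq> (\<lambda>_. 0)}))" by simp
  show ?thesis
  proof (rule that)
    fix \<omega> i assume "\<omega> \<in> W" "\<omega> i \<noteq> (\<lambda>_. 0)"
    then have "nat \<bar>i\<bar> \<le> Max ((\<lambda>i. nat \<bar>i\<bar>) ` (\<Union>\<omega>\<in>W. {i. \<omega> i \<noteq> (\<lambda>_. 0)}))"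
      by (intro Max_ge[OF fin]) auto
    then show "\<bar>i\<bar> \<le> int (Max ((\<lambda>i. nat \<bar>i\<bar>) ` (\<Union>\<omega>\<in>W. {i. \<omega> i \<noteq> (\<lambda>_. 0)})))" by linarith
  qed
qed

text \<open>Block \<open>q\<close> is brought to the positions \<open>0..<m\<close> and isolated by
  \<open>cut\<close> before it is tested. Shifting and cutting commute with addition and negation,
  so each test is the preimage of a subgroup and the whole is an intersection of subgroups.\<close>

definition glue :: "nat \<Rightarrow> nat \<Rightarrow> (nat \<Rightarrow> (int \<Rightarrow> nat \<Rightarrow> nat) set) \<Rightarrow> (int \<Rightarrow> nat \<Rightarrow> nat) set" where
  "glue m l H = {\<omega>\<in>AC. \<forall>q::int. cut {0..<int m} (shift (q * int m) \<omega>) \<in> H (nat (q mod int l))}"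

lemma glue_Sub:
  assumes "0 < l" "\<And>k. k < l \<Longrightarrow> H k \<in> Sub A"
  shows "glue m l H \<in> Sub A"
proof -
  have "H (nat (q mod int l)) \<in> Sub A" for q
    using assms(1) by (intro assms(2)) (simp add: nat_less_iff)
  then show ?thesis unfolding Sub_A_iff by (auto simp: glue_def)
qed

lemma glue_periodic: "shift (int (m * l)) ` glue m l H = glue m l H"
proof -
  have inv: "\<omega> \<in> glue m l H \<longleftrightarrow> shift (int (m * l)) \<omega> \<in> glue m l H" if "\<omega> \<in> AC" for \<omega>
  proof -
    \<comment> \<open>Shifting by \<open>m * l\<close> replaces block \<open>q\<close> by block
      \<open>q + l\<close>, which has the same residue. The reindexing is isolated with an arbitrary
      predicate.\<close>
    have "(\<forall>q. P (q + int l) (q mod int l)) \<longleftrightarrow> (\<forall>q. P q (q mod int l))" for P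
    proof
      assume a: "\<forall>q. P (q + int l) (q mod int l)"
      show "\<forall>q. P q (q mod int l)"
      proof
        fix q show "P q (q mod int l)" using a[rule_format, of "q - int l"] by simp
      qed
    next
      assume a: "\<forall>q. P q (q mod int l)"
      show "\<forall>q. P (q + int l) (q mod int l)"
      proof
        fix q show "P (q + int l) (q mod int l)" using a[rule_format, of "q + int l"] by simp
      qed
    qed
    from this[of "\<lambda>q s. cut {0..<int m} (shift (q * int m) \<omega>) \<in> H (nat s)"]
    show ?thesis using that by (simp add: glue_def algebra_simps)
  qed
  have "\<omega> \<in> shift (int (m * l)) ` glue m l H \<longleftrightarrow> \<omega> \<in> glue m l H" for \<omega>
  proof (cases "\<omega> \<in> AC")
    case True
    then show ?thesis unfolding mem_shift_image using inv[of "shift (- int (m * l)) \<omega>"] by simp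
  next
    case False
    then have "shift (- int (m * l)) \<omega> \<notin> AC" using shift_AC[of "shift (- int (m * l)) \<omega>" "int (m * l)"] by auto
    with False show ?thesis unfolding mem_shift_image by (simp add: glue_def)
  qed
  then show ?thesis by blast
qed

text \<open>Pulling back moves the support of \<open>\<omega>\<close> to within \<open>r\<close> of
  position \<open>k * m + j\<close>, and the bounds on \<open>j\<close> put it inside block
  \<open>k\<close>. The other blocks see zero, which belongs to every subgroup; block
  \<open>k\<close> sees all of \<open>\<omega>\<close>.\<close>

lemma glue_window:
  assumes H: "\<And>k. k < l \<Longrightarrow> H k \<in> Sub A" and \<omega>: "\<omega> \<in> AC" "\<And>i. \<omega> i \<noteq> (\<lambda>_. 0) \<Longrightarrow> \<bar>i\<bar> \<le> int r"
    and k: "k < l" and j: "r \<le> j" "j + r < m"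
  shows "\<omega> \<in> shift (int (k * m + j)) ` glue m l H \<longleftrightarrow> \<omega> \<in> shift (int j) ` H k"
proof -
  let ?c = "\<lambda>q. cut {0..<int m} (shift (q * int m) (shift (- int (k * m + j)) \<omega>))"
  have zero: "?c q = zeroA" if "q \<noteq> int k" for q
  proof -
    have "\<omega> (i + q * int m - int k * int m - int j) = (\<lambda>_. 0)" if i: "0 \<le> i" "i < int m" for i
    proof (rule ccontr)
      assume "\<omega> (i + q * int m - int k * int m - int j) \<noteq> (\<lambda>_. 0)"
      from \<omega>(2)[OF this] have b: "\<bar>i + (q - int k) * int m - int j\<bar> \<le> int r" by (simp add: algebra_simps)
      consider "1 \<le> q - int k" | "q - int k \<le> -1" using \<open>q \<noteq> int k\<close> by linarith
      then show False
      proof cases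
        case 1
        then have "1 * int m \<le> (q - int k) * int m" by (intro mult_right_mono) auto
        with b i j show False by linarith
      next
        case 2
        then have "(q - int k) * int m \<le> -1 * int m" by (intro mult_right_mono) auto
        with b i j show False by linarith
      qed
    qed
    then show ?thesis
      by (auto simp: cut_def shift_def zeroA_def fun_eq_iff algebra_simps)
  qed
  have main: "?c (int k) = shift (- int j) \<omega>"
  proof -
    have "?c (int k) = cut {0..<int m} (shift (- int j) \<omega>)" by simp
    also have "\<dots> = shift (- int j) \<omega>"
    proof (rule cut_id)
      fix i assume "shift (- int j) \<omega> i \<noteq> (\<lambda>_. 0)"
      then have "\<bar>i - int j\<bar> \<le> int r" by (intro \<omega>(2)) (simp add: shift_def)
      then show "i \<in> {0..<int m}" using j by auto
    qed
    finally show ?thesis .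
  qed
  have z: "zeroA \<in> H (nat (q mod int l))" for q
    using k by (intro Sub_AD(2) H) (simp add: nat_less_iff)
  have "(\<forall>q. ?c q \<in> H (nat (q mod int l))) \<longleftrightarrow> ?c (int k) \<in> H k"
  proof
    assume "\<forall>q. ?c q \<in> H (nat (q mod int l))"
    then have "?c (int k) \<in> H (nat (int k mod int l))" by blast
    then show "?c (int k) \<in> H k" using k by simp
  next
    assume a: "?c (int k) \<in> H k"
    show "\<forall>q. ?c q \<in> H (nat (q mod int l))"
    proof
      fix q show "?c q \<in> H (nat (q mod int l))"
        using a k z zero by (cases "q = int k") auto
    qed
  qed
  then show ?thesis using \<omega>(1) unfolding mem_shift_image by (simp only: glue_def main) simp
qed

lemma gluing_A:
  assumes "finite W" "W \<subseteq> AC"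
  shows "\<exists>r. \<forall>m l H. 0 < m \<longrightarrow> 0 < l \<longrightarrow> (\<forall>k<l. H k \<in> Sub A) \<longrightarrow>
    (\<exists>K\<in>Sub A. shift (int (m * l)) ` K = K \<and>
      (\<forall>k<l. \<forall>j. r \<le> j \<longrightarrow> j + r < m \<longrightarrow>
        shift (int (k * m + j)) ` K \<inter> W = shift (int j) ` H k \<inter> W))"
proof -
  obtain r :: nat where r: "\<And>\<omega> i. \<omega> \<in> W \<Longrightarrow> \<omega> i \<noteq> (\<lambda>_. 0) \<Longrightarrow> \<bar>i\<bar> \<le> int r"
    using bounded_support[OF assms] by blast
  show ?thesis
  proof (intro exI[of _ r] allI impI bexI conjI)
    fix m l :: nat and H k j
    assume "\<forall>k<l. H k \<in> Sub A" "k < l" "r \<le> j" "j + r < m"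
    then have "\<omega> \<in> shift (int (k * m + j)) ` glue m l H \<longleftrightarrow> \<omega> \<in> shift (int j) ` H k" if "\<omega> \<in> W" for \<omega>
      using that assms(2) r[OF that] by (intro glue_window) auto
    then show "shift (int (k * m + j)) ` glue m l H \<inter> W = shift (int j) ` H k \<inter> W" by blast
  qed (simp_all only: glue_periodic glue_Sub)
qed

lemma trivial_Sub_A: "{zeroA} \<in> Sub A"
  unfolding Sub_A_iff using add_zero(1)[OF zero_AC] add_neg(2)[OF zero_AC] add_zero(2)[OF neg_AC[OF zero_AC]] by auto

lemma gluing_system_A: "gluing_system (Sub_top A) ((`) (shift 1)) (Sub A) {zeroA}"
proof -
  interpret countable_group A by (rule countable_group_A)
  show ?thesis
  proof (rule gluing_systemI)
    show "continuous_map (Sub_top A) (Sub_top A) ((`) (shift 1))"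
      by (rule continuous_map_image_Sub[where \<psi>="shift (-1)"]) (auto intro: shift_Sub)
    show "closedin (Sub_top A) (Sub A)" using closedin_topspace[of "Sub_top A"] by simp
  qed (use gluing_A in \<open>simp_all add: image_shift_funpow shift_Sub trivial_Sub_A image_subset_iff\<close>)
qed

lemma poulsen_A: "poulsen_simplex (Sub_top A) (IRS_tau n p)"
proof -
  interpret countable_group A by (rule countable_group_A)
  interpret S: gluing_system "Sub_top A" "(`) (shift 1)" "Sub A" "{zeroA}" by (rule gluing_system_A)
  have "emeasure \<mu> (Sub A) = 1" if "\<mu> \<in> prob_measures (Sub_top A)" for \<mu>
    using prob_space.emeasure_space_1[OF prob_measuresD(1)[OF that]] prob_measuresD(3)[OF that] by simp
  then have "IRS_tau n p = S.K" by (auto simp: IRS_tau_def S.K_def)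
  then show ?thesis using S.poulsen_K by simp
qed

end

section \<open>The perfect kernel of the lamplighter group\<close>

lemma int_subgroup_multiples:
  fixes S :: "int set"
  assumes zero: "0 \<in> S" and diff: "\<And>a b. a \<in> S \<Longrightarrow> b \<in> S \<Longrightarrow> a - b \<in> S"
  shows "\<exists>m::nat. S = {int m * k | k. True}"
proof (cases "S = {0}")
  case True
  then show ?thesis by (intro exI[of _ 0]) auto
next
  case False
  have neg: "- a \<in> S" if "a \<in> S" for a using diff[OF zero that] by simp
  have add: "a + b \<in> S" if "a \<in> S" "b \<in> S" for a b using diff[OF that(1) neg[OF that(2)]] by simp
  have mult: "int k * a \<in> S" if "a \<in> S" for a k
    by (induction k) (use zero add[OF that] in \<open>auto simp: distrib_right\<close>)
  have multz: "a * k \<in> S" if "a \<in> S" for a k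
    using mult[OF that, of "nat k"] neg[OF mult[OF that, of "nat (- k)"]]
    by (cases "0 \<le> k") (auto simp: mult.commute)
  obtain a where a: "a \<in> S" "a \<noteq> 0" using False zero by blast
  have ex: "\<exists>m. 0 < m \<and> int m \<in> S"
  proof (cases "0 < a")
    case True
    then show ?thesis using a by (intro exI[of _ "nat a"]) auto
  next
    case False
    then show ?thesis using a neg[OF a(1)] by (intro exI[of _ "nat (- a)"]) auto
  qed
  define m where "m = (LEAST m. 0 < m \<and> int m \<in> S)"
  have m: "0 < m" "int m \<in> S" using LeastI_ex[OF ex] by (auto simp: m_def)
  have "s \<in> {int m * k | k. True}" if s: "s \<in> S" for s
  proof -
    have "s mod int m = s - int m * (s div int m)" by (simp add: minus_mult_div_eq_mod)
    then have "s mod int m \<in> S" using diff[OF s multz[OF m(2)]] by metis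
    moreover have "int (nat (s mod int m)) = s mod int m" using m(1) by simp
    ultimately have r: "int (nat (s mod int m)) \<in> S" by metis
    have "nat (s mod int m) < m" using m(1) by (simp add: nat_less_iff)
    then have "\<not> 0 < nat (s mod int m)"
      using not_less_Least[of "nat (s mod int m)" "\<lambda>m. 0 < m \<and> int m \<in> S"] r unfolding m_def[symmetric] by metis
    then have "s mod int m = 0" using m(1) by (simp add: order_antisym)
    then have "s = int m * (s div int m)" by (metis add.right_neutral mult_div_mod_eq)
    then show ?thesis by blast
  qed
  then show ?thesis using multz[OF m(2)] by (intro exI[of _ m]) blast
qed

lemma int_multiples_inj:
  assumes "{int m * k | k. True} = {int m' * k | k. True}"
  shows "m = m'"
proof -
  have "int m * 1 \<in> {int m' * k | k. True}" using assms by blast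
  then obtain k where "int m = int m' * k" by auto
  then have "m' dvd m" by (metis dvd_triv_left int_dvd_int_iff)
  have "int m' * 1 \<in> {int m * k | k. True}" using assms by blast
  then obtain k where "int m' = int m * k" by auto
  then have "m dvd m'" by (metis dvd_triv_left int_dvd_int_iff)
  with \<open>m' dvd m\<close> show ?thesis by (simp add: dvd_antisym)
qed

lemma pi1_eqI:
  assumes "snd ` V = {int m * k | k. True}"
  shows "pi1 V = m"
  unfolding pi1_def
proof (rule the_equality)
  show "snd ` V = {int m * k | k. True}" by fact
  fix m' assume "snd ` V = {int m' * k | k. True}"
  then show "m' = m" using assms by (intro int_multiples_inj) simp
qed

context lamplighter
begin

lemma Sub_LD:
  assumes "V \<in> Sub L"
  shows "V \<subseteq> AC \<times> UNIV" "(zeroA, 0) \<in> V"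
    "x \<in> V \<Longrightarrow> y \<in> V \<Longrightarrow> x \<otimes>\<^bsub>L\<^esub> y \<in> V" "x \<in> V \<Longrightarrow> inv\<^bsub>L\<^esub> x \<in> V"
proof -
  have V: "subgroup V L" using assms by (simp add: Sub_def)
  show "V \<subseteq> AC \<times> UNIV" "(zeroA, 0) \<in> V"
    using subgroup.subset[OF V] subgroup.one_closed[OF V] by simp_all
  show "x \<in> V \<Longrightarrow> y \<in> V \<Longrightarrow> x \<otimes>\<^bsub>L\<^esub> y \<in> V" "x \<in> V \<Longrightarrow> inv\<^bsub>L\<^esub> x \<in> V"
    by (fact subgroup.m_closed[OF V]) (fact subgroup.m_inv_closed[OF V])
qed

text \<open>The subgroups of the base, a copy of \<open>Sub A\<close> inside \<open>Sub L\<close>.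
  It is both the fibre of \<open>pi1\<close> over 0 and the perfect kernel, whence
  \<open>IRS_0_eq_IRS_star\<close>.\<close>

definition Y :: "((int \<Rightarrow> nat \<Rightarrow> nat) \<times> int) set set" where
  "Y = {V\<in>Sub L. snd ` V \<subseteq> {0}}"

lemma Y_Times: "H \<in> Sub A \<Longrightarrow> H \<times> {0} \<in> Y"
proof -
  assume H: "H \<in> Sub A"
  note HD = Sub_AD[OF H]
  have "subgroup (H \<times> {0}) L"
  proof (rule group.subgroupI[OF group_L])
    show "H \<times> {0} \<subseteq> carrier L" using HD(1) by auto
    show "H \<times> {0} \<noteq> {}" using HD(2) by auto
    show "inv\<^bsub>L\<^esub> x \<in> H \<times> {0}" if "x \<in> H \<times> {0}" for x
      using that HD(1,4) by auto
    show "x \<otimes>\<^bsub>L\<^esub> y \<in> H \<times> {0}" if "x \<in> H \<times> {0}" "y \<in> H \<times> {0}" for x y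
      using that HD(3) by auto
  qed
  then show ?thesis by (auto simp: Y_def Sub_def)
qed

lemma Sub_L_zero_part:
  assumes "V \<in> Sub L"
  shows "{b. (b, 0) \<in> V} \<in> Sub A"
  unfolding Sub_A_iff
proof (intro conjI ballI)
  note VD = Sub_LD[OF assms]
  show "{b. (b, 0) \<in> V} \<subseteq> AC" "zeroA \<in> {b. (b, 0) \<in> V}" using VD(1,2) by auto
  fix a assume a: "a \<in> {b. (b, 0) \<in> V}"
  then have "a \<in> AC" using VD(1) by auto
  then show "neg a \<in> {b. (b, 0) \<in> V}" using a VD(4)[of "(a, 0)"] by simp
  fix b assume b: "b \<in> {b. (b, 0) \<in> V}"
  show "add a b \<in> {b. (b, 0) \<in> V}" using a b VD(3)[of "(a, 0)" "(b, 0)"] by simp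
qed

lemma Y_cases:
  assumes "V \<in> Y"
  obtains H where "H \<in> Sub A" "V = H \<times> {0}"
proof
  show "{b. (b, 0) \<in> V} \<in> Sub A" using assms by (intro Sub_L_zero_part) (simp add: Y_def)
  show "V = {b. (b, 0) \<in> V} \<times> {0}" using assms by (auto simp: Y_def)
qed

interpretation L: countable_group L by (rule countable_group_L)

text \<open>The base is abelian, so the base part \<open>c\<close> of the conjugating element
  cancels and only the shift remains.\<close>

lemma conjugate_L: "c \<in> AC \<Longrightarrow> b \<in> AC \<Longrightarrow> L.conjugate (c, k) (b, 0) = (shift k b, 0)"
proof -
  assume cb: "c \<in> AC" "b \<in> AC"
  have "add (add c (shift k b)) (neg c) = add (shift k b) (add c (neg c))"
    by (simp only: add_assoc add_commute[of c])
  also have "\<dots> = shift k b" using cb by simp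
  finally show ?thesis using cb by (simp add: L.conjugate_def)
qed

lemma conjugate_Times:
  assumes "c \<in> AC" "H \<in> Sub A"
  shows "L.conjugate (c, k) ` (H \<times> {0}) = (shift k ` H) \<times> {0}"
proof -
  have "H \<subseteq> AC" by (rule Sub_AD[OF assms(2)])
  then have "L.conjugate (c, k) ` (H \<times> {0}) = (\<lambda>x. (shift k (fst x), 0)) ` (H \<times> {0::int})"
    using assms(1) by (intro image_cong) (auto simp: conjugate_L)
  also have "\<dots> = (shift k ` H) \<times> {0}"
  proof (intro equalityI subsetI)
    fix x assume "x \<in> (shift k ` H) \<times> {0::int}"
    then obtain h where "h \<in> H" "x = (shift k h, 0)" by auto
    then show "x \<in> (\<lambda>x. (shift k (fst x), 0)) ` (H \<times> {0::int})"
      by (intro image_eqI[of _ _ "(h, 0)"]) auto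
  qed auto
  finally show ?thesis .
qed

abbreviation T :: "((int \<Rightarrow> nat \<Rightarrow> nat) \<times> int) set \<Rightarrow> ((int \<Rightarrow> nat \<Rightarrow> nat) \<times> int) set" where
  "T \<equiv> (`) (L.conjugate (zeroA, 1))"

lemma T_funpow: "H \<in> Sub A \<Longrightarrow> (T ^^ i) (H \<times> {0}) = (shift (int i) ` H) \<times> {0}"
proof (induction i)
  case 0
  show ?case by simp
next
  case (Suc i)
  then have "(T ^^ Suc i) (H \<times> {0}) = T ((shift (int i) ` H) \<times> {0})" by simp
  also have "\<dots> = (shift 1 ` shift (int i) ` H) \<times> {0}"
    using Suc by (intro conjugate_Times shift_Sub) auto
  finally show ?case by (simp add: image_image)
qed

lemma closedin_Y: "closedin (Sub_top L) Y"
proof -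
  have "Sub L - Y = \<Union>((\<lambda>x. {V\<in>Sub L. x \<in> V}) ` {x\<in>carrier L. snd x \<noteq> 0})"
    using Sub_LD(1) by (fastforce simp: Y_def)
  moreover have "openin (Sub_top L) (\<Union>((\<lambda>x. {V\<in>Sub L. x \<in> V}) ` {x\<in>carrier L. snd x \<noteq> 0}))"
    by (intro openin_Union) (auto intro!: L.openin_mem simp del: carrier_L)
  ultimately show ?thesis by (auto simp: closedin_def Y_def)
qed

text \<open>Transport of \<open>gluing_A\<close> along \<open>H \<mapsto> H \<times> {0}\<close>,
  under which \<open>T\<close> corresponds to the shift; the window is projected to the
  base.\<close>

lemma gluing_system_L: "gluing_system (Sub_top L) T Y {(zeroA, 0)}"
proof (rule L.gluing_systemI)
  show "continuous_map (Sub_top L) (Sub_top L) T"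
    by (rule L.continuous_map_conjugate) simp
  show "closedin (Sub_top L) Y" by (rule closedin_Y)
  show "T ` Y \<subseteq> Y"
  proof
    fix V assume "V \<in> T ` Y"
    then obtain H where "H \<in> Sub A" "V = T (H \<times> {0})" by (auto elim: Y_cases)
    then show "V \<in> Y" by (simp add: conjugate_Times shift_Sub Y_Times)
  qed
  have "{(zeroA, 0)} = {zeroA} \<times> {0::int}" by auto
  then show "{(zeroA, 0)} \<in> Y" using Y_Times[OF trivial_Sub_A] by simp
  show "T {(zeroA, 0)} = {(zeroA, 0)}" by (simp add: conjugate_L)
next
  fix W assume W: "finite W" "W \<subseteq> carrier L"
  then have "finite (fst ` W)" "fst ` W \<subseteq> AC" by auto
  from gluing_A[OF this] obtain r where r: "\<forall>m l H. 0 < m \<longrightarrow> 0 < l \<longrightarrow> (\<forall>k<l. H k \<in> Sub A) \<longrightarrow>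
    (\<exists>K\<in>Sub A. shift (int (m * l)) ` K = K \<and>
      (\<forall>k<l. \<forall>j. r \<le> j \<longrightarrow> j + r < m \<longrightarrow>
        shift (int (k * m + j)) ` K \<inter> fst ` W = shift (int j) ` H k \<inter> fst ` W))" by (elim exE)
  show "\<exists>r. \<forall>M l xs. 0 < M \<longrightarrow> 0 < l \<longrightarrow> (\<forall>k<l. xs k \<in> Y) \<longrightarrow>
    (\<exists>x\<in>Y. (T ^^ (M * l)) x = x \<and>
      (\<forall>k<l. \<forall>j. r \<le> j \<longrightarrow> j + r < M \<longrightarrow> (T ^^ (k * M + j)) x \<inter> W = (T ^^ j) (xs k) \<inter> W))"
  proof (intro exI[of _ r] allI impI)
    fix m l :: nat and V assume ml: "0 < m" "0 < l" "\<forall>k<l. V k \<in> Y"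
    define H where "H k = {b. (b, 0) \<in> V k}" for k
    have H: "H k \<in> Sub A" "V k = H k \<times> {0}" if "k < l" for k
    proof -
      obtain H0 where H0: "H0 \<in> Sub A" "V k = H0 \<times> {0}" using Y_cases ml(3) \<open>k < l\<close> by metis
      moreover have "H k = H0" by (simp add: H_def H0(2))
      ultimately show "H k \<in> Sub A" "V k = H k \<times> {0}" by simp_all
    qed
    have HA: "\<forall>k<l. H k \<in> Sub A" using H by simp
    from r[THEN spec, THEN spec, THEN spec, THEN mp, THEN mp, THEN mp, OF ml(1,2) HA]
    obtain K where K: "K \<in> Sub A" "shift (int (m * l)) ` K = K"
      "\<forall>k<l. \<forall>j. r \<le> j \<longrightarrow> j + r < m \<longrightarrow>
        shift (int (k * m + j)) ` K \<inter> fst ` W = shift (int j) ` H k \<inter> fst ` W" by (elim bexE conjE)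
    \<comment> \<open>Elements of \<open>W\<close> outside the base lie in no member of
      \<open>Y\<close>, so the projected window still decides the traces on
      \<open>W\<close>.\<close>
    have fibre: "(P \<times> {0}) \<inter> W = (P \<inter> fst ` W) \<times> {0} \<inter> W" for P :: "(int \<Rightarrow> nat \<Rightarrow> nat) set"
      by force
    show "\<exists>x\<in>Y. (T ^^ (m * l)) x = x \<and>
      (\<forall>k<l. \<forall>j. r \<le> j \<longrightarrow> j + r < m \<longrightarrow> (T ^^ (k * m + j)) x \<inter> W = (T ^^ j) (V k) \<inter> W)"
    proof (intro bexI[of _ "K \<times> {0}"] conjI allI impI)
      show "K \<times> {0} \<in> Y" by (rule Y_Times[OF K(1)])
      show "(T ^^ (m * l)) (K \<times> {0}) = K \<times> {0}" by (simp only: T_funpow[OF K(1)] K(2))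
      fix k j assume kj: "k < l" "r \<le> j" "j + r < m"
      show "(T ^^ (k * m + j)) (K \<times> {0}) \<inter> W = (T ^^ j) (V k) \<inter> W"
        unfolding T_funpow[OF K(1)] H(2)[OF kj(1)] T_funpow[OF H(1)[OF kj(1)]]
        by (subst (1 2) fibre) (simp only: K(3)[rule_format, OF kj])
    qed
  qed
qed

lemma snd_image_multiples:
  assumes "V \<in> Sub L"
  shows "\<exists>m::nat. snd ` V = {int m * k | k. True}"
proof (rule int_subgroup_multiples)
  note VD = Sub_LD[OF assms]
  show "0 \<in> snd ` V" using VD(2) by force
  fix k l assume "k \<in> snd ` V" "l \<in> snd ` V"
  then obtain a b where ab: "(a, k) \<in> V" "(b, l) \<in> V" by auto
  then have "b \<in> AC" using VD(1) by auto
  then have "(a, k) \<otimes>\<^bsub>L\<^esub> inv\<^bsub>L\<^esub> (b, l) = (add a (shift k (neg (shift (- l) b))), k - l)" by simp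
  moreover have "(a, k) \<otimes>\<^bsub>L\<^esub> inv\<^bsub>L\<^esub> (b, l) \<in> V" using ab by (intro VD)
  ultimately show "k - l \<in> snd ` V" by (metis image_eqI snd_conv)
qed

lemma pi1_eq_0_iff: "V \<in> Sub L \<Longrightarrow> pi1 V = 0 \<longleftrightarrow> V \<in> Y"
proof -
  assume V: "V \<in> Sub L"
  obtain m :: nat where m: "snd ` V = {int m * k | k. True}" using snd_image_multiples[OF V] by blast
  have "m = 0 \<longleftrightarrow> {int m * k | k. True} \<subseteq> {0}"
  proof
    assume "{int m * k | k. True} \<subseteq> {0}"
    then have "int m * 1 \<in> {0}" by blast
    then show "m = 0" by simp
  qed auto
  then show ?thesis using V by (simp add: pi1_eqI[OF m] Y_def m)
qed

text \<open>A measure in the dynamical set is only known to be preserved by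
  \<open>(zeroA, 1)\<close>, hence by its powers. Elements of the base fix every point of
  \<open>Y\<close>, which has full measure, and \<open>(a, k)\<close> is the product of
  \<open>(a, 0)\<close> and \<open>(zeroA, k)\<close>.\<close>

lemma IRS_0_eq_K: "IRS_0 n p = stone_system.K (Sub_top L) T Y"
proof -
  interpret S: gluing_system "Sub_top L" T Y "{(zeroA, 0)}" by (rule gluing_system_L)
  have Y_pi1: "{V\<in>Sub L. pi1 V = 0} = Y" using pi1_eq_0_iff by (auto simp: Y_def)
  have IRS_L: "IRS_L n p = {\<mu>\<in>prob_measures (Sub_top L). carrier L \<subseteq> L.preserving \<mu>}"
    unfolding IRS_L_def L.preserving_def L.conjugate_def by blast
  show ?thesis
  proof (intro equalityI subsetI)
    fix \<mu> assume "\<mu> \<in> IRS_0 n p"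
    then have \<mu>: "\<mu> \<in> prob_measures (Sub_top L)" "carrier L \<subseteq> L.preserving \<mu>" "emeasure \<mu> Y = 1"
      by (auto simp: IRS_0_def IRS_L Y_pi1)
    have "(zeroA, 1) \<in> L.preserving \<mu>" by (rule subsetD[OF \<mu>(2)]) simp
    from L.preservingD[OF this] show "\<mu> \<in> S.K" using \<mu> by (simp add: S.K_def)
  next
    fix \<mu> assume \<mu>K: "\<mu> \<in> S.K"
    then have \<mu>: "\<mu> \<in> prob_measures (Sub_top L)" "emeasure \<mu> Y = 1" by (auto simp: S.K_def)
    note AE_Y = S.K_AE_Y[OF \<mu>K]
    have one: "(zeroA, 1) \<in> L.preserving \<mu>"
      using \<mu>K by (simp add: S.K_def L.preserving_def)
    have nat: "(zeroA, int i) \<in> L.preserving \<mu>" for i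
    proof (induction i)
      case 0
      show ?case
        using S.K_D(4)[OF \<mu>K] L.conjugate_image_one sets.sets_into_space
        by (fastforce simp: L.preserving_def intro!: arg_cong[where f="emeasure \<mu>"])
    next
      case (Suc i)
      then show ?case using L.preserving_mult[OF \<mu>(1) one Suc] by simp
    qed
    have int: "(zeroA, k) \<in> L.preserving \<mu>" for k
    proof (cases "0 \<le> k")
      case True
      then show ?thesis using nat[of "nat k"] by simp
    next
      case False
      have "inv\<^bsub>L\<^esub> (zeroA, int (nat (- k))) = (zeroA, k)"
        using False by simp
      then show ?thesis using L.preserving_inv[OF \<mu>(1) nat[of "nat (- k)"]] by simp
    qed
    have base: "(a, 0) \<in> L.preserving \<mu>" if a: "a \<in> AC" for a
    proof -
      have "emeasure \<mu> {V\<in>Sub L. L.conjugate (a, 0) ` V \<in> B} = emeasure \<mu> B" if B: "B \<in> sets \<mu>" for B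
      proof (rule emeasure_eq_AE)
        show "{V\<in>Sub L. L.conjugate (a, 0) ` V \<in> B} \<in> sets \<mu>"
          using a by (intro L.conjugate_vimage_sets \<mu> B) simp
        show "AE V in \<mu>. V \<in> {V\<in>Sub L. L.conjugate (a, 0) ` V \<in> B} \<longleftrightarrow> V \<in> B"
          using AE_Y
        proof eventually_elim
          case (elim V)
          then obtain H where H: "H \<in> Sub A" "V = H \<times> {0}" by (rule Y_cases)
          then have "L.conjugate (a, 0) ` V = V" by (simp add: conjugate_Times[OF a] )
          then show ?case using elim by (simp add: Y_def)
        qed
      qed (rule B)
      then show ?thesis using a by (simp add: L.preserving_def)
    qed
    have "(a, k) \<in> L.preserving \<mu>" if "a \<in> AC" for a k
      using L.preserving_mult[OF \<mu>(1) base[OF that] int[of k]] that by simp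
    then have "carrier L \<subseteq> L.preserving \<mu>" by auto
    then show "\<mu> \<in> IRS_0 n p" using \<mu> by (simp add: IRS_0_def IRS_L Y_pi1)
  qed
qed

lemma poulsen_L: "poulsen_simplex (Sub_top L) (IRS_0 n p)"
proof -
  interpret S: gluing_system "Sub_top L" T Y "{(zeroA, 0)}" by (rule gluing_system_L)
  show ?thesis using S.poulsen_K by (simp add: IRS_0_eq_K)
qed

section \<open>The subgroups of the base have no isolated point\<close>

lemma restricted_Sub: "H \<in> Sub A \<Longrightarrow> {\<omega>\<in>H. cut I \<omega> = \<omega>} \<in> Sub A"
  and extended_Sub: "H \<in> Sub A \<Longrightarrow> {\<omega>\<in>AC. cut I \<omega> \<in> H} \<in> Sub A"
  by (auto simp: Sub_A_iff)

text \<open>On a bounded window \<open>H\<close> cannot be told apart from the subgroup of its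
  elements supported there, nor from the subgroup of all configurations whose restriction lies in
  \<open>H\<close>. These two differ from each other, so one of them is a different subgroup close
  to \<open>H\<close>.\<close>

lemma Y_perfect: "Sub_top L derived_set_of Y = Y"
proof
  show "Sub_top L derived_set_of Y \<subseteq> Y" using closedin_Y by (simp add: closedin_contains_derived_set)
  show "Y \<subseteq> Sub_top L derived_set_of Y"
  proof
    fix V assume V: "V \<in> Y"
    then obtain H where H: "H \<in> Sub A" "V = H \<times> {0}" by (rule Y_cases)
    show "V \<in> Sub_top L derived_set_of Y"
      unfolding in_derived_set_of
    proof (intro conjI allI impI, goal_cases)
      case 1
      show ?case using V by (simp add: Y_def)
    next
      case (2 U)
      then obtain W where W: "finite W" "W \<subseteq> carrier L" "L.cylinder W V \<subseteq> U"
        using L.cylinder_nbhd[of U V] by blast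
      have W': "finite (fst ` W)" "fst ` W \<subseteq> AC" using W by auto
      obtain r :: nat where r: "\<And>\<omega> i. \<omega> \<in> fst ` W \<Longrightarrow> \<omega> i \<noteq> (\<lambda>_. 0) \<Longrightarrow> \<bar>i\<bar> \<le> int r"
        using bounded_support[OF W'] by blast
      let ?I = "{- int r..int r}"
      have cut: "cut ?I \<omega> = \<omega>" if "\<omega> \<in> fst ` W" for \<omega>
      proof (rule cut_id)
        fix i assume "\<omega> i \<noteq> (\<lambda>_. 0)"
        from r[OF that this] show "i \<in> ?I" by auto
      qed
      define H0 where "H0 = {\<omega>\<in>H. cut ?I \<omega> = \<omega>}"
      define H1 where "H1 = {\<omega>\<in>AC. cut ?I \<omega> \<in> H}"
      have Sub01: "H0 \<in> Sub A" "H1 \<in> Sub A"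
        unfolding H0_def H1_def by (rule restricted_Sub[OF H(1)], rule extended_Sub[OF H(1)])
      \<comment> \<open>A single lamp just outside the interval: its restriction is zero, so it lies
        in \<open>H1\<close>, but it is not supported in the interval.\<close>
      define \<delta> :: "int \<Rightarrow> nat \<Rightarrow> nat" where "\<delta> = (\<lambda>i j. if i = int r + 1 \<and> j = 0 then 1 else 0 :: nat)"
      have "{i. \<delta> i \<noteq> (\<lambda>_. 0)} \<subseteq> {int r + 1}" by (auto simp: \<delta>_def)
      then have "finite {i. \<delta> i \<noteq> (\<lambda>_. 0)}" by (rule finite_subset) simp
      then have "\<delta> \<in> AC" using n p by (auto simp: A_carrier_def) (auto simp: \<delta>_def)
      have "cut ?I \<delta> = zeroA" by (auto simp: cut_def \<delta>_def zeroA_def fun_eq_iff)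
      moreover have "\<delta> \<noteq> zeroA"
      proof
        assume "\<delta> = zeroA"
        then have "\<delta> (int r + 1) 0 = 0" by (simp add: zeroA_def)
        then show False by (simp add: \<delta>_def)
      qed
      ultimately have "\<delta> \<in> H1" "\<delta> \<notin> H0"
        using \<open>\<delta> \<in> AC\<close> Sub_AD(2)[OF H(1)] by (auto simp: H0_def H1_def)
      then have "H0 \<noteq> H1" by blast
      then obtain K where K: "K \<noteq> H" "K = H0 \<or> K = H1" by metis
      have KS: "K \<in> Sub A" using K(2) Sub01 by blast
      have "\<omega> \<in> K \<longleftrightarrow> \<omega> \<in> H" if "\<omega> \<in> fst ` W" for \<omega>
        using K(2) cut[OF that] subsetD[OF W'(2) that] by (auto simp: H0_def H1_def)
      then have "(K \<times> {0}) \<inter> W = V \<inter> W" unfolding H(2) by force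
      then have "K \<times> {0} \<in> L.cylinder W V"
        using Y_Times[OF KS] by (simp add: L.cylinder_def Y_def)
      then have "K \<times> {0} \<in> U" using W(3) by auto
      moreover have "K \<times> {0} \<noteq> V" using K(1) unfolding H(2) by blast
      ultimately show ?case using Y_Times[OF KS] by blast
    qed
  qed
qed

section \<open>Finite generation of the subgroups outside the base\<close>

lemma finite_cut:
  assumes "finite I"
  shows "finite {\<omega>\<in>AC. cut I \<omega> = \<omega>}"
proof -
  let ?f = "\<lambda>\<omega>::int \<Rightarrow> nat \<Rightarrow> nat. restrict (\<lambda>(i, j). \<omega> i j) (I \<times> {..<n})"
  have "?f ` {\<omega>\<in>AC. cut I \<omega> = \<omega>} \<subseteq> PiE (I \<times> {..<n}) (\<lambda>_. {..<p})"
    by (intro image_subsetI iffD2[OF restrict_PiE_iff]) (auto simp: A_carrier_def)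
  then have "finite (?f ` {\<omega>\<in>AC. cut I \<omega> = \<omega>})"
    by (rule finite_subset) (intro finite_PiE finite_cartesian_product assms, auto)
  moreover have "inj_on ?f {\<omega>\<in>AC. cut I \<omega> = \<omega>}"
  proof (rule inj_onI, intro ext)
    fix a b i j assume a: "a \<in> {\<omega>\<in>AC. cut I \<omega> = \<omega>}" and b: "b \<in> {\<omega>\<in>AC. cut I \<omega> = \<omega>}" and eq: "?f a = ?f b"
    show "a i j = b i j"
    proof (cases "i \<in> I \<and> j < n")
      case True
      then have "?f a (i, j) = a i j" "?f b (i, j) = b i j" by simp_all
      with eq show ?thesis by simp
    next
      case False
      have zero: "c i j = 0" if c: "c \<in> {\<omega>\<in>AC. cut I \<omega> = \<omega>}" for c
      proof (cases "j < n")
        case True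
        then have "cut I c i j = 0" using False by (simp add: cut_def)
        then show ?thesis using c by simp
      next
        case False
        then show ?thesis using c by (simp add: A_carrier_def)
      qed
      show ?thesis unfolding zero[OF a] zero[OF b] ..
    qed
  qed
  ultimately show ?thesis by (rule finite_imageD)
qed

text \<open>Noetherianity: with \<^term>\<open>N\<close> viewed as a module over the group ring of the subgroup generated by
  \<^term>\<open>shift (int m)\<close>, the sets of leading blocks of elements of bounded length form an
  increasing chain in a finite set.\<close>

lemma leading_blocks_stabilise:
  assumes "N \<subseteq> AC"
  obtains l0 :: nat where "\<And>l \<omega>. l0 \<le> l \<Longrightarrow> \<omega> \<in> N \<Longrightarrow> cut {- int l..0} \<omega> = \<omega> \<Longrightarrow>
    \<exists>\<omega>'\<in>N. cut {- int l0..0} \<omega>' = \<omega>' \<and> cut {- int m<..0} \<omega>' = cut {- int m<..0} \<omega>"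
proof -
  \<comment> \<open>Supports are bounded above by 0 and length is measured downwards, so
    \<open>{- int m<..0}\<close> holds the top \<open>m\<close> positions, the leading
    block.\<close>
  define D where "D l = cut {- int m<..0} ` {\<omega>\<in>N. cut {- int l..0} \<omega> = \<omega>}" for l :: nat
  let ?Q = "{\<omega>\<in>AC. cut {- int m<..0} \<omega> = \<omega>}"
  have Q: "finite ?Q" by (rule finite_cut) simp
  have DQ: "D l \<subseteq> ?Q" for l
  proof
    fix \<omega> assume "\<omega> \<in> D l"
    then obtain \<omega>' where \<omega>': "\<omega>' \<in> N" "\<omega> = cut {- int m<..0} \<omega>'" by (auto simp: D_def)
    then show "\<omega> \<in> ?Q" using assms by auto
  qed
  have mono: "D l \<subseteq> D l'" if "l \<le> l'" for l l'
  proof -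
    have "cut {- int l'..0} \<omega> = \<omega>" if \<omega>: "cut {- int l..0} \<omega> = \<omega>" for \<omega>
    proof (rule cut_id)
      fix i assume "\<omega> i \<noteq> (\<lambda>_. 0)"
      then have "i \<in> {- int l..0}" using fun_cong[OF \<omega>, of i] by (simp add: cut_def split: if_splits)
      then show "i \<in> {- int l'..0}" using \<open>l \<le> l'\<close> by auto
    qed
    then show ?thesis by (auto simp: D_def)
  qed
  have "finite (range (\<lambda>l. card (D l)))"
  proof (rule finite_subset)
    show "range (\<lambda>l. card (D l)) \<subseteq> {..card ?Q}" using card_mono[OF Q DQ] by auto
  qed simp
  \<comment> \<open>The sets increase with \<open>l\<close>, so they are constant from an index of
    maximal cardinality on.\<close>
  then have "Max (range (\<lambda>l. card (D l))) \<in> range (\<lambda>l. card (D l))" by (rule Max_in) simp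
  then obtain l0 where l0: "card (D l0) = Max (range (\<lambda>l. card (D l)))" by auto
  have stable: "D l0 = D l" if "l0 \<le> l" for l
  proof (rule card_seteq)
    show "finite (D l)" using DQ Q by (rule finite_subset)
    show "D l0 \<subseteq> D l" by (rule mono[OF that])
    show "card (D l) \<le> card (D l0)"
      unfolding l0 by (rule Max_ge) (use \<open>finite (range (\<lambda>l. card (D l)))\<close> in auto)
  qed
  show ?thesis
  proof (rule that)
    fix l \<omega> assume a: "l0 \<le> l" "\<omega> \<in> N" "cut {- int l..0} \<omega> = \<omega>"
    then have "cut {- int m<..0} \<omega> \<in> D l" by (simp add: D_def)
    then have "cut {- int m<..0} \<omega> \<in> D l0" unfolding stable[OF a(1)] .
    then show "\<exists>\<omega>'\<in>N. cut {- int l0..0} \<omega>' = \<omega>' \<and> cut {- int m<..0} \<omega>' = cut {- int m<..0} \<omega>"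
      by (auto simp: D_def)
  qed
qed

text \<open>Division by leading blocks. The generators are an element \<open>?g\<close> projecting
  to \<open>m\<close> and the elements of \<open>N\<close> supported in
  \<open>{- int l0..0}\<close>. Subtracting one of the latter removes the leading block of a longer
  element, and what is left is a shift of a shorter one.\<close>

lemma finitely_generated:
  assumes V: "V \<in> Sub L" "V \<notin> Y"
  shows "\<exists>S. finite S \<and> S \<subseteq> carrier L \<and> V = generate L S"
proof -
  note VD = Sub_LD[OF V(1)]
  obtain m :: nat where m: "snd ` V = {int m * k | k. True}" using snd_image_multiples[OF V(1)] by blast
  have "m \<noteq> 0" using V by (auto simp: m Y_def)
  then have mpos: "0 < m" by simp
  have "int m * 1 \<in> snd ` V" unfolding m by blast
  then obtain a where a: "(a, int m) \<in> V" by auto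
  have aAC: "a \<in> AC" using a VD(1) by auto
  let ?g = "(a, int m)"
  define N where "N = {b. (b, 0) \<in> V}"
  have N: "N \<in> Sub A" unfolding N_def by (rule Sub_L_zero_part[OF V(1)])
  note ND = Sub_AD[OF N]
  have closed: "(shift k b, 0) \<in> Z" if "Z \<in> Sub L" "?g \<in> Z" "(b, 0) \<in> Z" "k = int m \<or> k = - int m" for Z b k
  proof -
    note ZD = Sub_LD[OF that(1)]
    have b: "b \<in> AC" using that(3) ZD(1) by auto
    have conj: "L.conjugate g (b, 0) \<in> Z" if "g \<in> Z" for g
      unfolding L.conjugate_def using that \<open>(b, 0) \<in> Z\<close> by (intro ZD)
    have "inv\<^bsub>L\<^esub> ?g = (neg (shift (- int m) a), - int m)" using aAC by simp
    moreover have "inv\<^bsub>L\<^esub> ?g \<in> Z" using that(2) by (rule ZD)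
    ultimately show ?thesis
      using conj[OF that(2)] conj[of "inv\<^bsub>L\<^esub> ?g"] that(4) aAC b by (auto simp: conjugate_L)
  qed
  obtain l0 :: nat where l0: "\<And>l \<omega>. l0 \<le> l \<Longrightarrow> \<omega> \<in> N \<Longrightarrow> cut {- int l..0} \<omega> = \<omega> \<Longrightarrow>
    \<exists>\<omega>'\<in>N. cut {- int l0..0} \<omega>' = \<omega>' \<and> cut {- int m<..0} \<omega>' = cut {- int m<..0} \<omega>"
    using leading_blocks_stabilise[OF ND(1), where m=m] by blast
  define S where "S = insert ?g ({\<omega>\<in>N. cut {- int l0..0} \<omega> = \<omega>} \<times> {0})"
  have "finite {\<omega>\<in>N. cut {- int l0..0} \<omega> = \<omega>}"
    by (rule finite_subset[OF _ finite_cut[of "{- int l0..0}"]]) (use ND(1) in auto)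
  then have finS: "finite S" by (simp add: S_def)
  have SV: "S \<subseteq> V" using a by (auto simp: S_def N_def)
  then have SL: "S \<subseteq> carrier L" using VD(1) by auto
  let ?Z = "generate L S"
  have Z: "?Z \<in> Sub L" using L.generate_is_subgroup[OF SL] by (simp add: Sub_def)
  note ZD = Sub_LD[OF Z]
  have gZ: "?g \<in> ?Z" by (rule generate.incl) (simp add: S_def)
  have short: "(\<omega>, 0) \<in> ?Z" if "\<omega> \<in> N" "cut {- int l..0} \<omega> = \<omega>" for l \<omega>
    using that
  proof (induction l arbitrary: \<omega> rule: less_induct)
    case (less l)
    have supp: "i \<in> {- int l..0}" if "\<omega> i \<noteq> (\<lambda>_. 0)" for i
      using fun_cong[OF less.prems(2), of i] that by (simp add: cut_def split: if_splits)
    show ?case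
    proof (cases "l \<le> l0")
      case True
      have "cut {- int l0..0} \<omega> = \<omega>"
      proof (rule cut_id)
        fix i assume "\<omega> i \<noteq> (\<lambda>_. 0)"
        from supp[OF this] True show "i \<in> {- int l0..0}" by auto
      qed
      then show ?thesis using less.prems(1) by (intro generate.incl) (simp add: S_def)
    next
      case False
      then obtain \<omega>' where \<omega>': "\<omega>' \<in> N" "cut {- int l0..0} \<omega>' = \<omega>'"
        "cut {- int m<..0} \<omega>' = cut {- int m<..0} \<omega>"
        using l0[of l \<omega>] less.prems by auto
      have \<omega>'Z: "(\<omega>', 0) \<in> ?Z" using \<omega>' by (intro generate.incl) (simp add: S_def)
      have AC: "\<omega> \<in> AC" "\<omega>' \<in> AC" using less.prems(1) \<omega>'(1) ND(1) by auto
      \<comment> \<open>The leading block of \<open>d\<close> is zero, so its support lies at or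
        below \<open>- m\<close>. Shifted up by \<open>m\<close> it is an element of
        \<open>N\<close> shorter by \<open>m\<close>, from which conjugation by \<open>?g\<close>
        recovers \<open>d\<close>.\<close>
      define d where "d = add \<omega> (neg \<omega>')"
      have dN: "d \<in> N" unfolding d_def using less.prems(1) \<omega>'(1) by (intro ND(3) ND(4))
      have dcut: "cut {- int m<..0} d = zeroA" using AC by (simp add: d_def \<omega>'(3))
      have dsupp: "- int l \<le> i \<and> i \<le> - int m" if "d i \<noteq> (\<lambda>_. 0)" for i
      proof -
        have supp': "i \<in> {- int l0..0}" if "\<omega>' i \<noteq> (\<lambda>_. 0)" for i
          using fun_cong[OF \<omega>'(2), of i] that by (simp add: cut_def split: if_splits)
        have "\<omega> i \<noteq> (\<lambda>_. 0) \<or> \<omega>' i \<noteq> (\<lambda>_. 0)"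
        proof (rule ccontr)
          assume "\<not> ?thesis"
          then have "d i = (\<lambda>_. 0)" by (simp add: d_def A_add_def negA_def)
          with that show False by contradiction
        qed
        then have "- int l \<le> i" "i \<le> 0" using supp supp' False by fastforce+
        moreover have "i \<notin> {- int m<..0}"
        proof
          assume "i \<in> {- int m<..0}"
          then have "d i = cut {- int m<..0} d i" by (simp add: cut_def)
          also have "\<dots> = (\<lambda>_. 0)" unfolding dcut by (simp add: zeroA_def)
          finally show False using that by contradiction
        qed
        ultimately show ?thesis by auto
      qed
      let ?s = "shift (- int m) d"
      have "(?s, 0) \<in> V" using dN closed[OF V(1) a, of d "- int m"] by (simp add: N_def)
      then have sN: "?s \<in> N" by (simp add: N_def)
      have "cut {- int (l - m)..0} ?s = ?s"
      proof (rule cut_id)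
        fix i assume "?s i \<noteq> (\<lambda>_. 0)"
        then have "- int l \<le> i - int m \<and> i - int m \<le> - int m" by (intro dsupp) (simp add: shift_def)
        then show "i \<in> {- int (l - m)..0}" by auto
      qed
      then have "(?s, 0) \<in> ?Z" using mpos False by (intro less.IH sN) auto
      from closed[OF Z gZ this, of "int m"] have "(d, 0) \<in> ?Z" by simp
      from ZD(3)[OF this \<omega>'Z] have "(add d \<omega>', 0) \<in> ?Z" by simp
      moreover have "add d \<omega>' = \<omega>" using AC by (simp add: d_def add_assoc)
      ultimately show ?thesis by simp
    qed
  qed
  have NZ: "(\<omega>, 0) \<in> ?Z" if \<omega>: "\<omega> \<in> N" for \<omega>
  proof -
    have fin: "finite {\<omega>}" "{\<omega>} \<subseteq> AC" using \<omega> ND(1) by auto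
    obtain r :: nat where "\<And>\<omega>' i. \<omega>' \<in> {\<omega>} \<Longrightarrow> \<omega>' i \<noteq> (\<lambda>_. 0) \<Longrightarrow> \<bar>i\<bar> \<le> int r"
      using bounded_support[OF fin] by blast
    note r = this[OF singletonI]
    have up: "(shift (int k * int m) \<omega>, 0) \<in> V" for k
    proof (induction k)
      case 0
      show ?case using \<omega> by (simp add: N_def)
    next
      case (Suc k)
      from closed[OF V(1) a this, of "int m"] show ?case by (simp add: distrib_right)
    qed
    \<comment> \<open>Because of \<open>r \<le> r * m\<close>, the shift by \<open>r * m\<close>
      moves a support within distance \<open>r\<close> of 0 to nonpositive positions; conjugating
      with \<open>?g\<close> inverse repeatedly brings the element back.\<close>
    have "int r * 1 \<le> int r * int m" using mpos by (intro mult_left_mono) auto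
    have "cut {- int (r + r * m)..0} (shift (int r * int m) \<omega>) = shift (int r * int m) \<omega>"
    proof (rule cut_id)
      fix i assume "shift (int r * int m) \<omega> i \<noteq> (\<lambda>_. 0)"
      then have "\<bar>i + int r * int m\<bar> \<le> int r" by (intro r) (simp add: shift_def)
      with \<open>int r * 1 \<le> int r * int m\<close> show "i \<in> {- int (r + r * m)..0}" by auto
    qed
    then have "(shift (int r * int m) \<omega>, 0) \<in> ?Z" using up by (intro short[where l="r + r * m"]) (simp_all add: N_def)
    moreover have "(\<omega>, 0) \<in> ?Z" if "(shift (int k * int m) \<omega>, 0) \<in> ?Z" for k
      using that
    proof (induction k)
      case (Suc k)
      from closed[OF Z gZ Suc.prems, of "- int m"] show ?case by (intro Suc.IH) (simp add: distrib_right)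
    qed simp
    ultimately show ?thesis by blast
  qed
  \<comment> \<open>Multiplying by \<open>?g\<close> or its inverse brings the projection
    \<open>m * k\<close> one step closer to 0, where \<open>NZ\<close> applies.\<close>
  have "x \<in> ?Z" if "x \<in> V" "snd x = int m * k" for x k
    using that
  proof (induction "nat \<bar>k\<bar>" arbitrary: x k rule: less_induct)
    case less
    obtain b where x: "x = (b, int m * k)" using less.prems(2) by (cases x) auto
    have xL: "x \<in> carrier L" using less.prems(1) VD(1) by auto
    have gL: "?g \<in> carrier L" using aAC by simp
    consider "k = 0" | "0 < k" | "k < 0" by linarith
    then show ?case
    proof cases
      case 1
      then show ?thesis using less.prems(1) NZ[of b] by (simp add: x N_def)
    next
      case 2
      have "x \<otimes>\<^bsub>L\<^esub> inv\<^bsub>L\<^esub> ?g \<in> ?Z"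
      proof (rule less.hyps)
        show "nat \<bar>k - 1\<bar> < nat \<bar>k\<bar>" using 2 by simp
        show "x \<otimes>\<^bsub>L\<^esub> inv\<^bsub>L\<^esub> ?g \<in> V" using less.prems(1) a by (intro VD)
        show "snd (x \<otimes>\<^bsub>L\<^esub> inv\<^bsub>L\<^esub> ?g) = int m * (k - 1)" using aAC by (simp add: x right_diff_distrib)
      qed
      from ZD(3)[OF this gZ] show ?thesis
        using xL gL L.inv_closed[OF gL] by (simp only: L.m_assoc L.l_inv L.r_one)
    next
      case 3
      have "x \<otimes>\<^bsub>L\<^esub> ?g \<in> ?Z"
      proof (rule less.hyps)
        show "nat \<bar>k + 1\<bar> < nat \<bar>k\<bar>" using 3 by simp
        show "x \<otimes>\<^bsub>L\<^esub> ?g \<in> V" using less.prems(1) a by (intro VD)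
        show "snd (x \<otimes>\<^bsub>L\<^esub> ?g) = int m * (k + 1)" by (simp add: x distrib_left)
      qed
      from ZD(3)[OF this ZD(4)[OF gZ]] show ?thesis
        using xL gL L.inv_closed[OF gL] by (simp only: L.m_assoc L.r_inv L.r_one)
    qed
  qed
  moreover have "\<exists>k. snd x = int m * k" if "x \<in> V" for x
    using imageI[OF that, of snd] unfolding m by blast
  ultimately have "V \<subseteq> ?Z" by blast
  moreover have "?Z \<subseteq> V" using V(1) by (intro L.generate_subgroup_incl SV) (simp add: Sub_def)
  ultimately show ?thesis using finS SL by blast
qed

lemma perfect_kernel_L: "perfect_kernel (Sub_top L) = Y"
proof (rule perfect_kernel_eqI)
  show "compact_space (Sub_top L)" "Hausdorff_space (Sub_top L)" by (rule L.compact, rule L.Hausdorff)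
  show "closedin (Sub_top L) Y" by (rule closedin_Y)
  show "Sub_top L derived_set_of Y = Y" by (rule Y_perfect)
  have "topspace (Sub_top L) - Y \<subseteq> generate L ` {S. finite S \<and> S \<subseteq> carrier L}"
  proof
    fix V assume "V \<in> topspace (Sub_top L) - Y"
    then have "V \<in> Sub L" "V \<notin> Y" by auto
    from finitely_generated[OF this] show "V \<in> generate L ` {S. finite S \<and> S \<subseteq> carrier L}" by blast
  qed
  moreover have "countable {S. finite S \<and> S \<subseteq> carrier L}"
    using countable_Collect_finite_subset[OF L.countable_carrier] by (simp add: conj_commute)
  ultimately show "countable (topspace (Sub_top L) - Y)"
    by (rule countable_subset[OF _ countable_image])
qed

lemma IRS_0_eq_IRS_star: "IRS_0 n p = IRS_star n p"
proof -
  have "{V\<in>Sub L. pi1 V = 0} = Y" using pi1_eq_0_iff by (auto simp: Y_def)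
  then show ?thesis by (simp add: IRS_0_def IRS_star_def perfect_kernel_L)
qed

end

theorem theorem3p3:
  fixes p n :: nat
  assumes "prime p" and "1 \<le> n"
  shows "poulsen_simplex (Sub_top (A_grp n p)) (IRS_tau n p)
       \<and> IRS_0 n p = IRS_star n p
       \<and> poulsen_simplex (Sub_top (L_grp n p)) (IRS_0 n p)"
proof -
  interpret lamplighter n p
    using assms by unfold_locales (auto simp: prime_ge_2_nat)
  show ?thesis
    using poulsen_A IRS_0_eq_IRS_star poulsen_L by blast
qed

end
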